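(* Let $\alpha>0$, $\alpha\notin\mathbb{N}$, $\lambda\in\mathbb{R}$, $a\in\mathbb{R}$ and $f\in L^2(0,T)$. Then there exists a unique solution $u=u(t)$ to the initial value problem $$\partial_t^\alpha(u-a)(t)=-\lambda u(t)+f(t),\quad 0<t<T,\qquad u-a\in H_\alpha(0,T).$$ Moreover $$u(t)=aE_{\alpha,1}(-\lambda t^\alpha)+\int_0^t(t-s)^{\alpha-1}E_{\alpha,\alpha}(-\lambda(t-s)^\alpha)f(s)\,ds,\quad 0<t<T.$$
   Context: Let $T>0$. The constant function with value $a$ is denoted by $a$. The Mittag-Leffler functions are $E_{\alpha,\beta}(z)=\sum_{k=0}^\infty\frac{z^k}{\Gamma(\alpha k+\beta)}$, $\alpha,\beta>0$, $z\in\mathbb{C}$. For $\alpha>0$, $(J^\alpha v)(t)=\frac1{\Gamma(\alpha)}\int_0^t(t-s)^{\alpha-1}v(s)ds$ for $v\in L^2(0,T)$. Spaces. For $0<\sigma<1$, $H^\sigma(0,T)$ is the Sobolev–Slobodeckij space; for $m\in\mathbb{N}$, $H^m(0,T)$ is the usual Sobolev space. For $0<\sigma\le1$: $H_\sigma(0,T)=H^\sigma(0,T)$ if $\sigma<\frac12$; $H_{1/2}(0,T)=\{v\in H^{1/2}(0,T): \int_0^T\frac{|v(t)|^2}{t}dt<\infty\}$; $H_\sigma(0,T)=\{v\in H^\sigma(0,T): v(0)=0\}$ if $\frac12<\sigma\le 1$. For $m\in\mathbb{N}$, $H_m(0,T)=\{v\in H^m(0,T): v(0)=\dots=\frac{d^{m-1}v}{dt^{m-1}}(0)=0\}$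 and, for $0<\sigma\le1$, $H_{m+\sigma}(0,T)=\{v\in H_m(0,T):\frac{d^mv}{dt^m}\in H_\sigma(0,T)\}$. The operator $J^\alpha:L^2(0,T)\to H_\alpha(0,T)$ is an isomorphism, so $H_\alpha(0,T)=J^\alpha L^2(0,T)$, and $\partial_t^\alpha:=(J^\alpha)^{-1}$ with domain $H_\alpha(0,T)$ and values in $L^2(0,T)$. The equation is understood in $L^2(0,T)$. *)

theory Defs
  imports "HOL-Analysis.Analysis"
begin

text \<open>Elements of \<open>L\<^sup>2(0,T)\<close> and of the Sobolev spaces are represented by real-valued functions
  on the line; only the values on the open interval matter, and only up to null sets.
  The spaces \<open>L\<^sup>2\<close> and \<open>H\<close> below are closed under equality almost everywhere on \<open>(0,T)\<close>.\<close>

abbreviation leb_interval :: "real \<Rightarrow> real measure" where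
  "leb_interval T \<equiv> lebesgue_on {0<..<T}"

definition L2 :: "real \<Rightarrow> (real \<Rightarrow> real) set" where
  "L2 T = {v. v \<in> borel_measurable (leb_interval T)
            \<and> integrable (leb_interval T) (\<lambda>t. (v t)\<^sup>2)}"

definition Mittag_Leffler :: "real \<Rightarrow> real \<Rightarrow> 'a \<Rightarrow> 'a::{real_normed_field, banach}" where
  "Mittag_Leffler \<alpha> \<beta> z = (\<Sum>k. z ^ k /\<^sub>R Gamma (\<alpha> * real k + \<beta>))"

definition frac_integral :: "real \<Rightarrow> (real \<Rightarrow> real) \<Rightarrow> real \<Rightarrow> real" where
  "frac_integral \<alpha> v t =
     1 / Gamma \<alpha> * (LINT s|lebesgue_on {0<..<t}. (t - s) powr (\<alpha> - 1) * v s)"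

text \<open>Smooth functions with support in \<open>(0,T)\<close>; the support is automatically compact,
  being closed and bounded.\<close>

definition test_functions :: "real \<Rightarrow> (real \<Rightarrow> real) set" where
  "test_functions T = {\<phi>. (\<forall>k x. (deriv ^^ k) \<phi> field_differentiable at x)
                        \<and> closure {x. \<phi> x \<noteq> 0} \<subseteq> {0<..<T}}"

text \<open>\<open>w\<close> is the weak (distributional) derivative of order \<open>k\<close> of \<open>v\<close> on \<open>(0,T)\<close>; used only for
  \<open>v\<close> and \<open>w\<close> in \<open>L\<^sup>2(0,T)\<close>, where both integrals exist. It determines \<open>w\<close> up to a null set.\<close>

definition weak_deriv :: "real \<Rightarrow> nat \<Rightarrow> (real \<Rightarrow> real) \<Rightarrow> (real \<Rightarrow> real) \<Rightarrow> bool" where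
  "weak_deriv T k v w \<longleftrightarrow>
     (\<forall>\<phi>\<in>test_functions T.
        (LINT t|leb_interval T. v t * (deriv ^^ k) \<phi> t)
        = (-1) ^ k * (LINT t|leb_interval T. w t * \<phi> t))"

definition sobolev :: "nat \<Rightarrow> real \<Rightarrow> (real \<Rightarrow> real) set" where
  "sobolev m T = {v \<in> L2 T. \<forall>k\<le>m. \<exists>w\<in>L2 T. weak_deriv T k v w}"

text \<open>On the diagonal the quotient is \<open>0 / 0 = 0\<close>, which does not matter for the integral.\<close>

definition slobodeckij :: "real \<Rightarrow> real \<Rightarrow> (real \<Rightarrow> real) set" where
  "slobodeckij \<sigma> T = {v \<in> L2 T.
     (\<integral>\<^sup>+t. (\<integral>\<^sup>+s. ennreal ((v t - v s)\<^sup>2 / \<bar>t - s\<bar> powr (1 + 2 * \<sigma>))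
        \<partial>leb_interval T) \<partial>leb_interval T) < \<infinity>}"

text \<open>The condition \<open>v(0) = 0\<close> refers to the representative of \<open>v\<close> that is continuous on \<open>[0,T]\<close>.
  It is only imposed where the Sobolev embedding provides one.\<close>

definition zero_at_0 :: "real \<Rightarrow> (real \<Rightarrow> real) \<Rightarrow> bool" where
  "zero_at_0 T v \<longleftrightarrow>
     (\<exists>g. continuous_on {0..T} g \<and> (AE t in leb_interval T. v t = g t) \<and> g 0 = 0)"

text \<open>The spaces \<open>H\<^sub>\<sigma>(0,T)\<close> for \<open>0 < \<sigma> \<le> 1\<close>.\<close>

definition H_unit :: "real \<Rightarrow> real \<Rightarrow> (real \<Rightarrow> real) set" where
  "H_unit \<sigma> T =
     (if \<sigma> < 1/2 then slobodeckij \<sigma> T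
      else if \<sigma> = 1/2 then
        {v \<in> slobodeckij (1/2) T. (\<integral>\<^sup>+t. ennreal ((v t)\<^sup>2 / t) \<partial>leb_interval T) < \<infinity>}
      else if \<sigma> < 1 then {v \<in> slobodeckij \<sigma> T. zero_at_0 T v}
      else {v \<in> sobolev 1 T. zero_at_0 T v})"

text \<open>The spaces \<open>H\<^sub>m(0,T)\<close> for natural \<open>m\<close>, with \<open>H\<^sub>0(0,T) = L\<^sup>2(0,T)\<close>.\<close>

definition H_nat :: "nat \<Rightarrow> real \<Rightarrow> (real \<Rightarrow> real) set" where
  "H_nat m T = {v \<in> sobolev m T. \<forall>k<m. \<exists>w\<in>L2 T. weak_deriv T k v w \<and> zero_at_0 T w}"

text \<open>The spaces \<open>H\<^sub>\<alpha>(0,T)\<close> for real \<open>\<alpha> > 0\<close>, with \<open>\<alpha> = m + \<sigma>\<close>, \<open>m\<close> natural and \<open>0 < \<sigma> \<le> 1\<close>.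
  For \<open>\<alpha> \<le> 1\<close> we have \<open>m = 0\<close>, and the weak derivative of order \<open>0\<close> is \<open>v\<close> itself.\<close>

definition H_frac :: "real \<Rightarrow> real \<Rightarrow> (real \<Rightarrow> real) set" where
  "H_frac \<alpha> T =
     (let m = nat (\<lceil>\<alpha>\<rceil> - 1) in
      {v \<in> H_nat m T. \<exists>w\<in>H_unit (\<alpha> - real m) T. weak_deriv T m v w})"

text \<open>The graph of \<open>\<partial>\<^sub>t\<^sup>\<alpha> = (J\<^sup>\<alpha>)\<^sup>-\<^sup>1\<close>, with domain \<open>H\<^sub>\<alpha>(0,T)\<close> and values in \<open>L\<^sup>2(0,T)\<close>:
  \<open>has_frac_deriv \<alpha> T v w\<close> means \<open>\<partial>\<^sub>t\<^sup>\<alpha> v = w\<close> in \<open>L\<^sup>2(0,T)\<close>. A relation is used because \<open>w\<close> is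
  determined only up to a null set.\<close>

definition has_frac_deriv :: "real \<Rightarrow> real \<Rightarrow> (real \<Rightarrow> real) \<Rightarrow> (real \<Rightarrow> real) \<Rightarrow> bool" where
  "has_frac_deriv \<alpha> T v w \<longleftrightarrow>
     v \<in> H_frac \<alpha> T \<and> w \<in> L2 T \<and> (AE t in leb_interval T. frac_integral \<alpha> w t = v t)"

definition is_solution ::
  "real \<Rightarrow> real \<Rightarrow> real \<Rightarrow> real \<Rightarrow> (real \<Rightarrow> real) \<Rightarrow> (real \<Rightarrow> real) \<Rightarrow> bool" where
  "is_solution \<alpha> T lam a f u \<longleftrightarrow>
     (\<lambda>t. u t - a) \<in> H_frac \<alpha> T \<and>
     has_frac_deriv \<alpha> T (\<lambda>t. u t - a) (\<lambda>t. - lam * u t + f t)"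

end

theory Submission
  imports Defs
begin

text \<open>
  Write \<open>k\<close> for the kernel \<open>t\<^sup>\<alpha>\<^sup>-\<^sup>1 / \<Gamma>(\<alpha>)\<close> of \<open>J\<^sup>\<alpha>\<close> and \<open>*\<close> for convolution. For \<open>v = u - a\<close> the problem says that
  \<open>v = k * (f - \<lambda> a - \<lambda> v)\<close> and that \<open>v\<close> lies in \<open>H\<^sub>\<alpha>(0,T)\<close>. It splits into an algebraic and an analytic part.

  The algebraic part is a Volterra equation. Its resolvent kernel \<open>r = t\<^sup>\<alpha>\<^sup>-\<^sup>1 E\<^bsub>\<alpha>,\<alpha>\<^esub>(- \<lambda> t\<^sup>\<alpha>)\<close> is the Neumann
  series \<open>k - \<lambda> k * k + \<lambda>\<^sup>2 k * k * k - \<dots>\<close>, since the Beta integral shows that convolution adds the orders of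
  the kernels; hence \<open>r = k - \<lambda> k * r\<close> (\<open>resolvent_equation\<close>). Associativity of convolution turns this into
  existence, \<open>v = r * (f - \<lambda> a)\<close> (\<open>resolvent_solves\<close>), and uniqueness (\<open>resolvent_unique\<close>). Since
  \<open>E\<^bsub>\<alpha>,1\<^esub>(- \<lambda> t\<^sup>\<alpha>) = 1 - \<lambda> (1 * r)(t)\<close>, this \<open>v\<close> is the asserted formula.

  The analytic part is that \<open>J\<^sup>\<alpha>\<close> maps \<open>L\<^sup>2(0,T)\<close> into \<open>H\<^sub>\<alpha>(0,T)\<close> (\<open>frac_integral_in_H_frac\<close>); the formula then
  lies in the right space because \<open>v\<close> is \<open>J\<^sup>\<alpha>\<close> of a square-integrable function. Integer derivatives lower the
  order by Fubini's theorem, so the core is the order \<open>0 < \<sigma> < 1\<close>, where the Slobodeckij seminorm of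
  \<open>J\<^sup>\<sigma> w\<close> must be finite. An increment with step \<open>h\<close> of \<open>J\<^sup>\<sigma> w\<close> is \<open>h\<^sup>\<sigma>\<close> times the convolution of \<open>w\<close> with the dilation
  by \<open>h\<close> of one fixed function \<open>d\<close> of mean zero (\<open>kernel_diff\<close>), and the seminorm becomes
  \<open>\<integral> \<parallel>d\<^sub>h * w\<parallel>\<^sup>2 dh / h\<close>. Estimating the norms one by one loses a logarithm. Instead the square is expanded: with
  the autocorrelation \<open>c\<close> of \<open>w\<close>, which is bounded by \<open>\<parallel>w\<parallel>\<^sup>2\<close>, the integral over \<open>\<epsilon> < h < R\<close> is
  \<open>\<integral>\<integral> d(p) d(q) \<integral> c(h (p - q)) dh / h dp dq\<close>. The inner integral differs from
  its value at \<open>p - q = 1\<close> by at most \<open>2 \<parallel>w\<parallel>\<^sup>2 \<bar>ln \<bar>p - q\<bar>\<bar>\<close>, uniformly in \<open>\<epsilon>\<close> and \<open>R\<close>, and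
  constants are annihilated by \<open>d\<close> (\<open>square_function_bound\<close>). So only the logarithmic energy of \<open>d\<close> has to be
  finite. The same estimate on the whole line also contains the weighted condition \<open>\<integral> v\<^sup>2 / t < \<infinity>\<close> of the case
  \<open>\<sigma> = 1/2\<close> (\<open>frac_integral_Hardy_finite\<close>), while for \<open>\<sigma> > 1/2\<close> Cauchy-Schwarz
  gives Hoelder continuity and the value \<open>0\<close> at \<open>0\<close>.
\<close>

section \<open>Convolution of integrable functions\<close>

text \<open>All convolutions are taken over the whole line. An integrand that is not integrable contributes the
  default value \<open>0\<close>; for the integrable factors here, and for the causal ones below, this happens only for
  \<open>t\<close> in a null set, which is why most identities hold almost everywhere.\<close>

definition conv :: "(real \<Rightarrow> real) \<Rightarrow> (real \<Rightarrow> real) \<Rightarrow> real \<Rightarrow> real" where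
  "conv f g t = (\<integral>s. f (t - s) * g s \<partial>lborel)"

lemma borel_measurable_conv [measurable]:
  assumes [measurable]: "f \<in> borel_measurable borel" "g \<in> borel_measurable borel"
  shows "conv f g \<in> borel_measurable borel"
  unfolding conv_def[abs_def] by measurable

lemma nn_integral_shift:
  fixes f :: "real \<Rightarrow> ennreal"
  assumes "f \<in> borel_measurable borel"
  shows "(\<integral>\<^sup>+x. f (x - s) \<partial>lborel) = (\<integral>\<^sup>+x. f x \<partial>lborel)"
  using nn_integral_real_affine[OF assms, of 1 "- s"] by simp

lemma conv_commute: "conv f g t = conv g f t"
  unfolding conv_def
  by (subst lborel_integral_real_affine[of "-1" _ t]) (simp_all add: mult.commute)

lemma integrable_conv_pair:
  fixes f g :: "real \<Rightarrow> real"
  assumes f: "integrable lborel f" and g: "integrable lborel g"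
  shows "integrable (lborel \<Otimes>\<^sub>M lborel) (\<lambda>(t, s). f (t - s) * g s :: real)"
proof (rule integrableI_bounded)
  have [measurable]: "f \<in> borel_measurable borel" "g \<in> borel_measurable borel"
    using f g by auto
  show "(\<lambda>(t, s). f (t - s) * g s) \<in> borel_measurable (lborel \<Otimes>\<^sub>M lborel)"
    by measurable
  have "(\<integral>\<^sup>+p. ennreal (norm (case p of (t, s) \<Rightarrow> f (t - s) * g s)) \<partial>(lborel \<Otimes>\<^sub>M lborel))
      = (\<integral>\<^sup>+s. \<integral>\<^sup>+t. ennreal \<bar>f (t - s)\<bar> * ennreal \<bar>g s\<bar> \<partial>lborel \<partial>lborel)"
    by (subst lborel_pair.nn_integral_snd[symmetric]) (auto simp: abs_mult ennreal_mult')
  also have "\<dots> = (\<integral>\<^sup>+s. (\<integral>\<^sup>+t. ennreal \<bar>f (t - s)\<bar> \<partial>lborel) * ennreal \<bar>g s\<bar> \<partial>lborel)"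
    by (simp add: nn_integral_multc)
  also have "\<dots> = (\<integral>\<^sup>+t. ennreal \<bar>f t\<bar> \<partial>lborel) * (\<integral>\<^sup>+s. ennreal \<bar>g s\<bar> \<partial>lborel)"
    by (subst nn_integral_shift[where f="\<lambda>t. ennreal \<bar>f t\<bar>"]) (auto simp: nn_integral_cmult)
  also have "\<dots> < \<infinity>"
    using f g by (auto simp: integrable_iff_bounded ennreal_mult_less_top)
  finally show "(\<integral>\<^sup>+p. ennreal (norm (case p of (t, s) \<Rightarrow> f (t - s) * g s)) \<partial>(lborel \<Otimes>\<^sub>M lborel)) < \<infinity>" .
qed

lemma AE_integrable_conv:
  fixes f g :: "real \<Rightarrow> real"
  assumes "integrable lborel f" "integrable lborel g"
  shows "AE t in lborel. integrable lborel (\<lambda>s. f (t - s) * g s :: real)"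
  using lborel_pair.AE_integrable_fst'[OF integrable_conv_pair[OF assms]] by simp

lemma integrable_conv:
  fixes f g :: "real \<Rightarrow> real"
  assumes "integrable lborel f" "integrable lborel g"
  shows "integrable lborel (conv f g)"
  using lborel_pair.integrable_fst'[OF integrable_conv_pair[OF assms]]
  by (simp add: conv_def[abs_def])

text \<open>For almost every \<open>t\<close> the triple integrand is integrable in the two remaining variables, by Tonelli;
  at such \<open>t\<close> both sides are the two iterated integrals of it.\<close>

lemma AE_conv_assoc:
  fixes f g :: "real \<Rightarrow> real"
  assumes f: "integrable lborel f" and g: "integrable lborel g" and h: "integrable lborel h"
  shows "AE t in lborel. conv f (conv g h) t = conv (conv f g) h t"
proof -
  have [measurable]: "f \<in> borel_measurable borel" "g \<in> borel_measurable borel"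
    "h \<in> borel_measurable borel"
    using f g h by auto
  have gh: "integrable (lborel \<Otimes>\<^sub>M lborel) (\<lambda>(s, u). g (s - u) * h u)"
    by (rule integrable_conv_pair[OF g h])
  have "integrable (lborel \<Otimes>\<^sub>M (lborel \<Otimes>\<^sub>M lborel)) (\<lambda>(t, s, u). f (t - s) * (g (s - u) * h u))"
  proof (rule integrableI_bounded)
    show "(\<lambda>(t, s, u). f (t - s) * (g (s - u) * h u)) \<in> borel_measurable (lborel \<Otimes>\<^sub>M lborel \<Otimes>\<^sub>M lborel)"
      by measurable
    interpret P: pair_sigma_finite lborel "lborel \<Otimes>\<^sub>M lborel :: (real \<times> real) measure" ..
    have "(\<integral>\<^sup>+p. ennreal (norm (case p of (t, s, u) \<Rightarrow> f (t - s) * (g (s - u) * h u)))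
            \<partial>(lborel \<Otimes>\<^sub>M lborel \<Otimes>\<^sub>M lborel))
      = (\<integral>\<^sup>+q. \<integral>\<^sup>+t. ennreal \<bar>f (t - fst q)\<bar> * ennreal \<bar>g (fst q - snd q) * h (snd q)\<bar> \<partial>lborel
            \<partial>(lborel \<Otimes>\<^sub>M lborel))"
      by (subst P.nn_integral_snd[symmetric]) (auto simp: abs_mult ennreal_mult' split_beta)
    also have "\<dots> = (\<integral>\<^sup>+q. (\<integral>\<^sup>+t. ennreal \<bar>f (t - fst q)\<bar> \<partial>lborel)
            * ennreal \<bar>g (fst q - snd q) * h (snd q)\<bar> \<partial>(lborel \<Otimes>\<^sub>M lborel))"
      by (simp add: nn_integral_multc)
    also have "\<dots> = (\<integral>\<^sup>+t. ennreal \<bar>f t\<bar> \<partial>lborel)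
            * (\<integral>\<^sup>+q. ennreal \<bar>g (fst q - snd q) * h (snd q)\<bar> \<partial>(lborel \<Otimes>\<^sub>M lborel))"
      by (subst nn_integral_shift[where f="\<lambda>t. ennreal \<bar>f t\<bar>"]) (auto simp: nn_integral_cmult)
    also have "\<dots> < \<infinity>"
      using f gh by (auto simp: integrable_iff_bounded ennreal_mult_less_top split_beta)
    finally show "(\<integral>\<^sup>+p. ennreal (norm (case p of (t, s, u) \<Rightarrow> f (t - s) * (g (s - u) * h u)))
            \<partial>(lborel \<Otimes>\<^sub>M lborel \<Otimes>\<^sub>M lborel)) < \<infinity>" .
  qed
  from pair_sigma_finite.AE_integrable_fst'[OF _ this]
  have "AE t in lborel. integrable (lborel \<Otimes>\<^sub>M lborel) (\<lambda>(s, u). f (t - s) * (g (s - u) * h u))"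
    by (simp add: pair_sigma_finite_def lborel.sigma_finite_measure_axioms
        lborel_pair.P.sigma_finite_measure_axioms case_prod_unfold)
  then show ?thesis
  proof eventually_elim
    case (elim t)
    have "conv f (conv g h) t = (\<integral>s. \<integral>u. f (t - s) * (g (s - u) * h u) \<partial>lborel \<partial>lborel)"
      by (simp add: conv_def)
    also have "\<dots> = (\<integral>u. \<integral>s. f (t - s) * (g (s - u) * h u) \<partial>lborel \<partial>lborel)"
      using lborel_pair.Fubini_integral[OF elim] by simp
    also have "\<dots> = (\<integral>u. (\<integral>s. f (t - s) * g (s - u) \<partial>lborel) * h u \<partial>lborel)"
      by (simp add: mult.assoc[symmetric])
    also have "\<dots> = (\<integral>u. conv f g (t - u) * h u \<partial>lborel)"
    proof (rule arg_cong[where f="integral\<^sup>L lborel"], rule ext)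
      fix u
      have "(\<integral>s. f (t - s) * g (s - u) \<partial>lborel) = conv f g (t - u)"
        unfolding conv_def
        by (subst lborel_integral_real_affine[of 1 _ u]) (simp_all add: algebra_simps)
      then show "(\<integral>s. f (t - s) * g (s - u) \<partial>lborel) * h u = conv f g (t - u) * h u" by simp
    qed
    finally show ?case by (simp add: conv_def)
  qed
qed

text \<open>The quadratic form \<open>\<integral>(a f + b g)\<^sup>2\<close> in \<open>(a, b)\<close> is nonnegative, so its discriminant is not positive.\<close>

lemma Cauchy_Schwarz_integral:
  fixes f g :: "'a \<Rightarrow> real"
  assumes [measurable]: "f \<in> borel_measurable M" "g \<in> borel_measurable M"
    and f: "integrable M (\<lambda>x. (f x)\<^sup>2)" and g: "integrable M (\<lambda>x. (g x)\<^sup>2)"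
  shows "integrable M (\<lambda>x. f x * g x)"
    and "(\<integral>x. f x * g x \<partial>M)\<^sup>2 \<le> (\<integral>x. (f x)\<^sup>2 \<partial>M) * (\<integral>x. (g x)\<^sup>2 \<partial>M)"
proof -
  have "integrable M (\<lambda>x. (f x)\<^sup>2 + (g x)\<^sup>2)" using f g by simp
  then show fg: "integrable M (\<lambda>x. f x * g x)"
  proof (rule Bochner_Integration.integrable_bound)
    show "AE x in M. norm (f x * g x) \<le> norm ((f x)\<^sup>2 + (g x)\<^sup>2)"
    proof (rule AE_I2)
      fix x
      have "\<bar>f x * g x\<bar> \<le> (f x)\<^sup>2 + (g x)\<^sup>2"
        using sum_squares_bound[of "\<bar>f x\<bar>" "\<bar>g x\<bar>"] abs_ge_zero[of "f x * g x"]
        unfolding abs_mult power2_abs by linarith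
      then show "norm (f x * g x) \<le> norm ((f x)\<^sup>2 + (g x)\<^sup>2)" by simp
    qed
  qed simp
  let ?A = "\<integral>x. (f x)\<^sup>2 \<partial>M" and ?B = "\<integral>x. f x * g x \<partial>M" and ?C = "\<integral>x. (g x)\<^sup>2 \<partial>M"
  have q: "0 \<le> ?A * a\<^sup>2 + 2 * ?B * a * b + ?C * b\<^sup>2" for a b
  proof -
    have "0 \<le> (\<integral>x. (a * f x + b * g x)\<^sup>2 \<partial>M)" by simp
    also have "\<dots> = (\<integral>x. (f x)\<^sup>2 * a\<^sup>2 + f x * g x * (2 * a * b) + (g x)\<^sup>2 * b\<^sup>2 \<partial>M)"
      by (simp add: power2_sum power_mult_distrib algebra_simps)
    also have "\<dots> = ?A * a\<^sup>2 + ?B * (2 * a * b) + ?C * b\<^sup>2"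
      using f g fg by simp
    finally show ?thesis by (simp add: algebra_simps)
  qed
  have A: "0 \<le> ?A" and C: "0 \<le> ?C" by simp_all
  show "?B\<^sup>2 \<le> ?A * ?C"
  proof (cases "?C = 0")
    case True
    have "?B = 0"
    proof (rule ccontr)
      assume "?B \<noteq> 0"
      then show False
        using q[of 1 "- (?A + 1) / (2 * ?B)"] True by (simp add: field_simps)
    qed
    then show ?thesis using True by simp
  next
    case False
    then have "0 < ?C" using C by linarith
    \<comment> \<open>The minimum of the form on the line \<open>a = C\<close> is attained at \<open>b = - B\<close>.\<close>
    have "0 \<le> ?C * (?A * ?C - ?B\<^sup>2)"
      using q[of ?C "- ?B"] by (simp add: algebra_simps power2_eq_square)
    with \<open>0 < ?C\<close> show ?thesis by (simp add: zero_le_mult_iff)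
  qed
qed

text \<open>The case \<open>L\<^sup>1 * L\<^sup>2 \<subseteq> L\<^sup>2\<close> of Young's inequality: splitting \<open>k = sgn k \<surd>\<bar>k\<bar> \<cdot> \<surd>\<bar>k\<bar>\<close>
  in Cauchy-Schwarz gives \<open>(k * w)\<^sup>2 \<le> \<parallel>k\<parallel>\<^sub>1 (\<bar>k\<bar> * w\<^sup>2)\<close>, and the right-hand side is a convolution of
  integrable functions.\<close>

lemma conv_Young:
  assumes k: "integrable lborel k" and [measurable]: "w \<in> borel_measurable borel"
    and w: "integrable lborel (\<lambda>s. (w s)\<^sup>2)"
  shows "integrable lborel (\<lambda>t. (conv k w t)\<^sup>2)"
proof -
  have [measurable]: "k \<in> borel_measurable borel" using k by auto
  have ak: "integrable lborel (\<lambda>s. \<bar>k s\<bar>)" using k by simp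
  \<comment> \<open>The sign of \<open>k\<close> is put into the second factor, so that the product of the factors is \<open>k\<close>.\<close>
  have "AE t in lborel. (conv k w t)\<^sup>2 \<le> (\<integral>s. \<bar>k s\<bar> \<partial>lborel) * conv (\<lambda>s. \<bar>k s\<bar>) (\<lambda>s. (w s)\<^sup>2) t"
    using AE_integrable_conv[OF ak w]
  proof eventually_elim
    case (elim t)
    let ?f = "\<lambda>s. sqrt \<bar>k (t - s)\<bar>" and ?g = "\<lambda>s. sgn (k (t - s)) * sqrt \<bar>k (t - s)\<bar> * w s"
    have f2: "(?f s)\<^sup>2 = \<bar>k (t - s)\<bar>" for s by simp
    have g2: "(?g s)\<^sup>2 = \<bar>k (t - s)\<bar> * (w s)\<^sup>2" for s
      by (simp add: power_mult_distrib sgn_if)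
    have i1: "integrable lborel (\<lambda>s. \<bar>k (t - s)\<bar>)"
      using lborel_integrable_real_affine[OF ak, of "-1" t] by simp
    have fg: "?f s * ?g s = k (t - s) * w s" for s
      by (simp add: sgn_if abs_if)
    have s1: "(\<integral>s. \<bar>k (t - s)\<bar> \<partial>lborel) = (\<integral>s. \<bar>k s\<bar> \<partial>lborel)"
      by (subst lborel_integral_real_affine[of "-1" _ t]) simp_all
    show ?case
      using Cauchy_Schwarz_integral(2)[of ?f lborel ?g, unfolded f2 g2 fg, OF _ _ i1 elim]
      by (simp add: conv_def s1)
  qed
  then have "AE t in lborel. norm ((conv k w t)\<^sup>2)
      \<le> norm ((\<integral>s. \<bar>k s\<bar> \<partial>lborel) * conv (\<lambda>s. \<bar>k s\<bar>) (\<lambda>s. (w s)\<^sup>2) t)"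
    by eventually_elim (simp only: real_norm_def, smt (verit) zero_le_power2)
  then show ?thesis
    by (rule Bochner_Integration.integrable_bound
        [OF integrable_mult_right[OF integrable_conv[OF ak w]], rotated]) simp
qed

section \<open>Causal functions\<close>

definition trunc :: "real \<Rightarrow> (real \<Rightarrow> real) \<Rightarrow> real \<Rightarrow> real" where
  "trunc T f t = (if t \<le> T then f t else 0)"

text \<open>The kernels of fractional integration are not integrable on the line, but their values up to time \<open>t\<close>
  alone determine the convolution at \<open>t\<close>. Local integrability up to every finite time is therefore enough,
  and convolution makes the causal functions a commutative algebra up to null sets.\<close>

definition causal :: "(real \<Rightarrow> real) \<Rightarrow> bool" where
  "causal f \<longleftrightarrow> f \<in> borel_measurable borel \<and> (\<forall>t\<le>0. f t = 0) \<and> (\<forall>T. integrable lborel (trunc T f))"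

lemma borel_measurable_trunc [measurable]:
  assumes [measurable]: "f \<in> borel_measurable borel"
  shows "trunc T f \<in> borel_measurable borel"
  unfolding trunc_def[abs_def] by measurable

lemma causal_measurable [measurable_dest]: "causal f \<Longrightarrow> f \<in> borel_measurable borel"
  by (simp add: causal_def)

lemma causal_zero: "causal f \<Longrightarrow> t \<le> 0 \<Longrightarrow> f t = 0"
  by (simp add: causal_def)

lemma causal_trunc: "causal f \<Longrightarrow> integrable lborel (trunc T f)"
  by (simp add: causal_def)

lemma causalI_integrable:
  assumes "integrable lborel f" "\<And>t. t \<le> 0 \<Longrightarrow> f t = 0"
  shows "causal f"
  unfolding causal_def
proof (intro conjI allI)
  have [measurable]: "f \<in> borel_measurable borel" using assms by auto
  then show "f \<in> borel_measurable borel" .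
  show "integrable lborel (trunc T f)" for T
    using assms(1) by (rule Bochner_Integration.integrable_bound) (auto simp: trunc_def)
qed (use assms in auto)

lemma causal_lincomb:
  assumes "causal f" "causal g"
  shows "causal (\<lambda>t. f t + c * g t)"
  unfolding causal_def
proof (intro conjI allI)
  show "(\<lambda>t. f t + c * g t) \<in> borel_measurable borel"
    using assms by (auto simp: causal_def)
  have "trunc T (\<lambda>t. f t + c * g t) = (\<lambda>t. trunc T f t + c * trunc T g t)" for T
    by (auto simp: trunc_def)
  then show "integrable lborel (trunc T (\<lambda>t. f t + c * g t))" for T
    using assms by (simp add: causal_def)
qed (use assms in \<open>auto simp: causal_def\<close>)

text \<open>The integrand vanishes unless \<open>0 < s < t\<close>, and then both arguments lie below \<open>T\<close>. This transfers the
  \<open>L\<^sup>1\<close> theory to causal functions.\<close>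

lemma causal_integrand_trunc:
  assumes f: "causal f" and g: "causal g" and t: "t \<le> T"
  shows "f (t - s) * g s = trunc T f (t - s) * trunc T g s"
proof -
  consider "s \<le> 0" | "t - s \<le> 0" | "0 < s" "0 < t - s" by linarith
  then show ?thesis
    by cases (use t in \<open>auto simp: trunc_def causal_zero[OF f] causal_zero[OF g]\<close>)
qed

lemma conv_trunc:
  assumes "causal f" "causal g" "t \<le> T"
  shows "conv f g t = conv (trunc T f) (trunc T g) t"
  unfolding conv_def by (simp only: causal_integrand_trunc[OF assms])

lemma conv_zero:
  assumes f: "causal f" and g: "causal g" and t: "t \<le> 0"
  shows "conv f g t = 0"
proof -
  have z: "f (t - s) * g s = 0" for s
    using t causal_zero[OF f] causal_zero[OF g] by (cases "s \<le> 0") auto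
  show ?thesis unfolding conv_def z by simp
qed

lemma AE_upto:
  fixes P :: "real \<Rightarrow> bool"
  assumes "\<And>T. AE t in lborel. t \<le> T \<longrightarrow> P t"
  shows "AE t in lborel. P t"
proof -
  have "AE t in lborel. \<forall>n::nat. t \<le> real n \<longrightarrow> P t"
    unfolding AE_all_countable using assms by blast
  then show ?thesis
    by eventually_elim (use real_arch_simple in blast)
qed

lemma causal_AE_integrable:
  assumes "causal f" "causal g"
  shows "AE t in lborel. integrable lborel (\<lambda>s. f (t - s) * g s)"
proof (rule AE_upto)
  fix T
  show "AE t in lborel. t \<le> T \<longrightarrow> integrable lborel (\<lambda>s. f (t - s) * g s)"
    using AE_integrable_conv[OF causal_trunc[OF assms(1), of T] causal_trunc[OF assms(2), of T]]
    by eventually_elim (simp add: causal_integrand_trunc[OF assms, where T=T])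
qed

lemma causal_conv:
  assumes "causal f" "causal g"
  shows "causal (conv f g)"
  unfolding causal_def
proof (intro conjI allI impI)
  show "conv f g \<in> borel_measurable borel"
    using assms by (auto intro!: borel_measurable_conv causal_measurable)
  show "conv f g t = 0" if "t \<le> 0" for t
    by (rule conv_zero[OF assms that])
  fix T
  have "trunc T (conv f g) = trunc T (conv (trunc T f) (trunc T g))"
    using conv_trunc[OF assms] by (auto simp: trunc_def fun_eq_iff)
  moreover have "integrable lborel (conv (trunc T f) (trunc T g))"
    by (intro integrable_conv causal_trunc assms)
  then have "integrable lborel (trunc T (conv (trunc T f) (trunc T g)))"
    by (rule Bochner_Integration.integrable_bound)
      (use assms in \<open>auto simp: trunc_def intro!: borel_measurable_trunc borel_measurable_conv causal_measurable\<close>)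
  ultimately show "integrable lborel (trunc T (conv f g))" by simp
qed

lemma conv_cong_upto:
  assumes f: "causal f" and g: "causal g" and g': "causal g'" and t: "t \<le> T"
    and eq: "AE s in lborel. s < T \<longrightarrow> g s = g' s"
  shows "conv f g t = conv f g' t"
  unfolding conv_def
proof (rule integral_cong_AE)
  have [measurable]: "f \<in> borel_measurable borel" "g \<in> borel_measurable borel" "g' \<in> borel_measurable borel"
    using f g g' by (auto intro: causal_measurable)
  show "(\<lambda>s. f (t - s) * g s) \<in> borel_measurable lborel" "(\<lambda>s. f (t - s) * g' s) \<in> borel_measurable lborel"
    by measurable
  show "AE s in lborel. f (t - s) * g s = f (t - s) * g' s"
    using eq
  proof eventually_elim
    case (elim s)
    then show ?case using t causal_zero[OF f, of "t - s"] by (cases "s < T") auto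
  qed
qed

text \<open>Up to time \<open>T\<close> the convolutions may be formed from the truncated, hence integrable, functions.\<close>

lemma causal_conv_assoc:
  assumes f: "causal f" and g: "causal g" and h: "causal h"
  shows "AE t in lborel. conv f (conv g h) t = conv (conv f g) h t"
proof (rule AE_upto)
  fix T
  let ?f = "trunc T f" and ?g = "trunc T g" and ?h = "trunc T h"
  have c: "causal ?f" "causal ?g" "causal ?h"
    using f g h by (auto intro!: causalI_integrable causal_trunc simp: trunc_def causal_zero)
  note cc = causal_conv[OF g h] causal_conv[OF f g] causal_conv[OF c(1,2)] causal_conv[OF c(2,3)]
  have "AE t in lborel. conv ?f (conv ?g ?h) t = conv (conv ?f ?g) ?h t"
    by (intro AE_conv_assoc causal_trunc f g h)
  then show "AE t in lborel. t \<le> T \<longrightarrow> conv f (conv g h) t = conv (conv f g) h t"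
  proof eventually_elim
    case (elim t)
    show ?case
    proof
      assume t: "t \<le> T"
      have tt: "trunc T ?f = ?f" "trunc T ?h = ?h" by (auto simp: trunc_def)
      have 1: "trunc T (conv g h) = trunc T (conv ?g ?h)" "trunc T (conv f g) = trunc T (conv ?f ?g)"
        using conv_trunc[OF g h] conv_trunc[OF f g] by (auto simp: trunc_def fun_eq_iff)
      have "conv f (conv g h) t = conv ?f (trunc T (conv ?g ?h)) t"
        using conv_trunc[OF f cc(1) t] 1 by simp
      also have "\<dots> = conv ?f (conv ?g ?h) t"
        using conv_trunc[OF c(1) cc(4) t] tt by simp
      also have "\<dots> = conv (conv ?f ?g) ?h t" by (rule elim)
      also have "\<dots> = conv (trunc T (conv f g)) ?h t"
        using conv_trunc[OF cc(3) c(3) t] tt 1 by simp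
      also have "\<dots> = conv (conv f g) h t"
        using conv_trunc[OF cc(2) h t] by simp
      finally show "conv f (conv g h) t = conv (conv f g) h t" .
    qed
  qed
qed

lemma causal_conv_lincomb:
  assumes f: "causal f" and g: "causal g" and h: "causal h"
  shows "AE t in lborel. conv f (\<lambda>s. g s + c * h s) t = conv f g t + c * conv f h t"
  using causal_AE_integrable[OF f g] causal_AE_integrable[OF f h]
proof eventually_elim
  case (elim t)
  have "f (t - s) * (g s + c * h s) = f (t - s) * g s + c * (f (t - s) * h s)" for s
    by (simp add: algebra_simps)
  with elim show ?case by (simp add: conv_def)
qed

section \<open>The kernels of fractional integration\<close>

text \<open>The convolution kernel of \<open>J\<^sup>\<beta>\<close>, extended by zero to negative times.\<close>

definition frac_kernel :: "real \<Rightarrow> real \<Rightarrow> real" where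
  "frac_kernel \<beta> t = (if 0 < t then t powr (\<beta> - 1) / Gamma \<beta> else 0)"

lemma borel_measurable_frac_kernel [measurable]: "frac_kernel \<beta> \<in> borel_measurable borel"
  unfolding frac_kernel_def[abs_def] by measurable

lemma frac_kernel_nonneg: "0 < \<beta> \<Longrightarrow> 0 \<le> frac_kernel \<beta> t"
  by (simp add: frac_kernel_def Gamma_real_pos less_imp_le)

text \<open>A gauge integral of a nonnegative function is a Lebesgue integral. This carries the explicit integrals of
  powers and the Beta integral over to Borel measure.\<close>

lemma has_integral_imp_lborel:
  fixes f :: "real \<Rightarrow> real"
  assumes I: "(f has_integral I) S" and [measurable]: "S \<in> sets borel"
    and [measurable]: "(\<lambda>x. indicator S x * f x) \<in> borel_measurable borel" and nn: "\<And>x. x \<in> S \<Longrightarrow> 0 \<le> f x"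
  shows "integrable lborel (\<lambda>x. indicator S x * f x)" "(\<integral>x. indicator S x * f x \<partial>lborel) = I"
proof -
  have "((\<lambda>x. indicator S x * f x) has_integral I) UNIV"
  proof -
    have "(\<lambda>x. indicator S x * f x) = (\<lambda>x. if x \<in> S then f x else 0)"
      by (auto split: split_indicator)
    then show ?thesis using I by (simp add: has_integral_restrict_UNIV)
  qed
  then have N: "(\<integral>\<^sup>+x. indicator S x * f x \<partial>lborel) = I"
    by (intro nn_integral_has_integral_lborel) (auto simp: nn split: split_indicator)
  have I0: "0 \<le> I" using has_integral_nonneg[OF I] nn by blast
  show int: "integrable lborel (\<lambda>x. indicator S x * f x)"
    by (rule integrableI_nonneg) (use N nn in \<open>auto split: split_indicator\<close>)
  have "ennreal (\<integral>x. indicator S x * f x \<partial>lborel) = ennreal I"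
    using nn_integral_eq_integral[OF int] N nn by (auto split: split_indicator)
  moreover have "0 \<le> (\<integral>x. indicator S x * f x \<partial>lborel)"
    by (intro integral_nonneg_AE) (use nn in \<open>auto split: split_indicator\<close>)
  ultimately show "(\<integral>x. indicator S x * f x \<partial>lborel) = I" using I0 by simp
qed

lemma integral_powr_from_0:
  fixes a c :: real
  assumes c: "0 \<le> c" and a: "a > -1"
  shows "integrable lborel (\<lambda>x. indicator {0<..c} x * x powr a)"
    and "(\<integral>x. indicator {0<..c} x * x powr a \<partial>lborel) = c powr (a + 1) / (a + 1)"
proof -
  have eq: "indicator {0<..c} x * x powr a = indicator {0..c} x * x powr a" for x :: real
    by (cases "x = 0") (auto split: split_indicator)
  show "integrable lborel (\<lambda>x. indicator {0<..c} x * x powr a)"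
    and "(\<integral>x. indicator {0<..c} x * x powr a \<partial>lborel) = c powr (a + 1) / (a + 1)"
    unfolding eq
    by (rule has_integral_imp_lborel[OF has_integral_powr_from_0[OF a c]]; simp)+
qed

lemma causal_frac_kernel:
  assumes "0 < \<beta>"
  shows "causal (frac_kernel \<beta>)"
  unfolding causal_def
proof (intro conjI allI impI)
  fix T :: real
  have "trunc T (frac_kernel \<beta>) = (\<lambda>t. (indicator {0<..max 0 T} t * t powr (\<beta> - 1)) / Gamma \<beta>)"
    by (auto simp: trunc_def frac_kernel_def fun_eq_iff indicator_def)
  then show "integrable lborel (trunc T (frac_kernel \<beta>))"
    using integral_powr_from_0(1)[of "max 0 T" "\<beta> - 1"] assms by simp
qed (auto simp: frac_kernel_def borel_measurable_frac_kernel)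

text \<open>The semigroup property \<open>J\<^sup>b J\<^sup>c = J\<^sup>b\<^sup>+\<^sup>c\<close> at the level of kernels: the substitution \<open>s = t x\<close> turns
  the convolution into the Beta integral \<open>B(c, b) = \<Gamma>(b) \<Gamma>(c) / \<Gamma>(b + c)\<close>.\<close>

lemma conv_frac_kernel:
  assumes b: "0 < b" and c: "0 < c"
  shows "conv (frac_kernel b) (frac_kernel c) t = frac_kernel (b + c) t"
    and "integrable lborel (\<lambda>s. frac_kernel b (t - s) * frac_kernel c s)"
proof -
  have "conv (frac_kernel b) (frac_kernel c) t = frac_kernel (b + c) t
      \<and> integrable lborel (\<lambda>s. frac_kernel b (t - s) * frac_kernel c s)"
  proof (cases "0 < t")
    case False
    have z: "frac_kernel b (t - s) * frac_kernel c s = 0" for s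
      using False by (auto simp: frac_kernel_def)
    show ?thesis using False by (simp add: conv_def z) (simp add: frac_kernel_def)
  next
    case True
    let ?g = "\<lambda>x. indicator {0..1} x * (x powr (c - 1) * (1 - x) powr (b - 1))"
    have G: "integrable lborel ?g" "(\<integral>x. ?g x \<partial>lborel) = Beta c b"
      by (rule has_integral_imp_lborel[OF has_integral_Beta_real[OF c b]]; simp)+
    have eq: "frac_kernel b (t - t * x) * frac_kernel c (t * x)
        = t powr (b + c - 2) / (Gamma b * Gamma c) * ?g x" if "x \<noteq> 0" "x \<noteq> 1" for x
    proof (cases "0 < x \<and> x < 1")
      case x: True
      have "t - t * x = t * (1 - x)" by (simp add: algebra_simps)
      moreover have "0 < t * (1 - x)" "0 < t * x" using x True by auto
      moreover have "t powr (b + c - 2) = t powr (b - 1) * t powr (c - 1)"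
        by (simp add: powr_add[symmetric])
      ultimately show ?thesis
        using x True by (simp add: frac_kernel_def powr_mult)
    next
      case x: False
      then have "x < 0 \<or> 1 < x" using that by auto
      then have "t * x < 0 \<or> t - t * x < 0"
        using True mult_strict_left_mono[of 1 x t] by (auto simp: mult_less_0_iff)
      then have 1: "frac_kernel b (t - t * x) * frac_kernel c (t * x) = 0" by (auto simp: frac_kernel_def)
      have 2: "?g x = 0" using \<open>x < 0 \<or> 1 < x\<close> by auto
      show ?thesis unfolding 1 2 by simp
    qed
    have ae: "AE x in lborel. frac_kernel b (t - t * x) * frac_kernel c (t * x)
        = t powr (b + c - 2) / (Gamma b * Gamma c) * ?g x"
      using AE_lborel_singleton[of 0] AE_lborel_singleton[of 1] by eventually_elim (rule eq)
    have i: "integrable lborel (\<lambda>x. frac_kernel b (t - t * x) * frac_kernel c (t * x))"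
      using integrable_mult_right[OF G(1), of "t powr (b + c - 2) / (Gamma b * Gamma c)"]
      by (subst integrable_cong_AE[OF _ _ ae]) simp_all
    have int: "integrable lborel (\<lambda>s. frac_kernel b (t - s) * frac_kernel c s)"
      using i lborel_integrable_real_affine_iff[of t "\<lambda>s. frac_kernel b (t - s) * frac_kernel c s" 0] True
      by simp
    have "conv (frac_kernel b) (frac_kernel c) t
        = t * (\<integral>x. frac_kernel b (t - t * x) * frac_kernel c (t * x) \<partial>lborel)"
      unfolding conv_def using True
      by (subst lborel_integral_real_affine[of t _ 0]) auto
    also have "(\<integral>x. frac_kernel b (t - t * x) * frac_kernel c (t * x) \<partial>lborel)
        = t powr (b + c - 2) / (Gamma b * Gamma c) * Beta c b"
      using integral_cong_AE[OF _ _ ae] G(2) by simp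
    also have "Beta c b = Gamma b * Gamma c / Gamma (b + c)"
      by (simp add: Beta_def add.commute mult.commute)
    also have "t * (t powr (b + c - 2) / (Gamma b * Gamma c) * (Gamma b * Gamma c / Gamma (b + c)))
        = t powr (b + c - 1) / Gamma (b + c)"
    proof -
      have "Gamma b \<noteq> 0" "Gamma c \<noteq> 0" using b c Gamma_real_pos by fastforce+
      moreover have "t * t powr (b + c - 2) = t powr (b + c - 1)"
        using True by (simp add: powr_mult_base)
      ultimately show ?thesis by (simp add: field_simps)
    qed
    also have "\<dots> = frac_kernel (b + c) t" using True by (simp add: frac_kernel_def)
    finally show ?thesis using int by simp
  qed
  then show "conv (frac_kernel b) (frac_kernel c) t = frac_kernel (b + c) t"
    and "integrable lborel (\<lambda>s. frac_kernel b (t - s) * frac_kernel c s)" by auto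
qed

lemma conv_conv_frac_kernel:
  assumes "0 < b" "0 < c" "causal w"
  shows "AE t in lborel. conv (frac_kernel b) (conv (frac_kernel c) w) t = conv (frac_kernel (b + c)) w t"
proof -
  have *: "conv (frac_kernel b) (frac_kernel c) = frac_kernel (b + c)"
    using conv_frac_kernel(1)[OF assms(1,2)] by auto
  show ?thesis
    using causal_conv_assoc[OF causal_frac_kernel causal_frac_kernel, of b c w] assms
    by (simp add: *)
qed

section \<open>Mittag-Leffler series and the resolvent kernel\<close>

text \<open>The part of Euler's integral over \<open>[M, M + 1]\<close> already grows faster than any fixed exponential in \<open>x\<close>,
  because \<open>M\<close> is free. Together with geometric comparison this is all that the convergence of the
  Mittag-Leffler series requires.\<close>

lemma Gamma_ge:
  fixes x M :: real
  assumes x: "1 \<le> x" and M: "1 \<le> M"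
  shows "M powr (x - 1) / exp (M + 1) \<le> Gamma x"
proof -
  have "((\<lambda>t. M powr (x - 1) / exp (M + 1)) has_integral (M powr (x - 1) / exp (M + 1))) {M..M + 1}"
    using has_integral_const_real[of "M powr (x - 1) / exp (M + 1)" M "M + 1"] by simp
  moreover have "((\<lambda>t. if t \<in> {M..M+1} then M powr (x - 1) / exp (M + 1) else 0)
      has_integral (M powr (x - 1) / exp (M + 1))) {0..}"
    using calculation M by (subst has_integral_restrict) auto
  then show ?thesis
  proof (rule has_integral_le[OF _ Gamma_integral_real])
    fix t :: real assume t: "t \<in> {0..}"
    show "(if t \<in> {M..M + 1} then M powr (x - 1) / exp (M + 1) else 0) \<le> t powr (x - 1) / exp t"
      using M x by (auto intro!: frac_le powr_mono2)
  qed (use x in auto)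
qed

text \<open>The constant \<open>M\<close> is chosen with \<open>M\<^sup>\<alpha> = 2 x + 1\<close>, so that the terms are dominated by a geometric series
  of ratio \<open>1/2\<close>.\<close>

lemma summable_Mittag_Leffler:
  fixes x :: real
  assumes \<alpha>: "0 < \<alpha>" and \<beta>: "0 < \<beta>" and x: "0 \<le> x"
  shows "summable (\<lambda>k. x ^ k / Gamma (\<alpha> * real k + \<beta>))"
proof -
  define M where "M = (2 * x + 1) powr (1 / \<alpha>)"
  have M: "1 \<le> M" using \<alpha> x by (auto simp: M_def intro!: ge_one_powr_ge_zero)
  have Ma: "M powr \<alpha> = 2 * x + 1" using \<alpha> x by (simp add: M_def powr_powr)
  define C where "C = exp (M + 1) / M powr (\<beta> - 1)"
  have bd: "x ^ k / Gamma (\<alpha> * real k + \<beta>) \<le> C * (1/2) ^ k" if k: "1 / \<alpha> \<le> real k" for k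
  proof -
    have "1 \<le> \<alpha> * real k" using k \<alpha> by (simp add: field_simps)
    then have "M powr (\<alpha> * real k + \<beta> - 1) / exp (M + 1) \<le> Gamma (\<alpha> * real k + \<beta>)"
      using \<beta> by (intro Gamma_ge M) auto
    moreover have "M powr (\<alpha> * real k + \<beta> - 1) = (2 * x + 1) ^ k * M powr (\<beta> - 1)"
    proof -
      have "M powr (\<alpha> * real k + \<beta> - 1) = (M powr \<alpha>) powr real k * M powr (\<beta> - 1)"
        by (simp add: powr_powr powr_add[symmetric] algebra_simps)
      then show ?thesis using x by (simp add: Ma powr_realpow)
    qed
    ultimately have "(2 * x + 1) ^ k / C \<le> Gamma (\<alpha> * real k + \<beta>)"
      by (simp add: C_def)
    moreover have "0 < C" using M by (simp add: C_def)
    ultimately have "x ^ k / Gamma (\<alpha> * real k + \<beta>) \<le> x ^ k / ((2 * x + 1) ^ k / C)"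
      using x by (intro divide_left_mono) (auto intro!: mult_pos_pos divide_pos_pos
          Gamma_real_pos add_nonneg_pos \<beta> mult_nonneg_nonneg \<alpha>[THEN less_imp_le])
    also have "\<dots> = C * (x / (2 * x + 1)) ^ k" by (simp add: power_divide)
    also have "\<dots> \<le> C * (1/2) ^ k"
      using x \<open>0 < C\<close> by (intro mult_left_mono power_mono) (auto simp: field_simps)
    finally show ?thesis .
  qed
  show ?thesis
  proof (rule summable_comparison_test_ev)
    show "\<forall>\<^sub>F k in sequentially. norm (x ^ k / Gamma (\<alpha> * real k + \<beta>)) \<le> C * (1/2) ^ k"
      using eventually_ge_at_top[of "nat \<lceil>1 / \<alpha>\<rceil>"]
    proof eventually_elim
      case (elim k)
      then have "1 / \<alpha> \<le> real k" by linarith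
      moreover have "0 < Gamma (\<alpha> * real k + \<beta>)"
        by (intro Gamma_real_pos add_nonneg_pos \<beta>) (use \<alpha> in simp)
      ultimately show ?case using bd[of k] x by simp
    qed
    show "summable (\<lambda>k. C * (1/2) ^ k :: real)" by (intro summable_mult summable_geometric) simp
  qed
qed

text \<open>The convolution kernel of \<open>(1 + \<lambda> J\<^sup>\<alpha>)\<^sup>-\<^sup>1 J\<^sup>\<alpha>\<close>: its power series is the Neumann series
  \<open>\<Sum>k. (- \<lambda>)\<^sup>k J\<^bsup>\<alpha>(k+1)\<^esup>\<close>.\<close>

definition resolvent_kernel :: "real \<Rightarrow> real \<Rightarrow> real \<Rightarrow> real" where
  "resolvent_kernel \<alpha> lam t = (if 0 < t then t powr (\<alpha> - 1) * Mittag_Leffler \<alpha> \<alpha> (- lam * t powr \<alpha>) else 0)"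

lemma power_mult_frac_kernel:
  assumes "0 < t"
  shows "c ^ k * frac_kernel (\<alpha> * real k + \<beta>) t = t powr (\<beta> - 1) * ((c * t powr \<alpha>) ^ k / Gamma (\<alpha> * real k + \<beta>))"
proof -
  have "t powr (\<alpha> * real k + \<beta> - 1) = t powr (\<beta> - 1) * (t powr \<alpha>) ^ k"
  proof -
    have "t powr (\<alpha> * real k + \<beta> - 1) = (t powr \<alpha>) powr real k * t powr (\<beta> - 1)"
      by (simp add: powr_powr powr_add[symmetric] algebra_simps)
    then show ?thesis using assms by (simp add: powr_realpow)
  qed
  then show ?thesis using assms by (simp add: frac_kernel_def power_mult_distrib)
qed

lemma summable_frac_kernel:
  assumes "0 < \<alpha>" "0 < \<beta>"
  shows "summable (\<lambda>k. \<bar>c ^ k * frac_kernel (\<alpha> * real k + \<beta>) t\<bar>)"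
proof (cases "0 < t")
  case True
  have "\<bar>c ^ k * frac_kernel (\<alpha> * real k + \<beta>) t\<bar> = t powr (\<beta> - 1) * ((\<bar>c\<bar> * t powr \<alpha>) ^ k / Gamma (\<alpha> * real k + \<beta>))" for k
    unfolding power_mult_frac_kernel[OF True, symmetric] abs_mult power_abs
    by (subst abs_of_nonneg[OF frac_kernel_nonneg]) (use assms in \<open>auto intro: add_nonneg_pos\<close>)
  then show ?thesis
    using summable_mult[OF summable_Mittag_Leffler[OF assms, of "\<bar>c\<bar> * t powr \<alpha>"], of "t powr (\<beta> - 1)"] by simp
qed (simp add: frac_kernel_def)

lemma frac_kernel_sums_Mittag_Leffler:
  assumes "0 < \<alpha>" "0 < \<beta>" "0 < t"
  shows "(\<Sum>k. c ^ k * frac_kernel (\<alpha> * real k + \<beta>) t) = t powr (\<beta> - 1) * Mittag_Leffler \<alpha> \<beta> (c * t powr \<alpha>)"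
proof -
  have s: "summable (\<lambda>k. (c * t powr \<alpha>) ^ k / Gamma (\<alpha> * real k + \<beta>))"
  proof (rule summable_rabs_cancel)
    have "\<bar>(c * t powr \<alpha>) ^ k / Gamma (\<alpha> * real k + \<beta>)\<bar> = (\<bar>c\<bar> * t powr \<alpha>) ^ k / Gamma (\<alpha> * real k + \<beta>)" for k
      using Gamma_real_pos[of "\<alpha> * real k + \<beta>"] assms by (simp add: abs_mult power_abs add_nonneg_pos)
    then show "summable (\<lambda>k. \<bar>(c * t powr \<alpha>) ^ k / Gamma (\<alpha> * real k + \<beta>)\<bar>)"
      using summable_Mittag_Leffler[OF assms(1,2), of "\<bar>c\<bar> * t powr \<alpha>"] by simp
  qed
  show ?thesis
    unfolding power_mult_frac_kernel[OF assms(3)] Mittag_Leffler_def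
    using suminf_mult[OF s, of "t powr (\<beta> - 1)"] by (simp add: divide_inverse mult.commute)
qed

lemma resolvent_kernel_series:
  assumes "0 < \<alpha>"
  shows "resolvent_kernel \<alpha> lam t = (\<Sum>k. (- lam) ^ k * frac_kernel (\<alpha> * real k + \<alpha>) t)"
proof (cases "0 < t")
  case True
  then show ?thesis using frac_kernel_sums_Mittag_Leffler[OF assms assms True, of "- lam"] by (simp add: resolvent_kernel_def)
qed (simp add: resolvent_kernel_def frac_kernel_def)

lemma borel_measurable_resolvent_kernel:
  assumes "0 < \<alpha>"
  shows "resolvent_kernel \<alpha> lam \<in> borel_measurable borel"
proof -
  have "resolvent_kernel \<alpha> lam = (\<lambda>t. \<Sum>k. (- lam) ^ k * frac_kernel (\<alpha> * real k + \<alpha>) t)"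
    using resolvent_kernel_series[OF assms] by auto
  then show ?thesis by simp
qed

text \<open>Convolution with a kernel shifts the exponents in the series termwise. The interchange of sum and
  integral is legitimate because the absolute values form the same kind of series, with \<open>\<bar>\<lambda>\<bar>\<close> in place
  of \<open>- \<lambda>\<close>.\<close>

lemma conv_frac_kernel_resolvent_kernel:
  assumes \<alpha>: "0 < \<alpha>" and b: "0 < b"
  shows "integrable lborel (\<lambda>s. frac_kernel b (t - s) * resolvent_kernel \<alpha> lam s)"
    and "conv (frac_kernel b) (resolvent_kernel \<alpha> lam) t = (\<Sum>k. (- lam) ^ k * frac_kernel (\<alpha> * real k + (\<alpha> + b)) t)"
proof -
  let ?f = "\<lambda>k s. frac_kernel b (t - s) * ((- lam) ^ k * frac_kernel (\<alpha> * real k + \<alpha>) s)"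
  have pos: "0 < \<alpha> * real k + \<alpha>" for k using \<alpha> by (simp add: add_nonneg_pos)
  have eq: "frac_kernel b (t - s) * resolvent_kernel \<alpha> lam s = (\<Sum>k. ?f k s)" for s
    unfolding resolvent_kernel_series[OF \<alpha>]
    by (intro suminf_mult[symmetric] summable_rabs_cancel[OF summable_frac_kernel] \<alpha>)
  have f: "?f k = (\<lambda>s. (- lam) ^ k * (frac_kernel b (t - s) * frac_kernel (\<alpha> * real k + \<alpha>) s))" for k
    by (auto simp: algebra_simps)
  have int: "integrable lborel (?f k)" for k
    unfolding f by (intro integrable_mult_right conv_frac_kernel(2) b pos)
  have val: "(\<integral>s. ?f k s \<partial>lborel) = (- lam) ^ k * frac_kernel (\<alpha> * real k + (\<alpha> + b)) t" for k
    unfolding f using conv_frac_kernel(1)[OF b pos[of k], of t] by (simp add: conv_def algebra_simps)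
  have aval: "(\<integral>s. norm (?f k s) \<partial>lborel) = \<bar>(- lam) ^ k * frac_kernel (\<alpha> * real k + (\<alpha> + b)) t\<bar>" for k
  proof -
    have n: "norm (?f k s) = \<bar>lam\<bar> ^ k * (frac_kernel b (t - s) * frac_kernel (\<alpha> * real k + \<alpha>) s)" for s
      by (simp only: real_norm_def abs_mult power_abs abs_minus_cancel
          abs_of_nonneg[OF frac_kernel_nonneg[OF b]] abs_of_nonneg[OF frac_kernel_nonneg[OF pos[of k]]]
          mult.left_commute)
    have p: "0 < \<alpha> * real k + (\<alpha> + b)" using pos[of k] b by simp
    have "(\<integral>s. norm (?f k s) \<partial>lborel) = \<bar>lam\<bar> ^ k * frac_kernel (\<alpha> * real k + (\<alpha> + b)) t"
      unfolding n using conv_frac_kernel(1)[OF b pos[of k], of t] by (simp add: conv_def algebra_simps)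
    then show ?thesis
      by (simp only: abs_mult power_abs abs_minus_cancel abs_of_nonneg[OF frac_kernel_nonneg[OF p]])
  qed
  have s1: "AE s in lborel. summable (\<lambda>k. norm (?f k s))"
    using summable_mult[OF summable_frac_kernel[OF \<alpha> \<alpha>, of "- lam"]] by (intro AE_I2) (simp add: abs_mult)
  have s2: "summable (\<lambda>k. \<integral>s. norm (?f k s) \<partial>lborel)"
    unfolding aval using \<alpha> b by (intro summable_frac_kernel) auto
  show "integrable lborel (\<lambda>s. frac_kernel b (t - s) * resolvent_kernel \<alpha> lam s)"
    unfolding eq by (rule integrable_suminf[OF int s1 s2])
  show "conv (frac_kernel b) (resolvent_kernel \<alpha> lam) t = (\<Sum>k. (- lam) ^ k * frac_kernel (\<alpha> * real k + (\<alpha> + b)) t)"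
    unfolding conv_def eq integral_suminf[OF int s1 s2] val ..
qed

lemma causal_resolvent_kernel:
  assumes \<alpha>: "0 < \<alpha>"
  shows "causal (resolvent_kernel \<alpha> lam)"
  unfolding causal_def
proof (intro conjI allI impI)
  fix T
  have "integrable lborel (\<lambda>s. frac_kernel 1 (T + 1 - s) * resolvent_kernel \<alpha> lam s)"
    by (rule conv_frac_kernel_resolvent_kernel[OF \<alpha>]) simp
  then show "integrable lborel (trunc T (resolvent_kernel \<alpha> lam))"
    by (rule Bochner_Integration.integrable_bound)
      (auto simp: trunc_def frac_kernel_def intro!: borel_measurable_trunc borel_measurable_resolvent_kernel \<alpha>)
qed (auto simp: resolvent_kernel_def borel_measurable_resolvent_kernel[OF \<alpha>])

text \<open>Splitting off the first term of the Neumann series leaves \<open>- \<lambda> J\<^sup>\<alpha>\<close> applied to the series itself.\<close>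

lemma resolvent_equation:
  assumes \<alpha>: "0 < \<alpha>"
  shows "resolvent_kernel \<alpha> lam t = frac_kernel \<alpha> t - lam * conv (frac_kernel \<alpha>) (resolvent_kernel \<alpha> lam) t"
proof -
  let ?g = "\<lambda>k. (- lam) ^ k * frac_kernel (\<alpha> * real k + \<alpha>) t"
  have s: "summable ?g"
    by (intro summable_rabs_cancel[OF summable_frac_kernel] \<alpha>)
  have s': "summable (\<lambda>k. (- lam) ^ k * frac_kernel (\<alpha> * real k + (\<alpha> + \<alpha>)) t)"
    using \<alpha> by (intro summable_rabs_cancel[OF summable_frac_kernel]) auto
  have "resolvent_kernel \<alpha> lam t = ?g 0 + (\<Sum>k. ?g (Suc k))"
    unfolding resolvent_kernel_series[OF \<alpha>] using suminf_split_head[OF s] by simp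
  also have "(\<lambda>k. ?g (Suc k)) = (\<lambda>k. (- lam) * ((- lam) ^ k * frac_kernel (\<alpha> * real k + (\<alpha> + \<alpha>)) t))"
    by (auto simp: algebra_simps)
  also have "suminf \<dots> = - lam * conv (frac_kernel \<alpha>) (resolvent_kernel \<alpha> lam) t"
    unfolding conv_frac_kernel_resolvent_kernel(2)[OF \<alpha> \<alpha>] by (rule suminf_mult[OF s'])
  finally show ?thesis by simp
qed

text \<open>The same splitting for \<open>E\<^bsub>\<alpha>,1\<^esub>\<close>: the terms after the constant one are the integral of the resolvent
  kernel. Hence the initial value \<open>a\<close> enters the solution like the constant source term \<open>- \<lambda> a\<close>.\<close>

lemma Mittag_Leffler_eq_conv:
  assumes \<alpha>: "0 < \<alpha>" and t: "0 < t"
  shows "Mittag_Leffler \<alpha> 1 (- lam * t powr \<alpha>) = 1 - lam * conv (frac_kernel 1) (resolvent_kernel \<alpha> lam) t"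
proof -
  let ?g = "\<lambda>k. (- lam) ^ k * frac_kernel (\<alpha> * real k + 1) t"
  have s: "summable ?g"
    by (intro summable_rabs_cancel[OF summable_frac_kernel] \<alpha>) simp
  have s': "summable (\<lambda>k. (- lam) ^ k * frac_kernel (\<alpha> * real k + (\<alpha> + 1)) t)"
    using \<alpha> by (intro summable_rabs_cancel[OF summable_frac_kernel]) auto
  have "Mittag_Leffler \<alpha> 1 (- lam * t powr \<alpha>) = (\<Sum>k. ?g k)"
    using frac_kernel_sums_Mittag_Leffler[OF \<alpha> _ t, of 1 "- lam"] t by simp
  also have "\<dots> = ?g 0 + (\<Sum>k. ?g (Suc k))"
    using suminf_split_head[OF s] by simp
  also have "(\<lambda>k. ?g (Suc k)) = (\<lambda>k. (- lam) * ((- lam) ^ k * frac_kernel (\<alpha> * real k + (\<alpha> + 1)) t))"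
    by (auto simp: algebra_simps)
  also have "suminf \<dots> = - lam * conv (frac_kernel 1) (resolvent_kernel \<alpha> lam) t"
    unfolding conv_frac_kernel_resolvent_kernel(2)[OF \<alpha> zero_less_one] by (rule suminf_mult[OF s'])
  finally show ?thesis using t by (simp add: frac_kernel_def)
qed

section \<open>Square-integrable functions on the interval and their Borel representatives\<close>

lemma AE_leb_interval_iff:
  "(AE t in leb_interval T. P t) \<longleftrightarrow> (AE t in lborel. 0 < t \<and> t < T \<longrightarrow> P t)"
  by (subst AE_restrict_space_iff) (auto simp: AE_completion_iff)

text \<open>Passing to a Borel representative, extended by zero, moves everything from Lebesgue measure on an
  interval to Borel measure on the line, where Fubini's theorem is at hand.\<close>

lemma lebesgue_on_AE_borel:
  fixes f f' :: "real \<Rightarrow> real"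
  assumes [measurable]: "f' \<in> borel_measurable borel" "S \<in> sets borel"
    and eq: "AE s in lborel. s \<in> S \<longrightarrow> f s = f' s"
  shows "f \<in> borel_measurable (lebesgue_on S)"
    and "integrable (lebesgue_on S) f \<longleftrightarrow> integrable lborel (\<lambda>s. indicator S s * f' s)"
    and "(LINT s|lebesgue_on S. f s) = (\<integral>s. indicator S s * f' s \<partial>lborel)"
proof -
  have S: "S \<inter> space lebesgue \<in> sets lebesgue" by simp
  have ae: "AE s in lebesgue. indicator S s *\<^sub>R f' s = indicator S s *\<^sub>R f s"
    by (intro AE_completion) (use eq in eventually_elim, auto split: split_indicator)
  have m': "(\<lambda>s. indicator S s *\<^sub>R f' s) \<in> borel_measurable lborel" by measurable
  then have m1: "(\<lambda>s. indicator S s *\<^sub>R f' s) \<in> borel_measurable lebesgue"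
    by (rule measurable_completion)
  have m2: "(\<lambda>s. indicator S s *\<^sub>R f s) \<in> borel_measurable lebesgue"
    by (rule borel_measurable_AE[OF m1 ae])
  then show "f \<in> borel_measurable (lebesgue_on S)"
    using borel_measurable_restrict_space_iff[OF S, of f] by simp
  show "integrable (lebesgue_on S) f \<longleftrightarrow> integrable lborel (\<lambda>s. indicator S s * f' s)"
    using integrable_restrict_space[OF S, of f] integrable_cong_AE[OF m1 m2 ae]
      integrable_completion[OF m'] by simp
  show "(LINT s|lebesgue_on S. f s) = (\<integral>s. indicator S s * f' s \<partial>lborel)"
    using integral_restrict_space[OF S, of f] integral_cong_AE[OF m1 m2 ae]
      integral_completion[OF m'] by simp
qed

lemma nn_integral_leb_interval:
  "(\<integral>\<^sup>+t. F t \<partial>leb_interval T) = (\<integral>\<^sup>+t. F t * indicator {0<..<T} t \<partial>lborel)"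
  by (simp add: nn_integral_restrict_space nn_integral_completion)

text \<open>Good representatives of the elements of \<open>L\<^sup>2(0,T)\<close>.\<close>

definition L2_supp :: "real \<Rightarrow> (real \<Rightarrow> real) \<Rightarrow> bool" where
  "L2_supp T w \<longleftrightarrow> w \<in> borel_measurable borel \<and> integrable lborel (\<lambda>t. (w t)\<^sup>2)
     \<and> (\<forall>t. t \<notin> {0<..<T} \<longrightarrow> w t = 0)"

lemma L2_suppI:
  assumes [measurable]: "h \<in> borel_measurable borel" and "integrable lborel (\<lambda>t. indicator {0<..<T} t * (h t)\<^sup>2)"
  shows "L2_supp T (\<lambda>t. indicator {0<..<T} t * h t)"
proof -
  have "(\<lambda>t. (indicator {0<..<T} t * h t)\<^sup>2) = (\<lambda>t. indicator {0<..<T} t * (h t)\<^sup>2)"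
    by (auto split: split_indicator)
  then show ?thesis using assms by (auto simp: L2_supp_def)
qed

lemma L2I:
  assumes w': "L2_supp T w'" and eq: "AE s in lborel. 0 < s \<and> s < T \<longrightarrow> w s = w' s"
  shows "w \<in> L2 T"
proof -
  have [measurable]: "w' \<in> borel_measurable borel" using w' by (simp add: L2_supp_def)
  have e1: "AE s in lborel. s \<in> {0<..<T} \<longrightarrow> w s = w' s"
    and e2: "AE s in lborel. s \<in> {0<..<T} \<longrightarrow> (w s)\<^sup>2 = (w' s)\<^sup>2"
    using eq by (auto elim: eventually_mono)
  have "(\<lambda>t. indicator {0<..<T} t * (w' t)\<^sup>2) = (\<lambda>t. (w' t)\<^sup>2)"
    using w' by (auto simp: L2_supp_def split: split_indicator)
  then show ?thesis
    using lebesgue_on_AE_borel(1)[OF _ _ e1] lebesgue_on_AE_borel(2)[OF _ _ e2] w'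
    by (simp add: L2_def L2_supp_def)
qed

lemma L2E:
  assumes "w \<in> L2 T"
  obtains w' where "L2_supp T w'" "AE s in lborel. 0 < s \<and> s < T \<longrightarrow> w s = w' s"
proof -
  have S: "{0<..<T} \<inter> space lebesgue \<in> sets lebesgue" by simp
  have "(\<lambda>s. indicator {0<..<T} s *\<^sub>R w s) \<in> borel_measurable lebesgue"
    using assms borel_measurable_restrict_space_iff[OF S, of w] by (simp add: L2_def)
  from completion_ex_borel_measurable_real[OF this]
  obtain h where [measurable]: "h \<in> borel_measurable borel"
    and h: "AE s in lborel. indicator {0<..<T} s *\<^sub>R w s = h s" by auto
  let ?w = "\<lambda>s. indicator {0<..<T} s * h s"
  have eq: "AE s in lborel. 0 < s \<and> s < T \<longrightarrow> w s = ?w s"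
    using h by eventually_elim (auto split: split_indicator)
  then have eq2: "AE s in lborel. s \<in> {0<..<T} \<longrightarrow> (w s)\<^sup>2 = (h s)\<^sup>2"
    by (auto elim!: eventually_mono)
  have "L2_supp T ?w"
    using assms lebesgue_on_AE_borel(2)[OF _ _ eq2] by (intro L2_suppI) (simp_all add: L2_def)
  with eq show ?thesis by (rule that[rotated])
qed

lemma L2_supp_integrable:
  assumes w: "L2_supp T w"
  shows "integrable lborel w"
proof (rule Bochner_Integration.integrable_bound)
  show "integrable lborel (\<lambda>t. indicator {0<..<T} t + (w t)\<^sup>2)"
    using w by (intro Bochner_Integration.integrable_add)
      (use emeasure_lborel_box_finite[of 0 T] in \<open>auto simp: L2_supp_def\<close>)
  show "w \<in> borel_measurable lborel" using w by (simp add: L2_supp_def)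
  have "\<bar>x\<bar> \<le> 1 + x\<^sup>2" for x :: real
  proof -
    show ?thesis using sum_squares_bound[of "\<bar>x\<bar>" 1] abs_ge_zero[of x]
      unfolding power2_abs power_one by linarith
  qed
  then show "AE t in lborel. norm (w t) \<le> norm (indicator {0<..<T} t + (w t)\<^sup>2)"
    using w by (intro AE_I2) (auto simp: L2_supp_def split: split_indicator)
qed

lemma L2_supp_causal: "L2_supp T w \<Longrightarrow> causal w"
  by (intro causalI_integrable L2_supp_integrable) (auto simp: L2_supp_def)

text \<open>Below \<open>T\<close> only the truncated, integrable part of the kernel matters, so Young's inequality applies.\<close>

lemma L2_supp_conv:
  assumes k: "causal k" and w: "L2_supp T w"
  shows "L2_supp T (\<lambda>t. indicator {0<..<T} t * conv k w t)"
proof (rule L2_suppI)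
  note c = L2_supp_causal[OF w]
  show m: "conv k w \<in> borel_measurable borel"
    by (intro causal_measurable causal_conv k c)
  have tw: "trunc T w = w" using w by (auto simp: trunc_def L2_supp_def)
  have eq: "conv k w t = conv (trunc T k) w t" if "t \<le> T" for t
    using conv_trunc[OF k c that] tw by simp
  have [measurable]: "w \<in> borel_measurable borel" "conv k w \<in> borel_measurable borel"
    using w m by (auto simp: L2_supp_def)
  have "integrable lborel (\<lambda>t. (conv (trunc T k) w t)\<^sup>2)"
    using w by (intro conv_Young causal_trunc k) (auto simp: L2_supp_def)
  then show "integrable lborel (\<lambda>t. indicator {0<..<T} t * (conv k w t)\<^sup>2)"
    by (rule Bochner_Integration.integrable_bound) (auto simp: eq split: split_indicator)
qed

lemma L2_supp_lincomb:
  assumes f: "L2_supp T f" and g: "L2_supp T g"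
  shows "L2_supp T (\<lambda>t. f t + c * g t)"
proof -
  have [measurable]: "f \<in> borel_measurable borel" "g \<in> borel_measurable borel"
    using f g by (auto simp: L2_supp_def)
  have f2: "integrable lborel (\<lambda>t. (f t)\<^sup>2)" and g2: "integrable lborel (\<lambda>t. (g t)\<^sup>2)"
    using f g by (auto simp: L2_supp_def)
  have "integrable lborel (\<lambda>t. f t * g t)"
    by (rule Cauchy_Schwarz_integral(1)[OF _ _ f2 g2]) auto
  then have "integrable lborel (\<lambda>t. (f t)\<^sup>2 + 2 * c * (f t * g t) + c\<^sup>2 * (g t)\<^sup>2)"
    using f2 g2 by simp
  moreover have "(f t)\<^sup>2 + 2 * c * (f t * g t) + c\<^sup>2 * (g t)\<^sup>2 = (f t + c * g t)\<^sup>2" for t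
    by (simp add: power2_sum power_mult_distrib)
  ultimately show ?thesis
    using f g by (simp add: L2_supp_def)
qed

lemma Volterra_integral_eq_conv:
  assumes k: "causal k" and w': "causal w'" and eq: "AE s in lborel. 0 < s \<and> s < T \<longrightarrow> w s = w' s"
    and t: "t \<le> T" and k': "\<And>s. 0 < s \<Longrightarrow> s < t \<Longrightarrow> k' s = k (t - s)"
  shows "(LINT s|lebesgue_on {0<..<t}. k' s * w s) = conv k w' t"
proof -
  have [measurable]: "k \<in> borel_measurable borel" "w' \<in> borel_measurable borel"
    using k w' by (auto simp: causal_def)
  have "AE s in lborel. s \<in> {0<..<t} \<longrightarrow> k' s * w s = k (t - s) * w' s"
    using eq by eventually_elim (use t k' in auto)
  from lebesgue_on_AE_borel(3)[OF _ _ this]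
  have "(LINT s|lebesgue_on {0<..<t}. k' s * w s) = (\<integral>s. indicator {0<..<t} s * (k (t - s) * w' s) \<partial>lborel)"
    by simp
  also have "(\<lambda>s. indicator {0<..<t} s * (k (t - s) * w' s)) = (\<lambda>s. k (t - s) * w' s)"
  proof
    fix s
    show "indicator {0<..<t} s * (k (t - s) * w' s) = k (t - s) * w' s"
      using causal_zero[OF k, of "t - s"] causal_zero[OF w', of s] by (auto split: split_indicator)
  qed
  finally show ?thesis by (simp add: conv_def)
qed

lemma frac_integral_eq_conv:
  assumes "0 < \<alpha>" and w': "causal w'" and eq: "AE s in lborel. 0 < s \<and> s < T \<longrightarrow> w s = w' s" and t: "t \<le> T"
  shows "frac_integral \<alpha> w t = conv (frac_kernel \<alpha>) w' t"
proof -
  have "frac_integral \<alpha> w t = (LINT s|lebesgue_on {0<..<t}. ((t - s) powr (\<alpha> - 1) / Gamma \<alpha>) * w s)"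
    unfolding frac_integral_def integral_mult_right_zero[symmetric] by simp
  also have "\<dots> = conv (frac_kernel \<alpha>) w' t"
    by (rule Volterra_integral_eq_conv[OF causal_frac_kernel[OF assms(1)] w' eq t])
      (simp add: frac_kernel_def)
  finally show ?thesis .
qed

section \<open>The Volterra equation\<close>

lemma conv_resolvent_kernel:
  assumes \<alpha>: "0 < \<alpha>" and g: "causal g"
  shows "AE t in lborel. conv (resolvent_kernel \<alpha> lam) g t
     = conv (frac_kernel \<alpha>) g t - lam * conv (conv (frac_kernel \<alpha>) (resolvent_kernel \<alpha> lam)) g t"
proof -
  let ?K = "frac_kernel \<alpha>" and ?R = "resolvent_kernel \<alpha> lam"
  note K = causal_frac_kernel[OF \<alpha>] and R = causal_resolvent_kernel[OF \<alpha>, of lam]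
  have eq: "?R = (\<lambda>s. ?K s + (- lam) * conv ?K ?R s)"
    using resolvent_equation[OF \<alpha>, of lam] by (auto simp: fun_eq_iff)
  show ?thesis
    using causal_conv_lincomb[OF g K causal_conv[OF K R], of "- lam"] 
  proof eventually_elim
    case (elim t)
    have "conv ?R g t = conv g ?R t" by (rule conv_commute)
    also have "\<dots> = conv g (\<lambda>s. ?K s + (- lam) * conv ?K ?R s) t"
      using arg_cong[OF eq, of "\<lambda>r. conv g r t"] .
    also have "\<dots> = conv g ?K t + (- lam) * conv g (conv ?K ?R) t" by (rule elim)
    finally show ?case by (simp add: conv_commute[of g])
  qed
qed

text \<open>With \<open>r = k - \<lambda> k * r\<close> one computes \<open>k * (g - \<lambda> r * g) = (k - \<lambda> k * r) * g = r * g\<close>.\<close>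

lemma resolvent_solves:
  assumes \<alpha>: "0 < \<alpha>" and g: "causal g"
  shows "AE t in lborel. conv (frac_kernel \<alpha>) (\<lambda>s. g s + (- lam) * conv (resolvent_kernel \<alpha> lam) g s) t
     = conv (resolvent_kernel \<alpha> lam) g t"
proof -
  note K = causal_frac_kernel[OF \<alpha>] and R = causal_resolvent_kernel[OF \<alpha>, of lam]
  show ?thesis
    using causal_conv_lincomb[OF K g causal_conv[OF R g], of "- lam"] causal_conv_assoc[OF K R g]
      conv_resolvent_kernel[OF \<alpha> g, of lam]
    by eventually_elim simp
qed

text \<open>The function \<open>e = D + \<lambda> k * D\<close> vanishes up to time \<open>T\<close>, hence so does
  \<open>r * e = r * D + \<lambda> r * k * D = k * D\<close>, by the resolvent equation.\<close>

lemma resolvent_unique: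
  assumes \<alpha>: "0 < \<alpha>" and D: "causal D"
    and eq: "AE t in lborel. 0 < t \<and> t < T \<longrightarrow> D t = - lam * conv (frac_kernel \<alpha>) D t"
  shows "AE t in lborel. t < T \<longrightarrow> conv (frac_kernel \<alpha>) D t = 0"
proof -
  let ?K = "frac_kernel \<alpha>" and ?R = "resolvent_kernel \<alpha> lam"
  note K = causal_frac_kernel[OF \<alpha>] and R = causal_resolvent_kernel[OF \<alpha>, of lam]
  note KD = causal_conv[OF K D]
  let ?e = "\<lambda>s. D s + lam * conv ?K D s"
  have e: "causal ?e" by (rule causal_lincomb[OF D KD])
  have e0: "AE t in lborel. t < T \<longrightarrow> ?e t = 0"
    using eq proof eventually_elim
    case (elim t)
    then show ?case using causal_zero[OF e, of t] by (cases "0 < t") auto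
  qed
  have z: "causal (\<lambda>_. 0)" by (rule causalI_integrable) auto
  have RK: "conv ?R ?K = conv ?K ?R" by (rule ext, rule conv_commute)
  have c: "conv ?R ?e t = 0" if "t \<le> T" for t
    using conv_cong_upto[OF R e z that e0] by (simp add: conv_def)
  show ?thesis
    using causal_conv_lincomb[OF R D KD, of lam] causal_conv_assoc[OF R K D] conv_resolvent_kernel[OF \<alpha> D, of lam]
  proof eventually_elim
    case (elim t)
    show ?case
    proof
      assume "t < T"
      then have "conv ?R ?e t = 0" by (intro c) simp
      with elim show "conv ?K D t = 0" by (simp add: RK)
    qed
  qed
qed

section \<open>A square function estimate\<close>

abbreviation lborel2 :: "(real \<times> real) measure" where
  "lborel2 \<equiv> lborel \<Otimes>\<^sub>M lborel"

definition autocorr :: "(real \<Rightarrow> real) \<Rightarrow> real \<Rightarrow> real" where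
  "autocorr w z = (\<integral>t. w t * w (t + z) \<partial>lborel)"

lemma pair_sigma_finite_lborel_lborel2: "pair_sigma_finite lborel lborel2"
  by (simp add: pair_sigma_finite_def lborel.sigma_finite_measure_axioms
        lborel_pair.P.sigma_finite_measure_axioms)

lemma borel_measurable_autocorr [measurable]:
  assumes [measurable]: "w \<in> borel_measurable borel"
  shows "autocorr w \<in> borel_measurable borel"
  unfolding autocorr_def[abs_def] by measurable

lemma autocorr_minus: "autocorr w (- z) = autocorr w z"
  unfolding autocorr_def
  by (subst lborel_integral_real_affine[of 1 _ z]) (simp_all add: add.commute mult.commute)

lemma autocorr_shift: "(\<integral>t. w (t - x) * w (t - y) \<partial>lborel) = autocorr w (x - y)"
  unfolding autocorr_def
  by (subst lborel_integral_real_affine[of 1 _ x]) (simp_all add: algebra_simps)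

lemma
  assumes [measurable]: "w \<in> borel_measurable borel" and w: "integrable lborel (\<lambda>t. (w t)\<^sup>2)"
  shows integrable_shift_mult: "integrable lborel (\<lambda>t. w (t - x) * w (t - y))"
    and abs_autocorr_le: "\<bar>autocorr w z\<bar> \<le> (\<integral>t. (w t)\<^sup>2 \<partial>lborel)"
proof -
  have i: "integrable lborel (\<lambda>t. (w (t - x))\<^sup>2)" for x
    using lborel_integrable_real_affine[OF w, of 1 "- x"] by simp
  show "integrable lborel (\<lambda>t. w (t - x) * w (t - y))"
    by (rule Cauchy_Schwarz_integral(1)[OF _ _ i i]) simp_all
  have e: "(\<integral>t. (w (t - x))\<^sup>2 \<partial>lborel) = (\<integral>t. (w t)\<^sup>2 \<partial>lborel)" for x
    by (subst lborel_integral_real_affine[of 1 _ x]) simp_all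
  have "(autocorr w z)\<^sup>2 \<le> (\<integral>t. (w t)\<^sup>2 \<partial>lborel) * (\<integral>t. (w t)\<^sup>2 \<partial>lborel)"
    using Cauchy_Schwarz_integral(2)[OF _ _ i i, of z 0] autocorr_shift[of w z 0] e[of z] e[of 0] by simp
  then show "\<bar>autocorr w z\<bar> \<le> (\<integral>t. (w t)\<^sup>2 \<partial>lborel)"
    by (intro abs_le_square_iff[THEN iffD2, of _ "\<integral>t. (w t)\<^sup>2 \<partial>lborel", simplified])
      (simp add: power2_eq_square)
qed

lemma integrable_pair_mult:
  fixes f g :: "_ \<Rightarrow> real"
  assumes "pair_sigma_finite M N" and f: "integrable M f" and g: "integrable N g"
  shows "integrable (M \<Otimes>\<^sub>M N) (\<lambda>p. f (fst p) * g (snd p))"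
proof -
  interpret pair_sigma_finite M N by fact
  have [measurable]: "f \<in> borel_measurable M" "g \<in> borel_measurable N" using f g by auto
  show ?thesis
  proof (rule Fubini_integrable)
    show "integrable M (\<lambda>x. \<integral>y. norm (f (fst (x, y)) * g (snd (x, y))) \<partial>N)"
      using f by (simp add: abs_mult)
    show "AE x in M. integrable N (\<lambda>y. f (fst (x, y)) * g (snd (x, y)))"
      using g by simp
  qed measurable
qed

lemma integrable_pair_times:
  "integrable lborel d \<Longrightarrow> integrable lborel2 (\<lambda>x. d (fst x) * d (snd x) :: real)"
  by (rule integrable_pair_mult[OF lborel_pair.pair_sigma_finite_axioms])

text \<open>Expanding the square gives a double integral over \<open>(p, q)\<close> in which the integration over \<open>t\<close> produces
  the autocorrelation of \<open>w\<close>.\<close>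

lemma
  assumes d: "integrable lborel d" and [measurable]: "w \<in> borel_measurable borel"
    and w: "integrable lborel (\<lambda>t. (w t)\<^sup>2)"
  shows integrable_dilated_conv: "integrable lborel (\<lambda>t. (\<integral>p. d p * w (t - h * p) \<partial>lborel)\<^sup>2)"
    and integral_dilated_conv: "(\<integral>t. (\<integral>p. d p * w (t - h * p) \<partial>lborel)\<^sup>2 \<partial>lborel)
      = (\<integral>x. d (fst x) * d (snd x) * autocorr w (h * (fst x - snd x)) \<partial>lborel2)"
proof -
  interpret P: pair_sigma_finite lborel lborel2 by (rule pair_sigma_finite_lborel_lborel2)
  have [measurable]: "d \<in> borel_measurable borel" using d by auto
  let ?M = "\<integral>t. (w t)\<^sup>2 \<partial>lborel"
  let ?F = "\<lambda>y. (d (fst (snd y)) * w (fst y - h * fst (snd y))) * (d (snd (snd y)) * w (fst y - h * snd (snd y)))"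
  have aw: "integrable lborel (\<lambda>t. \<bar>w t\<bar>\<^sup>2)" using w by simp
  have F: "integrable (lborel \<Otimes>\<^sub>M lborel2) ?F"
  proof (rule integrableI_bounded)
    show "?F \<in> borel_measurable (lborel \<Otimes>\<^sub>M lborel2)" by measurable
    have "(\<integral>\<^sup>+y. ennreal (norm (?F y)) \<partial>(lborel \<Otimes>\<^sub>M lborel2))
        = (\<integral>\<^sup>+x. \<integral>\<^sup>+t. ennreal \<bar>d (fst x) * d (snd x)\<bar> * ennreal (\<bar>w (t - h * fst x)\<bar> * \<bar>w (t - h * snd x)\<bar>) \<partial>lborel \<partial>lborel2)"
      by (subst P.nn_integral_snd[symmetric])
        (auto simp: abs_mult ennreal_mult'[symmetric] algebra_simps intro!: nn_integral_cong)
    also have "\<dots> = (\<integral>\<^sup>+x. ennreal \<bar>d (fst x) * d (snd x)\<bar> *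
        (\<integral>\<^sup>+t. ennreal (\<bar>w (t - h * fst x)\<bar> * \<bar>w (t - h * snd x)\<bar>) \<partial>lborel) \<partial>lborel2)"
      by (intro nn_integral_cong nn_integral_cmult) measurable
    also have "\<dots> \<le> (\<integral>\<^sup>+x. ennreal \<bar>d (fst x) * d (snd x)\<bar> * ennreal ?M \<partial>lborel2)"
    proof (intro nn_integral_mono mult_left_mono)
      fix x
      have "(\<integral>\<^sup>+t. ennreal (\<bar>w (t - h * fst x)\<bar> * \<bar>w (t - h * snd x)\<bar>) \<partial>lborel)
          = ennreal (\<integral>t. \<bar>w (t - h * fst x)\<bar> * \<bar>w (t - h * snd x)\<bar> \<partial>lborel)"
        by (intro nn_integral_eq_integral integrable_shift_mult[OF _ aw]) auto
      also have "\<dots> \<le> ennreal ?M"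
        using abs_autocorr_le[OF _ aw, of "h * fst x - h * snd x"] autocorr_shift[of "\<lambda>t. \<bar>w t\<bar>" "h * fst x" "h * snd x"]
        by (intro ennreal_leI) simp
      finally show "(\<integral>\<^sup>+t. ennreal (\<bar>w (t - h * fst x)\<bar> * \<bar>w (t - h * snd x)\<bar>) \<partial>lborel) \<le> ennreal ?M" .
    qed simp
    also have "\<dots> = (\<integral>\<^sup>+x. ennreal \<bar>d (fst x) * d (snd x)\<bar> \<partial>lborel2) * ennreal ?M"
      by (rule nn_integral_multc) measurable
    also have "\<dots> < \<infinity>"
      using integrable_pair_times[OF d] by (simp add: integrable_iff_bounded ennreal_mult_less_top)
    finally show "(\<integral>\<^sup>+y. ennreal (norm (?F y)) \<partial>(lborel \<Otimes>\<^sub>M lborel2)) < \<infinity>" .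
  qed
  have ae: "AE t in lborel. (\<integral>x. ?F (t, x) \<partial>lborel2) = (\<integral>p. d p * w (t - h * p) \<partial>lborel)\<^sup>2"
    using P.AE_integrable_fst'[OF F]
  proof eventually_elim
    case (elim t)
    have "(\<integral>x. ?F (t, x) \<partial>lborel2) = (\<integral>p. \<integral>q. ?F (t, (p, q)) \<partial>lborel \<partial>lborel)"
      by (rule lborel_pair.integral_fst'[symmetric, OF elim])
    then show ?case by (simp add: power2_eq_square)
  qed
  have m: "(\<lambda>t. \<integral>x. ?F (t, x) \<partial>lborel2) \<in> borel_measurable lborel"
    "(\<lambda>t. (\<integral>p. d p * w (t - h * p) \<partial>lborel)\<^sup>2) \<in> borel_measurable lborel"
    by measurable
  show "integrable lborel (\<lambda>t. (\<integral>p. d p * w (t - h * p) \<partial>lborel)\<^sup>2)"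
    using P.integrable_fst'[OF F] integrable_cong_AE[OF m ae] by blast
  have "(\<integral>t. (\<integral>p. d p * w (t - h * p) \<partial>lborel)\<^sup>2 \<partial>lborel) = (\<integral>t. \<integral>x. ?F (t, x) \<partial>lborel2 \<partial>lborel)"
    using integral_cong_AE[OF m ae] by simp
  also have "\<dots> = (\<integral>x. \<integral>t. ?F (t, x) \<partial>lborel \<partial>lborel2)"
    using P.Fubini_integral[of "\<lambda>t x. ?F (t, x)"] F by (simp add: case_prod_unfold)
  also have "\<dots> = (\<integral>x. d (fst x) * d (snd x) * autocorr w (h * (fst x - snd x)) \<partial>lborel2)"
  proof (rule Bochner_Integration.integral_cong[OF refl])
    fix x
    have "(\<integral>t. ?F (t, x) \<partial>lborel) = (\<integral>t. d (fst x) * d (snd x) * (w (t - h * fst x) * w (t - h * snd x)) \<partial>lborel)"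
      by (intro Bochner_Integration.integral_cong) (auto simp: algebra_simps)
    also have "\<dots> = d (fst x) * d (snd x) * autocorr w (h * fst x - h * snd x)"
      by (simp add: autocorr_shift)
    finally show "(\<integral>t. ?F (t, x) \<partial>lborel) = d (fst x) * d (snd x) * autocorr w (h * (fst x - snd x))"
      by (simp add: right_diff_distrib)
  qed
  finally show "(\<integral>t. (\<integral>p. d p * w (t - h * p) \<partial>lborel)\<^sup>2 \<partial>lborel)
      = (\<integral>x. d (fst x) * d (snd x) * autocorr w (h * (fst x - snd x)) \<partial>lborel2)" .
qed

text \<open>The integral of \<open>c(h z)\<close> against the dilation-invariant measure \<open>dh / h\<close> on \<open>(\<epsilon>, R)\<close>.\<close>

definition log_mean :: "real \<Rightarrow> real \<Rightarrow> (real \<Rightarrow> real) \<Rightarrow> real \<Rightarrow> real" where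
  "log_mean \<epsilon> R c z = (\<integral>h. indicator {\<epsilon><..<R} h / h * c (h * z) \<partial>lborel)"

lemma
  assumes a: "0 < a" and z: "0 < z"
  shows integrable_inverse_between: "integrable lborel (\<lambda>s. indicator {min a (a * z)..max a (a * z)} s / s :: real)"
    and integral_inverse_between: "(\<integral>s. indicator {min a (a * z)..max a (a * z)} s / s \<partial>lborel) = \<bar>ln z\<bar>"
proof -
  let ?l = "min a (a * z)" and ?u = "max a (a * z)"
  have l: "0 < ?l" using a z by simp
  have "has_bochner_integral lborel (\<lambda>x. 1 / x * indicator {?l..?u} x) (ln ?u - ln ?l)"
  proof (rule has_bochner_integral_FTC_Icc_nonneg)
    show "(\<lambda>x::real. 1 / x) \<in> borel_measurable borel" by measurable
    show "DERIV ln x :> 1 / x" if "x \<in> {?l..?u}" for x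
      using that l by (intro DERIV_ln_divide) (auto simp: min_le_iff_disj)
    show "0 \<le> 1 / x" if "x \<in> {?l..?u}" for x
      using that l by (auto simp: min_le_iff_disj)
  qed simp
  moreover have eq: "(\<lambda>x. 1 / x * indicator {?l..?u} x) = (\<lambda>s. indicator {?l..?u} s / s)"
    by (simp add: fun_eq_iff)
  moreover have "ln ?u - ln ?l = \<bar>ln z\<bar>"
  proof (cases "1 \<le> z")
    case True
    then have "?u = a * z" "?l = a" "0 \<le> ln z" using a by (auto simp: max_def min_def)
    then show ?thesis using a z by (simp add: ln_mult)
  next
    case False
    then have "?u = a" "?l = a * z" "ln z < 0" using a z by (auto simp: max_def min_def)
    then show ?thesis using a z by (simp add: ln_mult)
  qed
  ultimately have hb: "has_bochner_integral lborel (\<lambda>s. indicator {?l..?u} s / s) \<bar>ln z\<bar>"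
    by (simp only:)
  show "integrable lborel (\<lambda>s. indicator {?l..?u} s / s)"
    using hb by (simp add: has_bochner_integral_iff)
  show "(\<integral>s. indicator {?l..?u} s / s \<partial>lborel) = \<bar>ln z\<bar>"
    using hb by (simp add: has_bochner_integral_iff)
qed

lemma integrable_indicator_inverse:
  fixes a b :: real
  assumes "0 < a"
  shows "integrable lborel (\<lambda>s. indicator {a<..<b} s / s :: real)"
proof (cases "a < b")
  case True
  have "integrable lborel (\<lambda>s. indicator {min a (a * (b / a))..max a (a * (b / a))} s / s :: real)"
    using assms True by (intro integrable_inverse_between) auto
  then show ?thesis
    by (rule Bochner_Integration.integrable_bound) (use assms in \<open>auto split: split_indicator\<close>)
qed auto

lemma indicator_Ioo_diff_le:
  fixes a b a' b' s :: real
  shows "\<bar>indicator {a'<..<b'} s - indicator {a<..<b} s\<bar>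
    \<le> (indicator {min a a'..max a a'} s + indicator {min b b'..max b b'} s :: real)"
proof -
  consider "(a < s) \<noteq> (a' < s)" | "(s < b) \<noteq> (s < b')" | "(a < s) = (a' < s)" "(s < b) = (s < b')"
    by blast
  then show ?thesis
  proof cases
    case 1
    then have "s \<in> {min a a'..max a a'}" by auto
    then show ?thesis by (simp add: indicator_def)
  next
    case 2
    then have "s \<in> {min b b'..max b b'}" by auto
    then show ?thesis by (simp add: indicator_def)
  next
    case 3
    then have "s \<in> {a'<..<b'} \<longleftrightarrow> s \<in> {a<..<b}" by simp
    then have "indicator {a'<..<b'} s = (indicator {a<..<b} s :: real)" by (simp add: indicator_def)
    then show ?thesis by simp
  qed
qed

lemma weighted_diff_le:
  fixes i1 i2 i3 i4 c s M :: real
  assumes i: "\<bar>i1 - i2\<bar> \<le> i3 + i4" and c: "\<bar>c\<bar> \<le> M" and s: "0 < s"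
  shows "\<bar>i1 / s * c - i2 / s * c\<bar> \<le> M * (i3 / s + i4 / s)"
proof -
  have "\<bar>i1 / s * c - i2 / s * c\<bar> = \<bar>i1 - i2\<bar> * (\<bar>c\<bar> / s)"
    using s by (simp add: abs_mult[symmetric] abs_divide[symmetric] field_simps)
  also have "\<dots> \<le> (i3 + i4) * (M / s)"
    using i c s by (intro mult_mono divide_right_mono) auto
  also have "\<dots> = M * (i3 / s + i4 / s)" using s by (simp add: field_simps)
  finally show ?thesis .
qed

text \<open>Substituting \<open>s = h z\<close> turns the window \<open>(\<epsilon>, R)\<close> into \<open>(\<epsilon> z, R z)\<close>. The two windows differ only between
  \<open>\<epsilon>\<close> and \<open>\<epsilon> z\<close> and between \<open>R\<close> and \<open>R z\<close>, and each of these pieces has \<open>ds / s\<close>-measure \<open>\<bar>ln z\<bar>\<close>,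
  whatever \<open>\<epsilon>\<close> and \<open>R\<close> are.\<close>

lemma log_mean_diff:
  assumes [measurable]: "c \<in> borel_measurable borel" and c: "\<And>s. \<bar>c s\<bar> \<le> M" and even: "\<And>s. c (- s) = c s"
    and e: "0 < \<epsilon>" and R: "0 < R" and z: "z \<noteq> 0"
  shows "\<bar>log_mean \<epsilon> R c z - log_mean \<epsilon> R c 1\<bar> \<le> 2 * M * \<bar>ln \<bar>z\<bar>\<bar>"
proof -
  have M: "0 \<le> M" using c[of 0] by linarith
  define y where "y = \<bar>z\<bar>"
  have y: "0 < y" using z by (simp add: y_def)
  have "c (h * z) = c (h * y)" for h
  proof (cases "0 \<le> z")
    case False
    then have "h * z = - (h * y)" by (simp add: y_def)
    then show ?thesis by (simp only: even)
  qed (simp add: y_def)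
  then have zy: "log_mean \<epsilon> R c z = log_mean \<epsilon> R c y" by (simp add: log_mean_def)
  let ?I = "\<lambda>z s. indicator {\<epsilon> * z<..<R * z} s / s * c s :: real"
  have G: "log_mean \<epsilon> R c x = (\<integral>s. ?I x s \<partial>lborel)" if x: "0 < x" for x
  proof -
    have "(\<integral>s. ?I x s \<partial>lborel) = x * (\<integral>h. ?I x (0 + x * h) \<partial>lborel)"
      using x by (subst lborel_integral_real_affine[of x _ 0]) simp_all
    also have "\<dots> = (\<integral>h. x * ?I x (0 + x * h) \<partial>lborel)"
      by (rule integral_mult_right_zero[symmetric])
    also have "\<dots> = log_mean \<epsilon> R c x"
      unfolding log_mean_def
      using x by (intro Bochner_Integration.integral_cong) (auto split: split_indicator simp: mult.commute)
    finally show ?thesis ..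
  qed
  have int: "integrable lborel (?I x)" if x: "0 < x" for x
  proof (rule Bochner_Integration.integrable_bound)
    show "integrable lborel (\<lambda>s. M * (indicator {\<epsilon> * x<..<R * x} s / s))"
      using e x by (intro integrable_mult_right integrable_indicator_inverse) simp
    have "0 < s" if "\<epsilon> * x < s" for s using that mult_pos_pos[OF e x] by linarith
    then show "AE s in lborel. norm (?I x s) \<le> norm (M * (indicator {\<epsilon> * x<..<R * x} s / s))"
      using c M by (intro AE_I2) (auto split: split_indicator simp: abs_mult abs_divide divide_right_mono)
  qed simp
  let ?J = "\<lambda>a s. indicator {min a (a * y)..max a (a * y)} s / s :: real"
  note J = integrable_inverse_between[OF e y] integrable_inverse_between[OF R y]
  have "\<bar>log_mean \<epsilon> R c z - log_mean \<epsilon> R c 1\<bar> = \<bar>\<integral>s. ?I y s - ?I 1 s \<partial>lborel\<bar>"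
    by (simp only: zy G[OF y] G[OF zero_less_one]
        Bochner_Integration.integral_diff[OF int[OF y] int[OF zero_less_one]])
  also have "\<dots> \<le> (\<integral>s. \<bar>?I y s - ?I 1 s\<bar> \<partial>lborel)" by (rule integral_abs_bound)
  also have "\<dots> \<le> (\<integral>s. M * (?J \<epsilon> s + ?J R s) \<partial>lborel)"
  proof (rule integral_mono)
    show "integrable lborel (\<lambda>s. \<bar>?I y s - ?I 1 s\<bar>)"
      by (intro integrable_abs Bochner_Integration.integrable_diff int y zero_less_one)
    show "integrable lborel (\<lambda>s. M * (?J \<epsilon> s + ?J R s))"
      by (intro integrable_mult_right Bochner_Integration.integrable_add J)
    fix s
    show "\<bar>?I y s - ?I 1 s\<bar> \<le> M * (?J \<epsilon> s + ?J R s)"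
    proof (cases "0 < s")
      case True
      show ?thesis
        using weighted_diff_le[OF indicator_Ioo_diff_le[of "\<epsilon> * y" "R * y" s \<epsilon> R] c[of s] True]
        by (simp only: mult_1_right)
    next
      case False
      then have "s < \<epsilon>" "s < \<epsilon> * y" "s < R" "s < R * y"
        using e R mult_pos_pos[OF e y] mult_pos_pos[OF R y] by simp_all
      then have "s \<notin> {\<epsilon> * y<..<R * y}" "s \<notin> {\<epsilon> * 1<..<R * 1}"
          "s \<notin> {min \<epsilon> (\<epsilon> * y)..max \<epsilon> (\<epsilon> * y)}" "s \<notin> {min R (R * y)..max R (R * y)}"
        by (simp_all add: not_le)
      then have z: "indicator {\<epsilon> * y<..<R * y} s = (0::real)" "indicator {\<epsilon> * 1<..<R * 1} s = (0::real)"
          "indicator {min \<epsilon> (\<epsilon> * y)..max \<epsilon> (\<epsilon> * y)} s = (0::real)"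
          "indicator {min R (R * y)..max R (R * y)} s = (0::real)"
        by (simp_all only: indicator_simps not_False_eq_True)
      show ?thesis unfolding z by simp
    qed
  qed
  also have "\<dots> = M * (\<bar>ln y\<bar> + \<bar>ln y\<bar>)"
    by (simp only: integral_mult_right_zero Bochner_Integration.integral_add[OF J]
        integral_inverse_between[OF e y] integral_inverse_between[OF R y])
  also have "\<dots> = 2 * M * \<bar>ln \<bar>z\<bar>\<bar>" by (simp add: y_def)
  finally show ?thesis .
qed

text \<open>Let \<open>d\<^sub>h(x) = d(x / h) / h\<close>, so that the inner integral is \<open>(d\<^sub>h * w)(t)\<close>. The plain bound \<open>\<parallel>d\<^sub>h * w\<parallel> \<le> \<parallel>d\<parallel>\<^sub>1 \<parallel>w\<parallel>\<close> would make
  the integral over \<open>dh / h\<close> diverge logarithmically at both ends. Written as a double integral of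
  \<open>d(p) d(q)\<close> against the logarithmic mean of the autocorrelation of \<open>w\<close> at \<open>p - q\<close>, it becomes bounded
  uniformly in \<open>\<epsilon>\<close> and \<open>R\<close>: because \<open>d\<close> has mean zero, the value of the logarithmic mean at \<open>1\<close> may be
  subtracted, and what remains is at most \<open>2 \<parallel>w\<parallel>\<^sup>2\<close> times the logarithmic energy of \<open>d\<close>.\<close>

lemma square_function_bound:
  assumes d: "integrable lborel d" and d0: "(\<integral>p. d p \<partial>lborel) = 0"
    and E: "integrable lborel2 (\<lambda>x. d (fst x) * d (snd x) * ln \<bar>fst x - snd x\<bar>)"
    and [measurable]: "w \<in> borel_measurable borel" and w: "integrable lborel (\<lambda>t. (w t)\<^sup>2)"
    and e: "0 < \<epsilon>" and R: "0 < R"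
  shows "(\<integral>\<^sup>+h. indicator {\<epsilon><..<R} h * (\<integral>\<^sup>+t. ennreal ((\<integral>p. d p * w (t - h * p) \<partial>lborel)\<^sup>2 / h) \<partial>lborel) \<partial>lborel)
    \<le> ennreal (2 * (\<integral>t. (w t)\<^sup>2 \<partial>lborel) * (\<integral>x. \<bar>d (fst x) * d (snd x) * ln \<bar>fst x - snd x\<bar>\<bar> \<partial>lborel2))"
proof -
  interpret P: pair_sigma_finite lborel lborel2 by (rule pair_sigma_finite_lborel_lborel2)
  have [measurable]: "d \<in> borel_measurable borel" using d by auto
  let ?M = "\<integral>t. (w t)\<^sup>2 \<partial>lborel" and ?c = "autocorr w"
  let ?dd = "\<lambda>x. d (fst x) * d (snd x)"
  let ?G = "log_mean \<epsilon> R ?c"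
  let ?S = "\<lambda>h t. (\<integral>p. d p * w (t - h * p) \<partial>lborel)\<^sup>2"
  let ?N = "\<lambda>h. \<integral>x. ?dd x * ?c (h * (fst x - snd x)) \<partial>lborel2"
  let ?i = "\<lambda>h. indicator {\<epsilon><..<R} h / h :: real"
  have inner: "(\<integral>h. ?i h * (?dd x * ?c (h * (fst x - snd x))) \<partial>lborel) = ?dd x * ?G (fst x - snd x)" for x
    unfolding log_mean_def integral_mult_right_zero[symmetric]
    by (intro Bochner_Integration.integral_cong refl) (rule mult.left_commute)
  have c: "\<bar>?c s\<bar> \<le> ?M" for s by (rule abs_autocorr_le[OF _ w]) simp
  have dd: "integrable lborel2 ?dd" by (rule integrable_pair_times[OF d])
  have F: "integrable (lborel \<Otimes>\<^sub>M lborel2)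
      (\<lambda>(h, x). ?i h * (?dd x * ?c (h * (fst x - snd x))))"
  proof (rule Bochner_Integration.integrable_bound)
    show "integrable (lborel \<Otimes>\<^sub>M lborel2) (\<lambda>y. ?i (fst y) * (?M * \<bar>?dd (snd y)\<bar>))"
      using dd by (intro integrable_pair_mult pair_sigma_finite_lborel_lborel2 integrable_indicator_inverse e) simp
    show "(\<lambda>(h, x). ?i h * (?dd x * ?c (h * (fst x - snd x)))) \<in> borel_measurable (lborel \<Otimes>\<^sub>M lborel2)"
      by measurable
    have "norm (?i h * (?dd x * ?c (h * (fst x - snd x)))) \<le> norm (?i h * (?M * \<bar>?dd x\<bar>))" for h x
      using mult_left_mono[OF c[of "h * (fst x - snd x)"], of "\<bar>?i h\<bar> * \<bar>?dd x\<bar>"]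
      by (simp add: abs_mult mult_ac)
    then show "AE y in lborel \<Otimes>\<^sub>M lborel2.
        norm (case y of (h, x) \<Rightarrow> ?i h * (?dd x * ?c (h * (fst x - snd x))))
        \<le> norm (?i (fst y) * (?M * \<bar>?dd (snd y)\<bar>))"
      by (intro AE_I2) (simp add: case_prod_unfold)
  qed
  have intN: "integrable lborel (\<lambda>h. ?i h * ?N h)"
    using P.integrable_fst'[OF F] by simp
  have N: "?N h = (\<integral>t. ?S h t \<partial>lborel)" for h
    using integral_dilated_conv[OF d _ w] by simp
  have N0: "0 \<le> ?i h * ?N h" for h
    using e unfolding N by (auto split: split_indicator)
  have "(\<integral>\<^sup>+h. indicator {\<epsilon><..<R} h * (\<integral>\<^sup>+t. ennreal (?S h t / h) \<partial>lborel) \<partial>lborel)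
      = (\<integral>\<^sup>+h. ennreal (?i h * ?N h) \<partial>lborel)"
  proof (intro nn_integral_cong)
    fix h
    show "indicator {\<epsilon><..<R} h * (\<integral>\<^sup>+t. ennreal (?S h t / h) \<partial>lborel) = ennreal (?i h * ?N h)"
    proof (cases "h \<in> {\<epsilon><..<R}")
      case True
      then have h: "0 < h" using e by auto
      have "(\<integral>\<^sup>+t. ennreal (?S h t / h) \<partial>lborel) = ennreal (\<integral>t. ?S h t / h \<partial>lborel)"
        using integrable_dilated_conv[OF d _ w, of h] h by (intro nn_integral_eq_integral) auto
      then show ?thesis using True by (simp add: N)
    qed simp
  qed
  also have "\<dots> = ennreal (\<integral>h. ?i h * ?N h \<partial>lborel)"
    using N0 by (intro nn_integral_eq_integral intN) auto
  also have "(\<integral>h. ?i h * ?N h \<partial>lborel) = (\<integral>h. \<integral>x. ?i h * (?dd x * ?c (h * (fst x - snd x))) \<partial>lborel2 \<partial>lborel)"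
    by simp
  also have "\<dots> = (\<integral>x. \<integral>h. ?i h * (?dd x * ?c (h * (fst x - snd x))) \<partial>lborel \<partial>lborel2)"
    by (rule P.Fubini_integral[symmetric, OF F])
  also have "\<dots> = (\<integral>x. ?dd x * ?G (fst x - snd x) \<partial>lborel2)"
    by (simp only: inner)
  also have "\<dots> = (\<integral>x. ?dd x * (?G (fst x - snd x) - ?G 1) \<partial>lborel2)"
  proof -
    have "integrable lborel2 (\<lambda>x. \<integral>h. ?i h * (?dd x * ?c (h * (fst x - snd x))) \<partial>lborel)"
      using P.integrable_snd[OF F] .
    then have "integrable lborel2 (\<lambda>x. ?dd x * ?G (fst x - snd x))" by (simp only: inner)
    moreover have "(\<integral>x. ?dd x * ?G 1 \<partial>lborel2) = 0"
    proof -
      have "(\<integral>x. ?dd x \<partial>lborel2) = (\<integral>p. \<integral>q. d p * d q \<partial>lborel \<partial>lborel)"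
        using lborel_pair.integral_fst'[OF dd] by simp
      then show ?thesis by (simp add: d0)
    qed
    ultimately show ?thesis
      using dd by (simp add: right_diff_distrib)
  qed
  also have "ennreal \<dots> \<le> ennreal (\<integral>x. 2 * ?M * \<bar>?dd x * ln \<bar>fst x - snd x\<bar>\<bar> \<partial>lborel2)"
  proof (rule ennreal_leI, rule integral_mono_AE')
    show "integrable lborel2 (\<lambda>x. 2 * ?M * \<bar>?dd x * ln \<bar>fst x - snd x\<bar>\<bar>)"
      using E by auto
    have "AE x in lborel2. fst x \<noteq> snd x"
    proof (rule lborel_pair.AE_pair_measure)
      show "{x \<in> space lborel2. fst x \<noteq> snd x} \<in> sets lborel2" by measurable
      show "AE p in lborel. AE q in lborel. fst (p :: real, q :: real) \<noteq> snd (p, q)"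
      proof (rule AE_I2)
        fix p :: real
        assume "p \<in> space lborel"
        show "AE q in lborel. fst (p, q :: real) \<noteq> snd (p, q)"
          using AE_lborel_singleton[of p] by eventually_elim auto
      qed
    qed
    then show "AE x in lborel2. ?dd x * (?G (fst x - snd x) - ?G 1) \<le> 2 * ?M * \<bar>?dd x * ln \<bar>fst x - snd x\<bar>\<bar>"
    proof eventually_elim
      case (elim x)
      have "?dd x * (?G (fst x - snd x) - ?G 1) \<le> \<bar>?dd x\<bar> * \<bar>?G (fst x - snd x) - ?G 1\<bar>"
        by (metis abs_ge_self abs_mult)
      also have "\<dots> \<le> \<bar>?dd x\<bar> * (2 * ?M * \<bar>ln \<bar>fst x - snd x\<bar>\<bar>)"
        using elim by (intro mult_left_mono log_mean_diff c e R autocorr_minus) auto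
      finally show ?case by (simp add: abs_mult mult_ac)
    qed
    show "AE x in lborel2. 0 \<le> 2 * ?M * \<bar>?dd x * ln \<bar>fst x - snd x\<bar>\<bar>" by simp
  qed
  finally show ?thesis by simp
qed

section \<open>The difference of two shifted kernels\<close>

lemma integral_powr_to_inf:
  fixes a :: real
  assumes a: "a < -1"
  shows "integrable lborel (\<lambda>x. indicator {1<..} x * x powr a)"
proof -
  have "integrable lborel (\<lambda>x. indicator {1..} x * x powr a)"
    by (rule has_integral_imp_lborel(1)[OF has_integral_powr_to_inf[OF a zero_less_one]]) auto
  then show ?thesis
    by (rule Bochner_Integration.integrable_bound) (auto split: split_indicator)
qed

text \<open>An increment of \<open>J\<^sup>\<sigma> w\<close> with step \<open>h\<close> is \<open>h\<^sup>\<sigma>\<close> times the convolution of \<open>w\<close> with the dilation by \<open>h\<close>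
  of this function. It has singularities of order \<open>\<sigma> - 1\<close> at \<open>-1\<close> and at \<open>0\<close>, and decays like \<open>p\<^sup>\<sigma>\<^sup>-\<^sup>2\<close>.\<close>

definition kernel_diff :: "real \<Rightarrow> real \<Rightarrow> real" where
  "kernel_diff \<sigma> p = frac_kernel \<sigma> (p + 1) - frac_kernel \<sigma> p"

lemma borel_measurable_kernel_diff [measurable]: "kernel_diff \<sigma> \<in> borel_measurable borel"
  unfolding kernel_diff_def[abs_def] by measurable

lemma abs_kernel_diff_le:
  assumes \<sigma>: "0 < \<sigma>" "\<sigma> < 1"
  shows "Gamma \<sigma> * \<bar>kernel_diff \<sigma> p\<bar> \<le>
    (if p \<le> -1 then 0 else if p \<le> 0 then (p + 1) powr (\<sigma> - 1)
     else if p \<le> 1 then p powr (\<sigma> - 1) else p powr (\<sigma> - 2))"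
proof -
  have G: "0 < Gamma \<sigma>" using \<sigma> by (intro Gamma_real_pos)
  show ?thesis
  proof (cases "0 < p")
    case False
    then show ?thesis using G by (auto simp: kernel_diff_def frac_kernel_def)
  next
    case True
    have mono: "(p + 1) powr (\<sigma> - 1) \<le> p powr (\<sigma> - 1)"
      using \<sigma> True by (intro powr_mono2') auto
    have eq: "Gamma \<sigma> * \<bar>kernel_diff \<sigma> p\<bar> = p powr (\<sigma> - 1) - (p + 1) powr (\<sigma> - 1)"
    proof -
      have "kernel_diff \<sigma> p = ((p + 1) powr (\<sigma> - 1) - p powr (\<sigma> - 1)) / Gamma \<sigma>"
        using True by (simp add: kernel_diff_def frac_kernel_def diff_divide_distrib)
      then show ?thesis using G mono by (simp add: abs_divide)
    qed
    have "p powr (\<sigma> - 1) - (p + 1) powr (\<sigma> - 1) \<le> p powr (\<sigma> - 2)"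
    proof -
      have e1: "p powr (\<sigma> - 1) = p powr \<sigma> / p" "(p + 1) powr (\<sigma> - 1) = (p + 1) powr \<sigma> / (p + 1)"
        "p powr (\<sigma> - 2) = p powr \<sigma> / p\<^sup>2"
        using True by (simp_all add: powr_diff)
      have "p powr \<sigma> / (p + 1) \<le> (p + 1) powr \<sigma> / (p + 1)"
        using True \<sigma> by (intro divide_right_mono powr_mono2) auto
      moreover have "p powr \<sigma> / p - p powr \<sigma> / (p + 1) = p powr \<sigma> / (p * (p + 1))"
        using True by (simp add: field_simps)
      moreover have "p powr \<sigma> / (p * (p + 1)) \<le> p powr \<sigma> / p\<^sup>2"
        using True by (intro divide_left_mono) (auto simp: power2_eq_square)
      ultimately show ?thesis unfolding e1 by linarith
    qed
    moreover have "0 \<le> (p + 1) powr (\<sigma> - 1)" by simp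
    ultimately show ?thesis
      unfolding eq using True by (cases "p \<le> 1") auto
  qed
qed

text \<open>The first condition on \<open>r\<close> makes the two singularities integrable, the second one the tail; the
  summand \<open>1\<close> in the weight lets one lemma serve for pure powers and for moments.\<close>

lemma integrable_kernel_diff_weighted:
  assumes \<sigma>: "0 < \<sigma>" "\<sigma> < 1" and r: "0 < r" and \<delta>: "0 \<le> \<delta>"
    and near: "r * (1 - \<sigma>) < 1" and far: "\<delta> + r * (\<sigma> - 2) < -1"
  shows "integrable lborel (\<lambda>p. (1 + \<bar>p\<bar> powr \<delta>) * \<bar>kernel_diff \<sigma> p\<bar> powr r)"
proof (rule Bochner_Integration.integrable_bound)
  have G: "0 < Gamma \<sigma>" using \<sigma> by (intro Gamma_real_pos)
  let ?a = "r * (\<sigma> - 1)" and ?b = "\<delta> + r * (\<sigma> - 2)"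
  let ?f = "\<lambda>p. indicator {0<..1} p * p powr ?a" and ?g = "\<lambda>p. indicator {1<..} p * p powr ?b"
  have a: "?a > -1" using near by (simp add: algebra_simps)
  have "integrable lborel (\<lambda>p. ?f (1 + 1 * p))"
    by (rule lborel_integrable_real_affine[OF integral_powr_from_0(1)[OF zero_le_one a]]) simp
  then show "integrable lborel (\<lambda>p. (2 / Gamma \<sigma> powr r) * (?f (1 + 1 * p) + ?f p + ?g p))"
    using integral_powr_from_0(1)[OF zero_le_one a] integral_powr_to_inf[OF far]
    by (intro integrable_mult_right Bochner_Integration.integrable_add)
  show "(\<lambda>p. (1 + \<bar>p\<bar> powr \<delta>) * \<bar>kernel_diff \<sigma> p\<bar> powr r) \<in> borel_measurable lborel"
    by measurable
  have bd: "(1 + \<bar>p\<bar> powr \<delta>) * \<bar>kernel_diff \<sigma> p\<bar> powr r \<le> (2 / Gamma \<sigma> powr r) * (?f (1 + 1 * p) + ?f p + ?g p)" for p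
  proof -
    let ?d = "(Gamma \<sigma> * \<bar>kernel_diff \<sigma> p\<bar>) powr r"
    note le = abs_kernel_diff_le[OF \<sigma>, of p]
    have w1: "1 + \<bar>p\<bar> powr \<delta> \<le> 2" if "\<bar>p\<bar> \<le> 1"
      using powr_mono2[of \<delta> "\<bar>p\<bar>" 1] that \<delta> by simp
    have d0: "0 \<le> Gamma \<sigma> * \<bar>kernel_diff \<sigma> p\<bar>" using G by simp
    have "(1 + \<bar>p\<bar> powr \<delta>) * ?d \<le> 2 * (?f (1 + 1 * p) + ?f p + ?g p)"
    proof -
      consider "p \<le> -1" | "-1 < p" "p \<le> 0" | "0 < p" "p \<le> 1" | "1 < p" by linarith
      then show ?thesis
      proof cases
        case 1
        then have "Gamma \<sigma> * \<bar>kernel_diff \<sigma> p\<bar> = 0" using le d0 by simp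
        then show ?thesis using 1 by (auto split: split_indicator)
      next
        case 2
        then have "?d \<le> ((p + 1) powr (\<sigma> - 1)) powr r" using le d0 r by (intro powr_mono2) auto
        also have "\<dots> = (p + 1) powr ?a" by (simp add: powr_powr mult.commute)
        finally have "(1 + \<bar>p\<bar> powr \<delta>) * ?d \<le> 2 * (p + 1) powr ?a"
          using w1 2 by (intro mult_mono) auto
        then show ?thesis using 2 by (simp add: add.commute)
      next
        case 3
        then have "?d \<le> (p powr (\<sigma> - 1)) powr r" using le d0 r by (intro powr_mono2) auto
        also have "\<dots> = p powr ?a" by (simp add: powr_powr mult.commute)
        finally have "(1 + \<bar>p\<bar> powr \<delta>) * ?d \<le> 2 * p powr ?a"
          using w1 3 by (intro mult_mono) auto
        then show ?thesis using 3 by simp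
      next
        case 4
        then have "?d \<le> (p powr (\<sigma> - 2)) powr r" using le d0 r by (intro powr_mono2) auto
        also have "\<dots> = p powr (r * (\<sigma> - 2))" by (simp add: powr_powr mult.commute)
        finally have d: "?d \<le> p powr (r * (\<sigma> - 2))" .
        have "1 \<le> p powr \<delta>" using 4 \<delta> by (intro ge_one_powr_ge_zero) auto
        then have "(1 + \<bar>p\<bar> powr \<delta>) * ?d \<le> (2 * p powr \<delta>) * p powr (r * (\<sigma> - 2))"
          using d 4 by (intro mult_mono) auto
        also have "\<dots> = 2 * p powr ?b" by (simp add: powr_add)
        finally show ?thesis using 4 by simp
      qed
    qed
    moreover have "?d = Gamma \<sigma> powr r * \<bar>kernel_diff \<sigma> p\<bar> powr r"
      using G by (simp add: powr_mult)
    moreover have "0 < Gamma \<sigma> powr r" using G by simp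
    ultimately show ?thesis by (simp add: field_simps)
  qed
  then show "AE p in lborel. norm ((1 + \<bar>p\<bar> powr \<delta>) * \<bar>kernel_diff \<sigma> p\<bar> powr r)
      \<le> norm ((2 / Gamma \<sigma> powr r) * (?f (1 + 1 * p) + ?f p + ?g p))"
  proof (intro AE_I2)
    fix p
    have "0 \<le> (1 + \<bar>p\<bar> powr \<delta>) * \<bar>kernel_diff \<sigma> p\<bar> powr r" by simp
    then show "norm ((1 + \<bar>p\<bar> powr \<delta>) * \<bar>kernel_diff \<sigma> p\<bar> powr r)
      \<le> norm ((2 / Gamma \<sigma> powr r) * (?f (1 + 1 * p) + ?f p + ?g p))"
      using bd[of p] by (simp only: real_norm_def)
  qed
qed

lemma
  assumes \<sigma>: "0 < \<sigma>" "\<sigma> < 1"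
  shows integrable_kernel_diff_powr: "\<lbrakk>1 \<le> r; r * (1 - \<sigma>) < 1\<rbrakk> \<Longrightarrow> integrable lborel (\<lambda>p. \<bar>kernel_diff \<sigma> p\<bar> powr r)"
    and integrable_kernel_diff_moment: "\<lbrakk>0 \<le> \<delta>; \<delta> < 1 - \<sigma>\<rbrakk> \<Longrightarrow> integrable lborel (\<lambda>p. \<bar>p\<bar> powr \<delta> * \<bar>kernel_diff \<sigma> p\<bar>)"
proof -
  assume r: "1 \<le> r" "r * (1 - \<sigma>) < 1"
  have "r * (\<sigma> - 2) \<le> 1 * (\<sigma> - 2)" using r \<sigma> by (intro mult_right_mono_neg) auto
  then have "r * (\<sigma> - 2) < -1" by (rule le_less_trans) (use \<sigma> in simp)
  then have "integrable lborel (\<lambda>p. (1 + \<bar>p\<bar> powr 0) * \<bar>kernel_diff \<sigma> p\<bar> powr r)"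
    using r \<sigma> by (intro integrable_kernel_diff_weighted) auto
  then show "integrable lborel (\<lambda>p. \<bar>kernel_diff \<sigma> p\<bar> powr r)"
    by (rule Bochner_Integration.integrable_bound) (auto simp: abs_mult intro!: AE_I2)
next
  assume \<delta>: "0 \<le> \<delta>" "\<delta> < 1 - \<sigma>"
  have "integrable lborel (\<lambda>p. (1 + \<bar>p\<bar> powr \<delta>) * \<bar>kernel_diff \<sigma> p\<bar> powr 1)"
    using \<delta> \<sigma> by (intro integrable_kernel_diff_weighted) auto
  then show "integrable lborel (\<lambda>p. \<bar>p\<bar> powr \<delta> * \<bar>kernel_diff \<sigma> p\<bar>)"
    by (rule Bochner_Integration.integrable_bound) (auto simp: abs_mult intro!: AE_I2 mult_right_mono)
qed

lemma integrable_kernel_diff: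
  assumes \<sigma>: "0 < \<sigma>" "\<sigma> < 1"
  shows "integrable lborel (kernel_diff \<sigma>)"
  using integrable_kernel_diff_powr[OF \<sigma>, of 1] \<sigma>
  by (simp add: integrable_abs_iff)

text \<open>The integral over \<open>p \<le> n\<close> telescopes to the integral of the kernel over \<open>[n, n + 1]\<close>, which tends to
  zero since the kernel does.\<close>

lemma integral_kernel_diff:
  assumes \<sigma>: "0 < \<sigma>" "\<sigma> < 1"
  shows "(\<integral>p. kernel_diff \<sigma> p \<partial>lborel) = 0"
proof -
  let ?k = "frac_kernel \<sigma>" and ?d = "kernel_diff \<sigma>"
  have G: "0 < Gamma \<sigma>" using \<sigma> by (intro Gamma_real_pos)
  have k: "integrable lborel (trunc N ?k)" for N by (intro causal_trunc causal_frac_kernel \<sigma>)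
  have "(\<lambda>n. \<integral>p. trunc (real n) ?d p \<partial>lborel) \<longlonglongrightarrow> (\<integral>p. ?d p \<partial>lborel)"
  proof (rule integral_dominated_convergence[where w="\<lambda>p. \<bar>?d p\<bar>"])
    show "integrable lborel (\<lambda>p. \<bar>?d p\<bar>)" using integrable_kernel_diff[OF \<sigma>] by simp
    show "AE p in lborel. (\<lambda>n. trunc (real n) ?d p) \<longlonglongrightarrow> ?d p"
    proof (rule AE_I2)
      fix p
      have "\<forall>\<^sub>F n in sequentially. trunc (real n) ?d p = ?d p"
        using eventually_ge_at_top[of "nat \<lceil>p\<rceil>"] by eventually_elim (auto simp: trunc_def)
      then show "(\<lambda>n. trunc (real n) ?d p) \<longlonglongrightarrow> ?d p" by (rule tendsto_eventually)
    qed
  qed (auto simp: trunc_def)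
  moreover have "(\<lambda>n. \<integral>p. trunc (real n) ?d p \<partial>lborel) \<longlonglongrightarrow> 0"
  proof (rule tendsto_sandwich[where f="\<lambda>_. 0" and h="\<lambda>n. real n powr (\<sigma> - 1) / Gamma \<sigma>"])
    have eq: "(\<integral>p. trunc (real n) ?d p \<partial>lborel) = (\<integral>p. trunc (real n + 1) ?k p - trunc (real n) ?k p \<partial>lborel)" for n
    proof -
      have s: "integrable lborel (\<lambda>p. trunc (real n + 1) ?k (1 + 1 * p))"
        by (rule lborel_integrable_real_affine[OF k]) simp
      have "trunc (real n) ?d p = trunc (real n + 1) ?k (1 + 1 * p) - trunc (real n) ?k p" for p
        by (auto simp: trunc_def kernel_diff_def add.commute)
      then have "(\<integral>p. trunc (real n) ?d p \<partial>lborel)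
          = (\<integral>p. trunc (real n + 1) ?k (1 + 1 * p) \<partial>lborel) - (\<integral>p. trunc (real n) ?k p \<partial>lborel)"
        using Bochner_Integration.integral_diff[OF s k[of "real n"]] by simp
      also have "(\<integral>p. trunc (real n + 1) ?k (1 + 1 * p) \<partial>lborel) = (\<integral>p. trunc (real n + 1) ?k p \<partial>lborel)"
        using lborel_integral_real_affine[of 1 "trunc (real n + 1) ?k" 1] by simp
      finally show ?thesis using k by simp
    qed
    show "\<forall>\<^sub>F n in sequentially. 0 \<le> (\<integral>p. trunc (real n) ?d p \<partial>lborel)"
      unfolding eq by (intro always_eventually allI Bochner_Integration.integral_nonneg)
        (auto simp: trunc_def frac_kernel_nonneg[OF \<sigma>(1)])
    show "\<forall>\<^sub>F n in sequentially. (\<integral>p. trunc (real n) ?d p \<partial>lborel) \<le> real n powr (\<sigma> - 1) / Gamma \<sigma>"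
      using eventually_gt_at_top[of 0]
    proof eventually_elim
      case (elim n)
      have "(\<integral>p. trunc (real n) ?d p \<partial>lborel)
          \<le> (\<integral>p. indicator {real n..real n + 1} p * (real n powr (\<sigma> - 1) / Gamma \<sigma>) \<partial>lborel)"
        unfolding eq
      proof (rule integral_mono)
        show "integrable lborel (\<lambda>p. trunc (real n + 1) ?k p - trunc (real n) ?k p)"
          by (intro Bochner_Integration.integrable_diff k)
        show "integrable lborel (\<lambda>p. indicator {real n..real n + 1} p * (real n powr (\<sigma> - 1) / Gamma \<sigma>))"
          by (intro integrable_mult_left integrable_real_indicator) auto
        fix p
        have "p powr (\<sigma> - 1) / Gamma \<sigma> \<le> real n powr (\<sigma> - 1) / Gamma \<sigma>" if "real n < p"
          using that elim G \<sigma> by (intro divide_right_mono powr_mono2') auto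
        then show "trunc (real n + 1) ?k p - trunc (real n) ?k p
            \<le> indicator {real n..real n + 1} p * (real n powr (\<sigma> - 1) / Gamma \<sigma>)"
          using elim G by (auto simp: trunc_def frac_kernel_def split: split_indicator)
      qed
      then show ?case by simp
    qed
    have "(\<lambda>n. real n powr (\<sigma> - 1)) \<longlonglongrightarrow> 0"
      using \<sigma> by (intro tendsto_neg_powr filterlim_real_sequentially) simp
    then show "(\<lambda>n. real n powr (\<sigma> - 1) / Gamma \<sigma>) \<longlonglongrightarrow> 0"
      using tendsto_divide[OF _ tendsto_const, of "\<lambda>n. real n powr (\<sigma> - 1)" 0 sequentially "Gamma \<sigma>"] G by simp
  qed simp
  ultimately show ?thesis by (rule LIMSEQ_unique)
qed

text \<open>Here \<open>\<delta> ln z \<le> z\<^sup>\<delta>\<close>, and powers are subadditive up to the factor \<open>2\<^sup>\<delta>\<close>.\<close>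

lemma log_weight_far:
  fixes A B P Q z \<delta> :: real
  assumes z: "1 \<le> z" "z \<le> P + Q" and nn: "0 \<le> P" "0 \<le> Q" "0 \<le> A" "0 \<le> B" and \<delta>: "0 < \<delta>"
  shows "A * B * ln z \<le> 2 powr \<delta> / \<delta> * (P powr \<delta> * A * B + A * (Q powr \<delta> * B))"
proof -
  have "z powr \<delta> \<le> (2 * max P Q) powr \<delta>"
    using \<delta> z by (intro powr_mono2) (auto simp: max_def)
  also have "\<dots> = 2 powr \<delta> * max P Q powr \<delta>" using nn by (simp add: powr_mult)
  also have "\<dots> \<le> 2 powr \<delta> * (P powr \<delta> + Q powr \<delta>)"
    by (intro mult_left_mono) (auto simp: max_def)
  finally have "z powr \<delta> / \<delta> \<le> 2 powr \<delta> * (P powr \<delta> + Q powr \<delta>) / \<delta>"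
    using \<delta> by (simp add: divide_right_mono)
  with ln_powr_bound[OF z(1) \<delta>] have "ln z \<le> 2 powr \<delta> * (P powr \<delta> + Q powr \<delta>) / \<delta>"
    by (rule order.trans)
  then have "A * B * ln z \<le> A * B * (2 powr \<delta> * (P powr \<delta> + Q powr \<delta>) / \<delta>)"
    using nn by (intro mult_left_mono) auto
  also have "\<dots> = 2 powr \<delta> / \<delta> * (P powr \<delta> * A * B + A * (Q powr \<delta> * B))"
    by (simp add: algebra_simps add_divide_distrib)
  finally show ?thesis .
qed

text \<open>Young's inequality for products separates the singularity of the logarithm from the size of the
  kernel. The exponent \<open>\<eta>\<close> is tuned so that the power of the logarithm is dominated by the integrable
  function \<open>z\<^sup>-\<^sup>1\<^sup>/\<^sup>2\<close>.\<close>

lemma log_weight_near: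
  fixes A B z r r' \<eta> :: real
  assumes z: "0 < z" "z < 1" and nn: "0 \<le> A" "0 \<le> B"
    and r: "1 < r" "1 < r'" "1 / r + 1 / r' = 1" and \<eta>: "0 < \<eta>" "\<eta> * r' = 1 / 2"
  shows "A * B * (- ln z) \<le> A powr r * B + \<eta> powr (- r') * (z powr (- 1 / 2) * B)"
proof -
  have "ln (1 / z) \<le> (1 / z) powr \<eta> / \<eta>" using z by (intro ln_powr_bound \<eta>) auto
  moreover have "ln (1 / z) = - ln z" using z by (simp add: ln_div)
  moreover have "(1 / z) powr \<eta> = z powr (- \<eta>)" using z by (simp add: powr_minus_divide powr_divide)
  ultimately have l: "- ln z \<le> z powr (- \<eta>) / \<eta>" by simp
  have l0: "0 \<le> - ln z" using z by simp
  have "(- ln z) powr r' \<le> (z powr (- \<eta>) / \<eta>) powr r'"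
    using l l0 r by (intro powr_mono2) auto
  also have "\<dots> = (z powr (- \<eta>)) powr r' * \<eta> powr (- r')"
    by (simp only: powr_divide) (simp only: powr_minus[of \<eta> r'] divide_inverse)
  also have "(z powr (- \<eta>)) powr r' = z powr (- (\<eta> * r'))"
    by (simp add: powr_powr)
  finally have lr: "(- ln z) powr r' \<le> \<eta> powr (- r') * z powr (- 1 / 2)"
    by (simp add: \<eta>(2) mult.commute)
  have "A * (- ln z) \<le> A powr r / r + (- ln z) powr r' / r'"
    by (rule Youngs_inequality[OF r nn(1) l0])
  also have "\<dots> \<le> A powr r + (- ln z) powr r'"
  proof (rule add_mono)
    show "A powr r / r \<le> A powr r" using r by (simp add: divide_le_eq mult_le_cancel_left1)
    show "(- ln z) powr r' / r' \<le> (- ln z) powr r'" using r by (simp add: divide_le_eq mult_le_cancel_left1)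
  qed
  also have "\<dots> \<le> A powr r + \<eta> powr (- r') * z powr (- 1 / 2)"
    by (rule add_left_mono[OF lr])
  finally have "A * (- ln z) * B \<le> (A powr r + \<eta> powr (- r') * z powr (- 1 / 2)) * B"
    by (rule mult_right_mono[OF _ nn(2)])
  then show ?thesis by (simp add: algebra_simps)
qed

text \<open>Far from the diagonal the logarithm is absorbed by a moment of order \<open>\<delta>\<close>, near the diagonal by the
  slightly better integrability of order \<open>r\<close>.\<close>

lemma integrable_log_energy:
  assumes [measurable]: "d \<in> borel_measurable borel" and d: "integrable lborel d"
    and r: "1 < r" and dr: "integrable lborel (\<lambda>p. \<bar>d p\<bar> powr r)"
    and \<delta>: "0 < \<delta>" and dm: "integrable lborel (\<lambda>p. \<bar>p\<bar> powr \<delta> * \<bar>d p\<bar>)"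
  shows "integrable lborel2 (\<lambda>x. d (fst x) * d (snd x) * ln \<bar>fst x - snd x\<bar>)"
proof (rule Bochner_Integration.integrable_bound)
  define r' where "r' = r / (r - 1)"
  define \<eta> where "\<eta> = 1 / (2 * r')"
  have r': "1 < r'" "1 / r + 1 / r' = 1" using r by (auto simp: r'_def field_simps)
  have \<eta>: "0 < \<eta>" "\<eta> * r' = 1 / 2" using r' by (auto simp: \<eta>_def)
  let ?B = "\<lambda>z. indicator {0<..1} \<bar>z\<bar> * \<bar>z\<bar> powr (- 1 / 2) :: real"
  have ad: "integrable lborel (\<lambda>p. \<bar>d p\<bar>)" using d by simp
  have B: "integrable lborel ?B"
  proof -
    let ?b = "\<lambda>z. indicator {0<..1} z * z powr (- 1 / 2) :: real"
    have b: "integrable lborel ?b" by (rule integral_powr_from_0(1)) auto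
    have "integrable lborel (\<lambda>z. ?b (0 + (- 1) * z))"
      by (rule lborel_integrable_real_affine[OF b]) simp
    then have "integrable lborel (\<lambda>z. ?b z + ?b (0 + (- 1) * z))" using b by simp
    moreover have "?b z + ?b (0 + (- 1) * z) = ?B z" for z
      by (cases "0 < z") (auto split: split_indicator)
    ultimately show ?thesis by simp
  qed
  note pair = integrable_pair_mult[OF lborel_pair.pair_sigma_finite_axioms]
  let ?C = "2 powr \<delta> / \<delta>" and ?D = "\<eta> powr (- r')"
  let ?m = "\<lambda>p. \<bar>p\<bar> powr \<delta> * \<bar>d p\<bar>"
  let ?rhs = "\<lambda>x. ?C * (?m (fst x) * \<bar>d (snd x)\<bar> + \<bar>d (fst x)\<bar> * ?m (snd x))
      + (\<bar>d (fst x)\<bar> powr r * \<bar>d (snd x)\<bar> + ?D * (?B (fst x - snd x) * \<bar>d (snd x)\<bar>))"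
  show "integrable lborel2 ?rhs"
    using integrable_conv_pair[OF B ad]
    by (intro Bochner_Integration.integrable_add integrable_mult_right pair ad dm dr) (simp add: case_prod_unfold)
  show "(\<lambda>x. d (fst x) * d (snd x) * ln \<bar>fst x - snd x\<bar>) \<in> borel_measurable lborel2"
    by measurable
  have bd: "\<bar>d p * d q * ln \<bar>p - q\<bar>\<bar> \<le> ?C * (?m p * \<bar>d q\<bar> + \<bar>d p\<bar> * ?m q)
      + (\<bar>d p\<bar> powr r * \<bar>d q\<bar> + ?D * (?B (p - q) * \<bar>d q\<bar>))" for p q
  proof -
    let ?z = "\<bar>p - q\<bar>"
    have nn1: "0 \<le> ?C * (?m p * \<bar>d q\<bar> + \<bar>d p\<bar> * ?m q)"
      by (intro mult_nonneg_nonneg add_nonneg_nonneg divide_nonneg_nonneg abs_ge_zero powr_ge_zero less_imp_le[OF \<delta>])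
    have nn3: "0 \<le> \<bar>d p\<bar> powr r * \<bar>d q\<bar> + ?D * (?B (p - q) * \<bar>d q\<bar>)"
      by (intro mult_nonneg_nonneg add_nonneg_nonneg abs_ge_zero powr_ge_zero indicator_pos_le)
    have ab: "\<bar>d p * d q * ln ?z\<bar> = \<bar>d p\<bar> * \<bar>d q\<bar> * \<bar>ln ?z\<bar>" by (simp only: abs_mult)
    consider "?z = 0" | "1 \<le> ?z" | "0 < ?z" "?z < 1" by linarith
    then show ?thesis
    proof cases
      case 1
      then have "\<bar>d p * d q * ln ?z\<bar> = 0" by (simp only: ln_0 mult_zero_right abs_zero)
      then show ?thesis using add_nonneg_nonneg[OF nn1 nn3] by (simp only:)
    next
      case 2
      have "\<bar>ln ?z\<bar> = ln ?z" by (rule abs_of_nonneg[OF ln_ge_zero[OF 2]])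
      then have "\<bar>d p * d q * ln ?z\<bar> = \<bar>d p\<bar> * \<bar>d q\<bar> * ln ?z" by (simp only: ab)
      also have "\<dots> \<le> ?C * (?m p * \<bar>d q\<bar> + \<bar>d p\<bar> * ?m q)"
        by (rule log_weight_far[OF 2 abs_triangle_ineq4 abs_ge_zero abs_ge_zero abs_ge_zero abs_ge_zero \<delta>])
      finally show ?thesis by (rule add_increasing2[OF nn3])
    next
      case 3
      have "\<bar>ln ?z\<bar> = - ln ?z" by (rule abs_of_neg) (rule ln_less_zero[OF 3])
      then have "\<bar>d p * d q * ln ?z\<bar> = \<bar>d p\<bar> * \<bar>d q\<bar> * (- ln ?z)" by (simp only: ab)
      also have "\<dots> \<le> \<bar>d p\<bar> powr r * \<bar>d q\<bar> + ?D * (?z powr (- 1 / 2) * \<bar>d q\<bar>)"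
        by (rule log_weight_near[OF 3 abs_ge_zero abs_ge_zero r r' \<eta>])
      also have "?z powr (- 1 / 2) = ?B (p - q)"
      proof -
        have "?z \<in> {0<..1}" using 3 by (simp only: greaterThanAtMost_iff less_imp_le simp_thms)
        then show ?thesis by (simp only: indicator_simps mult_1_left)
      qed
      finally show ?thesis by (rule add_increasing[OF nn1])
    qed
  qed
  show "AE x in lborel2. norm (d (fst x) * d (snd x) * ln \<bar>fst x - snd x\<bar>) \<le> norm (?rhs x)"
    unfolding real_norm_def by (intro AE_I2 order_trans[OF bd abs_ge_self])
qed

lemma integrable_log_energy_kernel_diff:
  assumes \<sigma>: "0 < \<sigma>" "\<sigma> < 1"
  shows "integrable lborel2 (\<lambda>x. kernel_diff \<sigma> (fst x) * kernel_diff \<sigma> (snd x) * ln \<bar>fst x - snd x\<bar>)"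
proof (rule integrable_log_energy)
  \<comment> \<open>The exponent satisfies \<open>r (1 - \<sigma>) = 1 - \<sigma> / (2 - \<sigma>) < 1\<close>, as the singularities require.\<close>
  show "1 < 2 / (2 - \<sigma>)" using \<sigma> by simp
  show "integrable lborel (\<lambda>p. \<bar>kernel_diff \<sigma> p\<bar> powr (2 / (2 - \<sigma>)))"
    using \<sigma> by (intro integrable_kernel_diff_powr) (auto simp: field_simps)
  show "0 < (1 - \<sigma>) / 2" using \<sigma> by simp
  show "integrable lborel (\<lambda>p. \<bar>p\<bar> powr ((1 - \<sigma>) / 2) * \<bar>kernel_diff \<sigma> p\<bar>)"
    using \<sigma> by (intro integrable_kernel_diff_moment) auto
qed (auto intro: integrable_kernel_diff \<sigma>)

section \<open>Increments of fractional integrals\<close>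

lemma frac_kernel_scale:
  assumes "0 < h"
  shows "frac_kernel \<sigma> (h * p) = h powr (\<sigma> - 1) * frac_kernel \<sigma> p"
  using assms by (auto simp: frac_kernel_def powr_mult zero_less_mult_iff)

text \<open>The substitution \<open>s = t - h p\<close>, with the homogeneity of the kernel. The cases \<open>c = 0\<close> and \<open>c = 1\<close>
  give the values of the fractional integral at \<open>t\<close> and at \<open>t + h\<close>.\<close>

lemma
  assumes h: "0 < h"
  shows conv_frac_kernel_dilate:
      "conv (frac_kernel \<sigma>) w (t + h * c) = h powr \<sigma> * (\<integral>p. frac_kernel \<sigma> (p + c) * w (t - h * p) \<partial>lborel)"
    and integrable_frac_kernel_dilate:
      "integrable lborel (\<lambda>s. frac_kernel \<sigma> (t + h * c - s) * w s)
        \<Longrightarrow> integrable lborel (\<lambda>p. frac_kernel \<sigma> (p + c) * w (t - h * p))"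
proof -
  let ?f = "\<lambda>s. frac_kernel \<sigma> (t + h * c - s) * w s"
  have eq: "?f (t + - h * p) = h powr (\<sigma> - 1) * (frac_kernel \<sigma> (p + c) * w (t - h * p))" for p
    using frac_kernel_scale[OF h, of \<sigma> "p + c"] by (simp add: algebra_simps)
  have hh: "h * h powr (\<sigma> - 1) = h powr \<sigma>" using h by (simp add: powr_mult_base)
  have "conv (frac_kernel \<sigma>) w (t + h * c) = \<bar>- h\<bar> *\<^sub>R (\<integral>p. ?f (t + - h * p) \<partial>lborel)"
    unfolding conv_def using h by (intro lborel_integral_real_affine) simp
  also have "\<dots> = h * (h powr (\<sigma> - 1) * (\<integral>p. frac_kernel \<sigma> (p + c) * w (t - h * p) \<partial>lborel))"
    unfolding eq integral_mult_right_zero using h by simp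
  finally show "conv (frac_kernel \<sigma>) w (t + h * c) = h powr \<sigma> * (\<integral>p. frac_kernel \<sigma> (p + c) * w (t - h * p) \<partial>lborel)"
    by (simp only: mult.assoc[symmetric] hh)
  assume "integrable lborel ?f"
  then have "integrable lborel (\<lambda>p. ?f (t + - h * p))"
    using h by (intro lborel_integrable_real_affine) auto
  then show "integrable lborel (\<lambda>p. frac_kernel \<sigma> (p + c) * w (t - h * p))"
    unfolding eq using h by simp
qed

lemma frac_integral_increment:
  assumes h: "0 < h" and i0: "integrable lborel (\<lambda>s. frac_kernel \<sigma> (t - s) * w s)"
    and i1: "integrable lborel (\<lambda>s. frac_kernel \<sigma> (t + h - s) * w s)"
  shows "conv (frac_kernel \<sigma>) w (t + h) - conv (frac_kernel \<sigma>) w t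
    = h powr \<sigma> * (\<integral>p. kernel_diff \<sigma> p * w (t - h * p) \<partial>lborel)"
proof -
  have j0: "integrable lborel (\<lambda>p. frac_kernel \<sigma> (p + 0) * w (t - h * p))"
    using i0 by (intro integrable_frac_kernel_dilate[OF h]) simp
  have j1: "integrable lborel (\<lambda>p. frac_kernel \<sigma> (p + 1) * w (t - h * p))"
    using i1 by (intro integrable_frac_kernel_dilate[OF h]) simp
  have "(\<integral>p. kernel_diff \<sigma> p * w (t - h * p) \<partial>lborel)
      = (\<integral>p. frac_kernel \<sigma> (p + 1) * w (t - h * p) \<partial>lborel) - (\<integral>p. frac_kernel \<sigma> (p + 0) * w (t - h * p) \<partial>lborel)"
    by (subst Bochner_Integration.integral_diff[OF j1 j0, symmetric])
      (simp add: kernel_diff_def left_diff_distrib)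
  then show ?thesis
    using conv_frac_kernel_dilate[OF h, of \<sigma> w t 0] conv_frac_kernel_dilate[OF h, of \<sigma> w t 1]
    by (simp add: right_diff_distrib)
qed

lemma AE_shift:
  fixes f :: "real \<Rightarrow> real \<Rightarrow> real"
  assumes [measurable]: "case_prod f \<in> borel_measurable (borel \<Otimes>\<^sub>M borel)"
    and ae: "AE t in lborel. integrable lborel (f t)"
  shows "AE t in lborel. integrable lborel (f (t + h))"
proof -
  let ?P = "\<lambda>t. (\<integral>\<^sup>+s. ennreal \<bar>f t s\<bar> \<partial>lborel) < \<infinity>"
  have "integrable lborel (f t) \<longleftrightarrow> ?P t" for t
    by (simp add: integrable_iff_bounded)
  moreover have "AE t in lborel. ?P (h + 1 * t)"
    using ae calculation by (intro AE_borel_affine) auto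
  ultimately show ?thesis by (simp add: add.commute)
qed

lemma indicator_Ioo_mult_mono:
  fixes a b R h :: real and x :: ennreal
  assumes "b \<le> a"
  shows "indicator {a<..<R} h * x \<le> indicator {b<..<R} h * x"
  using assms by (cases "a < h"; cases "h < R") simp_all

text \<open>Monotone convergence along \<open>\<epsilon> = 1 / (n + 1)\<close>.\<close>

lemma nn_integral_Ioo_le_limit:
  fixes \<Phi> :: "real \<Rightarrow> ennreal"
  assumes m [measurable]: "\<Phi> \<in> borel_measurable borel"
    and bound: "\<And>\<epsilon>. 0 < \<epsilon> \<Longrightarrow> (\<integral>\<^sup>+h. indicator {\<epsilon><..<R} h * \<Phi> h \<partial>lborel) \<le> B"
  shows "(\<integral>\<^sup>+h. indicator {0<..<R} h * \<Phi> h \<partial>lborel) \<le> B"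
proof -
  have e1: "(\<integral>\<^sup>+h. indicator {0<..<R} h * \<Phi> h \<partial>lborel)
      = (\<integral>\<^sup>+h. (SUP n::nat. indicator {1 / real (Suc n)<..<R} h * \<Phi> h) \<partial>lborel)"
  proof (rule nn_integral_cong)
    fix h
    show "indicator {0<..<R} h * \<Phi> h = (SUP n::nat. indicator {1 / real (Suc n)<..<R} h * \<Phi> h)"
    proof (rule antisym)
      show "indicator {0<..<R} h * \<Phi> h \<le> (SUP n::nat. indicator {1 / real (Suc n)<..<R} h * \<Phi> h)"
      proof (cases "h \<in> {0<..<R}")
        case True
        then obtain n where "1 / real (Suc n) < h" using nat_approx_posE[of h] by auto
        then have "indicator {0<..<R} h * \<Phi> h = indicator {1 / real (Suc n)<..<R} h * \<Phi> h"
          using True by (simp only: indicator_simps greaterThanLessThan_iff simp_thms)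
        then show ?thesis by (intro SUP_upper2[OF UNIV_I] eq_refl)
      qed simp
      show "(SUP n::nat. indicator {1 / real (Suc n)<..<R} h * \<Phi> h) \<le> indicator {0<..<R} h * \<Phi> h"
      proof (rule SUP_least)
        fix n :: nat
        show "indicator {1 / real (Suc n)<..<R} h * \<Phi> h \<le> indicator {0<..<R} h * \<Phi> h"
          by (rule indicator_Ioo_mult_mono) (rule divide_nonneg_nonneg, simp_all only: zero_le_one of_nat_0_le_iff)
      qed
    qed
  qed
  have e2: "(\<integral>\<^sup>+h. (SUP n::nat. indicator {1 / real (Suc n)<..<R} h * \<Phi> h) \<partial>lborel)
      = (SUP n::nat. \<integral>\<^sup>+h. indicator {1 / real (Suc n)<..<R} h * \<Phi> h \<partial>lborel)"
  proof (rule nn_integral_monotone_convergence_SUP)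
    show "incseq (\<lambda>(n::nat) h. indicator {1 / real (Suc n)<..<R} h * \<Phi> h)"
    proof (intro incseq_SucI le_funI)
      fix n :: nat and h :: real
      have "1 / real (Suc (Suc n)) \<le> 1 / real (Suc n)" by (simp add: field_simps)
      then show "indicator {1 / real (Suc n)<..<R} h * \<Phi> h \<le> indicator {1 / real (Suc (Suc n))<..<R} h * \<Phi> h"
        by (rule indicator_Ioo_mult_mono)
    qed
  qed measurable
  show ?thesis
    unfolding e1 e2 by (intro SUP_least bound) simp
qed

text \<open>The weight \<open>h\<^sup>-\<^sup>1\<^sup>-\<^sup>2\<^sup>\<sigma>\<close> cancels the factor \<open>h\<^sup>2\<^sup>\<sigma>\<close> from the squared increment up to \<open>1 / h\<close>, so that
  this is the square function of the kernel difference.\<close>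

lemma frac_integral_square_function:
  assumes \<sigma>: "0 < \<sigma>" "\<sigma> < 1" and w: "L2_supp T w" and R: "0 < R"
  defines "v \<equiv> conv (frac_kernel \<sigma>) w"
  shows "(\<integral>\<^sup>+h. indicator {0<..<R} h * (\<integral>\<^sup>+t. ennreal ((v (t + h) - v t)\<^sup>2 / h powr (1 + 2 * \<sigma>)) \<partial>lborel) \<partial>lborel) < \<infinity>"
proof -
  have [measurable]: "w \<in> borel_measurable borel" and w2: "integrable lborel (\<lambda>t. (w t)\<^sup>2)"
    using w by (auto simp: L2_supp_def)
  have vm [measurable]: "v \<in> borel_measurable borel" unfolding v_def by measurable
  note c = L2_supp_causal[OF w] causal_frac_kernel[OF \<sigma>(1)]
  let ?d = "kernel_diff \<sigma>"
  define \<Phi> where "\<Phi> h = (\<integral>\<^sup>+t. ennreal ((v (t + h) - v t)\<^sup>2 / h powr (1 + 2 * \<sigma>)) \<partial>lborel)" for h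
  have \<Phi>m: "\<Phi> \<in> borel_measurable borel"
    unfolding \<Phi>_def[abs_def] by measurable
  define B where "B = 2 * (\<integral>t. (w t)\<^sup>2 \<partial>lborel) * (\<integral>x. \<bar>?d (fst x) * ?d (snd x) * ln \<bar>fst x - snd x\<bar>\<bar> \<partial>lborel2)"
  have \<Phi>: "\<Phi> h = (\<integral>\<^sup>+t. ennreal ((\<integral>p. ?d p * w (t - h * p) \<partial>lborel)\<^sup>2 / h) \<partial>lborel)" if h: "0 < h" for h
    unfolding \<Phi>_def
  proof (rule nn_integral_cong_AE)
    have m: "(\<lambda>(t, s). frac_kernel \<sigma> (t - s) * w s) \<in> borel_measurable (borel \<Otimes>\<^sub>M borel)" by measurable
    show "AE t in lborel. ennreal ((v (t + h) - v t)\<^sup>2 / h powr (1 + 2 * \<sigma>))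
        = ennreal ((\<integral>p. ?d p * w (t - h * p) \<partial>lborel)\<^sup>2 / h)"
      using causal_AE_integrable[OF c(2,1)] AE_shift[OF m causal_AE_integrable[OF c(2,1)], of h]
    proof eventually_elim
      case (elim t)
      have "h powr (1 + 2 * \<sigma>) = h * (h powr \<sigma>)\<^sup>2"
      proof -
        have "1 + 2 * \<sigma> = 1 + (\<sigma> + \<sigma>)" by simp
        then show ?thesis using h by (simp only: powr_add power2_eq_square powr_one less_imp_le)
      qed
      then have "(h powr \<sigma> * x)\<^sup>2 / h powr (1 + 2 * \<sigma>) = x\<^sup>2 / h" for x
        using h by (simp add: power_mult_distrib)
      then show ?case
        using frac_integral_increment[OF h, of \<sigma> t w] elim by (simp add: v_def)
    qed
  qed
  have bound: "(\<integral>\<^sup>+h. indicator {\<epsilon><..<R} h * \<Phi> h \<partial>lborel) \<le> ennreal B" if e: "0 < \<epsilon>" for \<epsilon>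
  proof -
    have "(\<integral>\<^sup>+h. indicator {\<epsilon><..<R} h * \<Phi> h \<partial>lborel)
        = (\<integral>\<^sup>+h. indicator {\<epsilon><..<R} h * (\<integral>\<^sup>+t. ennreal ((\<integral>p. ?d p * w (t - h * p) \<partial>lborel)\<^sup>2 / h) \<partial>lborel) \<partial>lborel)"
      using \<Phi> e by (intro nn_integral_cong) (auto split: split_indicator)
    also have "\<dots> \<le> ennreal B"
      unfolding B_def
      by (intro square_function_bound integrable_kernel_diff integral_kernel_diff
          integrable_log_energy_kernel_diff \<sigma> w2 e R) measurable
    finally show ?thesis .
  qed
  from nn_integral_Ioo_le_limit[OF \<Phi>m bound]
  have "(\<integral>\<^sup>+h. indicator {0<..<R} h * \<Phi> h \<partial>lborel) \<le> ennreal B" .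
  also have "\<dots> < \<infinity>" by simp
  finally show ?thesis by (simp only: \<Phi>_def)
qed

text \<open>The square is cut along the diagonal into two halves, exchanged by the symmetry; in the half \<open>t < s\<close>
  the substitution \<open>s = t + h\<close> is made and the domain enlarged.\<close>

lemma nn_integral_square_le_increments:
  fixes F :: "real \<Rightarrow> real \<Rightarrow> ennreal"
  assumes m [measurable]: "case_prod F \<in> borel_measurable (borel \<Otimes>\<^sub>M borel)"
    and sym: "\<And>t s. F t s = F s t" and diag: "\<And>t. F t t = 0"
  shows "(\<integral>\<^sup>+t. (\<integral>\<^sup>+s. F t s \<partial>leb_interval T) \<partial>leb_interval T)
    \<le> 2 * (\<integral>\<^sup>+h. indicator {0<..<T} h * (\<integral>\<^sup>+t. F t (t + h) \<partial>lborel) \<partial>lborel)"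
proof -
  define U where "U t s = (if t < s then F t s else 0) * indicator {0<..<T} s * indicator {0<..<T} t" for t s
  have Um [measurable]: "case_prod U \<in> borel_measurable (borel \<Otimes>\<^sub>M borel)"
    unfolding U_def[abs_def] by measurable
  have split: "F t s * indicator {0<..<T} s * indicator {0<..<T} t = U t s + U s t" for t s
  proof (cases t s rule: linorder_cases)
    case less
    then have "(t < s) = True" "(s < t) = False" by simp_all
    then show ?thesis by (simp only: U_def if_True if_False mult_zero_left add_0_right)
  next
    case equal
    then show ?thesis by (simp add: U_def diag)
  next
    case greater
    then have "(t < s) = False" "(s < t) = True" by simp_all
    then show ?thesis
      by (simp only: U_def if_True if_False mult_zero_left add_0_left sym[of t s] mult.assoc
          mult.commute[of "indicator {0<..<T} s"])
  qed
  have inner: "(\<integral>\<^sup>+s. F t s * indicator {0<..<T} s \<partial>lborel) * indicator {0<..<T} t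
      = (\<integral>\<^sup>+s. U t s \<partial>lborel) + (\<integral>\<^sup>+s. U s t \<partial>lborel)" for t
  proof -
    have "(\<integral>\<^sup>+s. F t s * indicator {0<..<T} s \<partial>lborel) * indicator {0<..<T} t
        = (\<integral>\<^sup>+s. F t s * indicator {0<..<T} s * indicator {0<..<T} t \<partial>lborel)"
      by (rule nn_integral_multc[symmetric]) measurable
    also have "\<dots> = (\<integral>\<^sup>+s. U t s + U s t \<partial>lborel)" by (simp only: split)
    also have "\<dots> = (\<integral>\<^sup>+s. U t s \<partial>lborel) + (\<integral>\<^sup>+s. U s t \<partial>lborel)"
      by (rule nn_integral_add) measurable
    finally show ?thesis .
  qed
  have swap: "(\<integral>\<^sup>+t. \<integral>\<^sup>+s. U s t \<partial>lborel \<partial>lborel) = (\<integral>\<^sup>+t. \<integral>\<^sup>+s. U t s \<partial>lborel \<partial>lborel)"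
    by (rule lborel_pair.Fubini') measurable
  have "(\<integral>\<^sup>+t. (\<integral>\<^sup>+s. F t s \<partial>leb_interval T) \<partial>leb_interval T)
      = (\<integral>\<^sup>+t. (\<integral>\<^sup>+s. U t s \<partial>lborel) + (\<integral>\<^sup>+s. U s t \<partial>lborel) \<partial>lborel)"
    by (simp only: nn_integral_leb_interval inner)
  also have "\<dots> = (\<integral>\<^sup>+t. \<integral>\<^sup>+s. U t s \<partial>lborel \<partial>lborel) + (\<integral>\<^sup>+t. \<integral>\<^sup>+s. U s t \<partial>lborel \<partial>lborel)"
    by (rule nn_integral_add) measurable
  also have "\<dots> = 2 * (\<integral>\<^sup>+t. \<integral>\<^sup>+s. U t s \<partial>lborel \<partial>lborel)"
    by (simp only: swap mult_2)
  also have "(\<integral>\<^sup>+t. \<integral>\<^sup>+s. U t s \<partial>lborel \<partial>lborel)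
      \<le> (\<integral>\<^sup>+t. \<integral>\<^sup>+h. indicator {0<..<T} h * F t (t + h) \<partial>lborel \<partial>lborel)"
  proof (rule nn_integral_mono)
    fix t
    have "(\<integral>\<^sup>+s. U t s \<partial>lborel) = (\<integral>\<^sup>+h. U t (t + 1 * h) \<partial>lborel)"
      by (subst nn_integral_real_affine[where c=1 and t=t]) simp_all
    also have "\<dots> \<le> (\<integral>\<^sup>+h. indicator {0<..<T} h * F t (t + h) \<partial>lborel)"
    proof (rule nn_integral_mono)
      fix h
      show "U t (t + 1 * h) \<le> indicator {0<..<T} h * F t (t + h)"
      proof (cases "0 < h \<and> t + h < T \<and> 0 < t")
        case True
        then show ?thesis by (simp add: U_def)
      next
        case False
        then have "\<not> t < t + h \<or> t + h \<notin> {0<..<T} \<or> t \<notin> {0<..<T}" by auto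
        then have "U t (t + 1 * h) = 0" by (auto simp: U_def)
        then show ?thesis by (simp only: zero_le)
      qed
    qed
    finally show "(\<integral>\<^sup>+s. U t s \<partial>lborel) \<le> (\<integral>\<^sup>+h. indicator {0<..<T} h * F t (t + h) \<partial>lborel)" .
  qed
  also have "(\<integral>\<^sup>+t. \<integral>\<^sup>+h. indicator {0<..<T} h * F t (t + h) \<partial>lborel \<partial>lborel)
      = (\<integral>\<^sup>+h. \<integral>\<^sup>+t. indicator {0<..<T} h * F t (t + h) \<partial>lborel \<partial>lborel)"
    by (rule lborel_pair.Fubini') measurable
  also have "\<dots> = (\<integral>\<^sup>+h. indicator {0<..<T} h * (\<integral>\<^sup>+t. F t (t + h) \<partial>lborel) \<partial>lborel)"
    by (intro nn_integral_cong nn_integral_cmult) measurable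
  finally show ?thesis by (simp add: mult_left_mono)
qed

lemma frac_integral_slobodeckij_finite:
  assumes \<sigma>: "0 < \<sigma>" "\<sigma> < 1" and w: "L2_supp T w" and T: "0 < T"
  defines "v \<equiv> conv (frac_kernel \<sigma>) w"
  shows "(\<integral>\<^sup>+t. (\<integral>\<^sup>+s. ennreal ((v t - v s)\<^sup>2 / \<bar>t - s\<bar> powr (1 + 2 * \<sigma>)) \<partial>leb_interval T) \<partial>leb_interval T) < \<infinity>"
proof -
  have [measurable]: "w \<in> borel_measurable borel" using w by (auto simp: L2_supp_def)
  have vm [measurable]: "v \<in> borel_measurable borel" unfolding v_def by measurable
  define F where "F t s = ennreal ((v t - v s)\<^sup>2 / \<bar>t - s\<bar> powr (1 + 2 * \<sigma>))" for t s
  have Fm: "case_prod F \<in> borel_measurable (borel \<Otimes>\<^sub>M borel)"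
    unfolding F_def[abs_def] by measurable
  have sym: "F t s = F s t" for t s
    by (simp only: F_def power2_commute[of "v t"] abs_minus_commute[of t])
  have "F t (t + h) = ennreal ((v (t + h) - v t)\<^sup>2 / h powr (1 + 2 * \<sigma>))" if "0 < h" for t h
    using that by (simp add: F_def power2_commute[of "v t"])
  then have "(\<integral>\<^sup>+h. indicator {0<..<T} h * (\<integral>\<^sup>+t. F t (t + h) \<partial>lborel) \<partial>lborel)
      = (\<integral>\<^sup>+h. indicator {0<..<T} h * (\<integral>\<^sup>+t. ennreal ((v (t + h) - v t)\<^sup>2 / h powr (1 + 2 * \<sigma>)) \<partial>lborel) \<partial>lborel)"
    by (intro nn_integral_cong) (simp split: split_indicator)
  also have "\<dots> < \<infinity>"
    using frac_integral_square_function[OF \<sigma> w T] by (simp only: v_def)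
  finally have "2 * (\<integral>\<^sup>+h. indicator {0<..<T} h * (\<integral>\<^sup>+t. F t (t + h) \<partial>lborel) \<partial>lborel) < \<infinity>"
    by (simp add: ennreal_mult_less_top)
  then have "(\<integral>\<^sup>+t. (\<integral>\<^sup>+s. F t s \<partial>leb_interval T) \<partial>leb_interval T) < \<infinity>"
    by (rule le_less_trans[OF nn_integral_square_le_increments[OF Fm sym], rotated]) (simp add: F_def)
  then show ?thesis by (simp only: F_def)
qed

text \<open>For \<open>t \<le> 0 < t + h\<close> the increment of \<open>v\<close> is \<open>v(t + h)\<close> itself, because \<open>v\<close> vanishes on the negative
  axis. That part of the square function on the whole line is \<open>\<integral>v(x)\<^sup>2 \<integral>\<^bsub>h \<ge> x\<^esub> h\<^sup>-\<^sup>1\<^sup>-\<^sup>2\<^sup>\<sigma> dh dx\<close>, and the steps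
  \<open>x \<le> h \<le> 2 x\<close> alone contribute a multiple of \<open>v(x)\<^sup>2 / x\<^sup>2\<^sup>\<sigma>\<close>. This explains the step bound \<open>2 T\<close>.\<close>

lemma frac_integral_Hardy_finite:
  assumes \<sigma>: "0 < \<sigma>" "\<sigma> < 1" and w: "L2_supp T w" and T: "0 < T"
  defines "v \<equiv> conv (frac_kernel \<sigma>) w"
  shows "(\<integral>\<^sup>+t. ennreal ((v t)\<^sup>2 / t powr (2 * \<sigma>)) \<partial>leb_interval T) < \<infinity>"
proof -
  have [measurable]: "w \<in> borel_measurable borel" using w by (auto simp: L2_supp_def)
  have vm [measurable]: "v \<in> borel_measurable borel" unfolding v_def by measurable
  have v0: "v t = 0" if "t \<le> 0" for t
    unfolding v_def by (rule conv_zero[OF causal_frac_kernel[OF \<sigma>(1)] L2_supp_causal[OF w] that])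
  define c where "c = 2 powr (1 + 2 * \<sigma>)"
  have c: "0 < c" by (simp add: c_def)
  define g where "g h x = (v x)\<^sup>2 / h powr (1 + 2 * \<sigma>)" for h x
  have gm [measurable]: "case_prod g \<in> borel_measurable (borel \<Otimes>\<^sub>M borel)"
    unfolding g_def[abs_def] by measurable
  have g0: "0 \<le> g h x" for h x by (simp add: g_def)
  define \<Psi> where "\<Psi> h x = indicator {0<..<2 * T} h * ((if 0 < x \<and> x \<le> h then 1 else 0) * ennreal (g h x))" for h x
  have \<Psi>m [measurable]: "case_prod \<Psi> \<in> borel_measurable (borel \<Otimes>\<^sub>M borel)"
    unfolding \<Psi>_def[abs_def] by measurable
  have dyadic: "(v x)\<^sup>2 / x powr (2 * \<sigma>) = c * (g (2 * x) x * x)" if x: "0 < x" for x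
  proof -
    have "(2 * x) powr (1 + 2 * \<sigma>) = c * (x * x powr (2 * \<sigma>))"
      using x by (simp only: c_def powr_mult powr_add[of x 1] powr_one less_imp_le)
    then show ?thesis using x c by (simp add: g_def)
  qed
  have "(\<integral>\<^sup>+t. ennreal ((v t)\<^sup>2 / t powr (2 * \<sigma>)) \<partial>leb_interval T)
      \<le> (\<integral>\<^sup>+x. ennreal c * (\<integral>\<^sup>+h. \<Psi> h x \<partial>lborel) \<partial>lborel)"
    unfolding nn_integral_leb_interval
  proof (rule nn_integral_mono)
    fix x
    show "ennreal ((v x)\<^sup>2 / x powr (2 * \<sigma>)) * indicator {0<..<T} x \<le> ennreal c * (\<integral>\<^sup>+h. \<Psi> h x \<partial>lborel)"
    proof (cases "0 < x \<and> x < T")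
      case x: True
      have "ennreal ((v x)\<^sup>2 / x powr (2 * \<sigma>)) = ennreal c * (ennreal (g (2 * x) x) * ennreal x)"
        using x c g0[of "2 * x" x] by (simp only: dyadic ennreal_mult' less_imp_le)
      also have "ennreal (g (2 * x) x) * ennreal x = (\<integral>\<^sup>+h. ennreal (g (2 * x) x) * indicator {x..2 * x} h \<partial>lborel)"
        using x by (simp add: nn_integral_cmult_indicator)
      also have "ennreal c * \<dots> \<le> ennreal c * (\<integral>\<^sup>+h. \<Psi> h x \<partial>lborel)"
      proof (intro mult_left_mono nn_integral_mono)
        fix h
        show "ennreal (g (2 * x) x) * indicator {x..2 * x} h \<le> \<Psi> h x"
        proof (cases "h \<in> {x..2 * x}")
          case True
          have "g (2 * x) x \<le> g h x"
            unfolding g_def using True x \<sigma> by (intro divide_left_mono powr_mono2 mult_pos_pos) auto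
          then show ?thesis using True x by (simp add: \<Psi>_def ennreal_leI)
        qed simp
      qed simp
      finally show ?thesis using x by simp
    next
      case False
      then have "x \<notin> {0<..<T}" by auto
      then show ?thesis by (simp only: indicator_simps mult_zero_right zero_le not_False_eq_True)
    qed
  qed
  also have "\<dots> = ennreal c * (\<integral>\<^sup>+x. \<integral>\<^sup>+h. \<Psi> h x \<partial>lborel \<partial>lborel)"
    by (rule nn_integral_cmult) measurable
  also have "(\<integral>\<^sup>+x. \<integral>\<^sup>+h. \<Psi> h x \<partial>lborel \<partial>lborel) = (\<integral>\<^sup>+h. \<integral>\<^sup>+x. \<Psi> h x \<partial>lborel \<partial>lborel)"
    by (rule lborel_pair.Fubini') measurable
  also have "ennreal c * \<dots> < \<infinity>"
  proof -
    have "(\<integral>\<^sup>+h. \<integral>\<^sup>+x. \<Psi> h x \<partial>lborel \<partial>lborel)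
        \<le> (\<integral>\<^sup>+h. indicator {0<..<2 * T} h * (\<integral>\<^sup>+t. ennreal ((v (t + h) - v t)\<^sup>2 / h powr (1 + 2 * \<sigma>)) \<partial>lborel) \<partial>lborel)"
    proof (rule nn_integral_mono)
      fix h
      have eq: "(\<integral>\<^sup>+x. \<Psi> h x \<partial>lborel)
          = indicator {0<..<2 * T} h * (\<integral>\<^sup>+x. (if 0 < x \<and> x \<le> h then 1 else 0) * ennreal (g h x) \<partial>lborel)"
        unfolding \<Psi>_def by (rule nn_integral_cmult) measurable
      have "(\<integral>\<^sup>+x. (if 0 < x \<and> x \<le> h then 1 else 0) * ennreal (g h x) \<partial>lborel)
          = (\<integral>\<^sup>+t. (if 0 < h + 1 * t \<and> h + 1 * t \<le> h then 1 else 0) * ennreal (g h (h + 1 * t)) \<partial>lborel)"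
        by (subst nn_integral_real_affine[where c=1 and t=h]) simp_all
      also have "\<dots> \<le> (\<integral>\<^sup>+t. ennreal ((v (t + h) - v t)\<^sup>2 / h powr (1 + 2 * \<sigma>)) \<partial>lborel)"
      proof (rule nn_integral_mono)
        fix t
        show "(if 0 < h + 1 * t \<and> h + 1 * t \<le> h then 1 else 0) * ennreal (g h (h + 1 * t))
            \<le> ennreal ((v (t + h) - v t)\<^sup>2 / h powr (1 + 2 * \<sigma>))"
        proof (cases "0 < h + 1 * t \<and> h + 1 * t \<le> h")
          case True
          then have "v t = 0" by (intro v0) simp
          then have "g h (h + 1 * t) = (v (t + h) - v t)\<^sup>2 / h powr (1 + 2 * \<sigma>)"
            by (simp only: g_def diff_0_right mult_1_left add.commute[of h])
          with True show ?thesis by (simp only: if_True mult_1_left order_refl simp_thms)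
        next
          case False
          then show ?thesis by (simp only: if_False mult_zero_left zero_le)
        qed
      qed
      finally show "(\<integral>\<^sup>+x. \<Psi> h x \<partial>lborel)
          \<le> indicator {0<..<2 * T} h * (\<integral>\<^sup>+t. ennreal ((v (t + h) - v t)\<^sup>2 / h powr (1 + 2 * \<sigma>)) \<partial>lborel)"
        unfolding eq by (rule mult_left_mono) (rule zero_le)
    qed
    also have "\<dots> < \<infinity>"
      using frac_integral_square_function[OF \<sigma> w, of "2 * T"] T by (simp add: v_def)
    finally show ?thesis by (simp add: ennreal_mult_less_top)
  qed
  finally show ?thesis .
qed

text \<open>For \<open>\<sigma> > 1/2\<close> the kernel difference is square-integrable, and Cauchy-Schwarz costs only the factor
  \<open>h\<^sup>-\<^sup>1\<^sup>/\<^sup>2\<close> from the dilation of \<open>w\<close>.\<close>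

lemma frac_integral_Hoelder:
  assumes \<sigma>: "1/2 < \<sigma>" "\<sigma> < 1" and w: "L2_supp T w" and h: "0 < h"
  shows "\<bar>conv (frac_kernel \<sigma>) w (t + h) - conv (frac_kernel \<sigma>) w t\<bar>
    \<le> sqrt ((\<integral>p. (kernel_diff \<sigma> p)\<^sup>2 \<partial>lborel) * (\<integral>s. (w s)\<^sup>2 \<partial>lborel)) * h powr (\<sigma> - 1/2)"
proof -
  have [measurable]: "w \<in> borel_measurable borel" and w2: "integrable lborel (\<lambda>t. (w t)\<^sup>2)"
    using w by (auto simp: L2_supp_def)
  let ?d = "kernel_diff \<sigma>" and ?k = "frac_kernel \<sigma>"
  have int: "integrable lborel (\<lambda>s. ?k (t - s) * w s)" for t
  proof -
    let ?f = "\<lambda>p. indicator {0<..max 0 t} p * p powr (2 * \<sigma> - 2)"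
    have "integrable lborel (\<lambda>p. ?f p / (Gamma \<sigma>)\<^sup>2)"
      using \<sigma> by (intro Bochner_Integration.integrable_divide integral_powr_from_0(1)) auto
    also have "(\<lambda>p. ?f p / (Gamma \<sigma>)\<^sup>2) = (\<lambda>p. (trunc t ?k p)\<^sup>2)"
      by (auto simp: trunc_def frac_kernel_def fun_eq_iff power_divide power2_eq_square
          powr_add[symmetric] split: split_indicator)
    finally have k2: "integrable lborel (\<lambda>p. (trunc t ?k p)\<^sup>2)" .
    have "integrable lborel (\<lambda>s. (trunc t ?k (t + (- 1) * s))\<^sup>2)"
      by (rule lborel_integrable_real_affine[OF k2]) simp
    then have "integrable lborel (\<lambda>s. trunc t ?k (t + (- 1) * s) * w s)"
      by (intro Cauchy_Schwarz_integral(1) w2) measurable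
    moreover have "(\<lambda>s. trunc t ?k (t + (- 1) * s) * w s) = (\<lambda>s. ?k (t - s) * w s)"
    proof
      fix s
      show "trunc t ?k (t + (- 1) * s) * w s = ?k (t - s) * w s"
        using w by (cases "0 < s") (auto simp: trunc_def L2_supp_def)
    qed
    ultimately show ?thesis by (simp only:)
  qed
  have d2: "integrable lborel (\<lambda>p. (?d p)\<^sup>2)"
  proof -
    have "integrable lborel (\<lambda>p. \<bar>?d p\<bar> powr 2)"
      using \<sigma> by (intro integrable_kernel_diff_powr) auto
    then show ?thesis by simp
  qed
  have wh: "integrable lborel (\<lambda>p. (w (t + - h * p))\<^sup>2)"
    using h by (intro lborel_integrable_real_affine[OF w2]) simp
  have whv: "(\<integral>p. (w (t + - h * p))\<^sup>2 \<partial>lborel) = (\<integral>s. (w s)\<^sup>2 \<partial>lborel) / h"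
    using h by (subst (2) lborel_integral_real_affine[of "- h" _ t]) (auto simp: field_simps)
  have "(\<integral>p. ?d p * w (t + - h * p) \<partial>lborel)\<^sup>2 \<le> (\<integral>p. (?d p)\<^sup>2 \<partial>lborel) * ((\<integral>s. (w s)\<^sup>2 \<partial>lborel) / h)"
    unfolding whv[symmetric] by (intro Cauchy_Schwarz_integral(2) d2 wh) measurable
  then have "\<bar>\<integral>p. ?d p * w (t + - h * p) \<partial>lborel\<bar> \<le> sqrt ((\<integral>p. (?d p)\<^sup>2 \<partial>lborel) * (\<integral>s. (w s)\<^sup>2 \<partial>lborel) / h)"
    by (intro real_le_rsqrt) simp
  then have "h powr \<sigma> * \<bar>\<integral>p. ?d p * w (t + - h * p) \<partial>lborel\<bar>
      \<le> h powr \<sigma> * (sqrt ((\<integral>p. (?d p)\<^sup>2 \<partial>lborel) * (\<integral>s. (w s)\<^sup>2 \<partial>lborel)) / sqrt h)"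
    by (intro mult_left_mono) (simp_all add: real_sqrt_divide)
  also have "\<dots> = sqrt ((\<integral>p. (?d p)\<^sup>2 \<partial>lborel) * (\<integral>s. (w s)\<^sup>2 \<partial>lborel)) * h powr (\<sigma> - 1/2)"
    using h by (simp add: powr_diff powr_half_sqrt)
  finally show ?thesis
    using frac_integral_increment[OF h int int, of t] by (simp add: abs_mult)
qed

lemma continuous_on_frac_integral:
  assumes \<sigma>: "1/2 < \<sigma>" "\<sigma> < 1" and w: "L2_supp T w"
  shows "continuous_on S (conv (frac_kernel \<sigma>) w)"
proof -
  let ?v = "conv (frac_kernel \<sigma>) w"
  define C where "C = sqrt ((\<integral>p. (kernel_diff \<sigma> p)\<^sup>2 \<partial>lborel) * (\<integral>s. (w s)\<^sup>2 \<partial>lborel))"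
  have C: "\<bar>?v (t + h) - ?v t\<bar> \<le> C * h powr (\<sigma> - 1/2)" if "0 < h" for t h
    unfolding C_def by (rule frac_integral_Hoelder[OF \<sigma> w that])
  have bd: "norm (?v y - ?v x) \<le> C * \<bar>y - x\<bar> powr (\<sigma> - 1/2)" for x y :: real
  proof (cases x y rule: linorder_cases)
    case less
    then show ?thesis using C[of "y - x" x] by simp
  next
    case greater
    then show ?thesis using C[of "x - y" y] by (simp add: abs_minus_commute)
  qed simp
  have "isCont ?v x" for x
    unfolding isCont_def
  proof (rule LIM_zero_cancel, rule Lim_null_comparison)
    show "\<forall>\<^sub>F y in at x. norm (?v y - ?v x) \<le> C * \<bar>y - x\<bar> powr (\<sigma> - 1/2)"
      using bd by (intro always_eventually) simp
    have "((\<lambda>y. \<bar>y - x\<bar>) \<longlongrightarrow> \<bar>x - x\<bar>) (at x)" by (intro tendsto_intros)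
    then have "((\<lambda>y. \<bar>y - x\<bar> powr (\<sigma> - 1/2)) \<longlongrightarrow> 0) (at x)"
      using \<sigma> by (intro tendsto_zero_powrI[OF _ tendsto_const]) auto
    from tendsto_mult_right_zero[OF this, of C]
    show "((\<lambda>y. C * \<bar>y - x\<bar> powr (\<sigma> - 1/2)) \<longlongrightarrow> 0) (at x)" .
  qed
  then show ?thesis by (intro continuous_at_imp_continuous_on) simp
qed

text \<open>The convolution is the primitive of \<open>z\<close>; continuity follows by dominated convergence.\<close>

lemma continuous_on_conv_frac_kernel_1:
  assumes z: "causal z"
  shows "continuous_on {0..T} (conv (frac_kernel 1) z)"
proof (rule continuous_on_sequentiallyI)
  fix u a assume u: "\<forall>n. u n \<in> {0..T}" and a: "a \<in> {0..T}" and lim: "u \<longlonglongrightarrow> a"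
  have [measurable]: "z \<in> borel_measurable borel" using z by (simp add: causal_def)
  let ?Z = "trunc T z"
  have eq: "conv (frac_kernel 1) z t = (\<integral>s. indicator {..<t} s * ?Z s \<partial>lborel)" if "t \<in> {0..T}" for t
    unfolding conv_def using that
    by (intro Bochner_Integration.integral_cong) (auto simp: frac_kernel_def trunc_def split: split_indicator)
  have "(\<lambda>n. \<integral>s. indicator {..<u n} s * ?Z s \<partial>lborel) \<longlonglongrightarrow> (\<integral>s. indicator {..<a} s * ?Z s \<partial>lborel)"
  proof (rule integral_dominated_convergence[where w="\<lambda>s. \<bar>?Z s\<bar>"])
    show "integrable lborel (\<lambda>s. \<bar>?Z s\<bar>)" using causal_trunc[OF z] by simp
    show "AE s in lborel. (\<lambda>n. indicator {..<u n} s * ?Z s) \<longlonglongrightarrow> indicator {..<a} s * ?Z s"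
      using AE_lborel_singleton[of a]
    proof eventually_elim
      case (elim s)
      have "\<forall>\<^sub>F n in sequentially. indicator {..<u n} s = (indicator {..<a} s :: real)"
      proof (cases "s < a")
        case True
        show ?thesis using order_tendstoD(1)[OF lim True] by eventually_elim (use True in simp)
      next
        case False
        then have as: "a < s" using elim by simp
        show ?thesis using order_tendstoD(2)[OF lim as] by eventually_elim (use False in simp)
      qed
      then have "\<forall>\<^sub>F n in sequentially. indicator {..<u n} s * ?Z s = indicator {..<a} s * ?Z s"
        by eventually_elim simp
      then show ?case by (rule tendsto_eventually)
    qed
    show "(\<lambda>s. indicator {..<a} s * ?Z s) \<in> borel_measurable lborel" by measurable
    show "(\<lambda>s. indicator {..<u n} s * ?Z s) \<in> borel_measurable lborel" for n by measurable
  qed (auto split: split_indicator)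
  then show "(\<lambda>n. conv (frac_kernel 1) z (u n)) \<longlonglongrightarrow> conv (frac_kernel 1) z a"
    using eq u a by simp
qed

section \<open>Fractional integrals belong to the fractional Sobolev spaces\<close>

lemma funpow_deriv_Suc: "(deriv ^^ k) (deriv \<phi>) = (deriv ^^ Suc k) \<phi>"
  by (simp only: funpow_Suc_right o_apply)

lemma test_functions_continuous:
  assumes "\<phi> \<in> test_functions T"
  shows "continuous_on S ((deriv ^^ k) \<phi>)"
  using assms unfolding test_functions_def
  by (intro continuous_at_imp_continuous_on ballI field_differentiable_imp_continuous_at) blast

lemma test_functions_measurable:
  assumes "\<phi> \<in> test_functions T"
  shows "(deriv ^^ k) \<phi> \<in> borel_measurable borel"
  by (intro borel_measurable_continuous_onI test_functions_continuous[OF assms])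

lemma test_functions_deriv:
  assumes \<phi>: "\<phi> \<in> test_functions T"
  shows "deriv \<phi> \<in> test_functions T"
proof -
  have "{x. deriv \<phi> x \<noteq> 0} \<subseteq> closure {x. \<phi> x \<noteq> 0}"
  proof
    fix x assume x: "x \<in> {x. deriv \<phi> x \<noteq> 0}"
    show "x \<in> closure {x. \<phi> x \<noteq> 0}"
    proof (rule ccontr)
      assume "x \<notin> closure {x. \<phi> x \<noteq> 0}"
      then have "\<forall>\<^sub>F y in nhds x. y \<in> - closure {x. \<phi> x \<noteq> 0}"
        by (intro eventually_nhds_in_open) auto
      then have "\<forall>\<^sub>F y in nhds x. \<phi> y = 0"
        using closure_subset[of "{x. \<phi> x \<noteq> 0}"] by (auto elim!: eventually_mono)
      then have "deriv \<phi> x = deriv (\<lambda>_. 0) x" by (intro deriv_cong_ev) auto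
      then show False using x by simp
    qed
  qed
  then have "closure {x. deriv \<phi> x \<noteq> 0} \<subseteq> closure {x. \<phi> x \<noteq> 0}"
    by (rule closure_minimal) simp
  moreover have "(deriv ^^ k) (deriv \<phi>) field_differentiable at x" for k x
    unfolding funpow_deriv_Suc using \<phi> unfolding test_functions_def by blast
  ultimately show ?thesis
    using \<phi> unfolding test_functions_def mem_Collect_eq by blast
qed

text \<open>By Fubini's theorem the primitive of \<open>z\<close> paired with \<open>\<phi>\<^sup>\<prime>\<close> is \<open>z\<close> paired with
  \<open>\<integral>\<^sub>s\<^sup>T \<phi>\<^sup>\<prime> = \<phi>(T) - \<phi>(s) = - \<phi>(s)\<close>.\<close>

lemma integral_by_parts_test:
  assumes z: "causal z" and \<phi>: "\<phi> \<in> test_functions T"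
  shows "(\<integral>t. indicator {0<..<T} t * (conv (frac_kernel 1) z t * deriv \<phi> t) \<partial>lborel)
    = - (\<integral>t. indicator {0<..<T} t * (z t * \<phi> t) \<partial>lborel)"
proof -
  have [measurable]: "z \<in> borel_measurable borel" using z by (simp add: causal_def)
  have [measurable]: "deriv \<phi> \<in> borel_measurable borel"
    using test_functions_measurable[OF \<phi>, of 1] by simp
  have cont: "isCont (deriv \<phi>) x" for x
    using test_functions_continuous[OF \<phi>, of UNIV 1] by (simp add: continuous_on_eq_continuous_at)
  have der: "(\<phi> has_real_derivative deriv \<phi> x) (at x)" for x
    unfolding DERIV_deriv_iff_field_differentiable
    using \<phi> unfolding test_functions_def mem_Collect_eq by (metis funpow_0)
  have \<phi>T: "\<phi> T = 0"
    using \<phi> closure_subset[of "{x. \<phi> x \<noteq> 0}"] by (fastforce simp: test_functions_def)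
  let ?Z = "trunc T z"
  let ?F = "\<lambda>(s, t). ?Z s * (indicator {0<..<T} t * (if s < t then 1 else 0) * deriv \<phi> t)"
  have F: "integrable lborel2 ?F"
  proof (rule Bochner_Integration.integrable_bound)
    have i: "integrable lborel (\<lambda>t. deriv \<phi> t * indicator {0..T} t)"
      by (rule borel_integrable_atLeastAtMost) (rule cont)
    then show "integrable lborel2 (\<lambda>x. ?Z (fst x) * (deriv \<phi> (snd x) * indicator {0..T} (snd x)))"
      by (intro integrable_pair_mult[OF lborel_pair.pair_sigma_finite_axioms] causal_trunc z)
    show "?F \<in> borel_measurable lborel2" by measurable
    show "AE x in lborel2. norm (?F x) \<le> norm (?Z (fst x) * (deriv \<phi> (snd x) * indicator {0..T} (snd x)))"
      by (intro AE_I2) (auto simp: case_prod_unfold split: split_indicator)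
  qed
  have "(\<integral>t. indicator {0<..<T} t * (conv (frac_kernel 1) z t * deriv \<phi> t) \<partial>lborel)
      = (\<integral>t. \<integral>s. ?F (s, t) \<partial>lborel \<partial>lborel)"
  proof (rule Bochner_Integration.integral_cong[OF refl])
    fix t
    have "(\<integral>s. ?F (s, t) \<partial>lborel) = (\<integral>s. (indicator {0<..<T} t * deriv \<phi> t) * (frac_kernel 1 (t - s) * z s) \<partial>lborel)"
      by (intro Bochner_Integration.integral_cong) (auto simp: frac_kernel_def trunc_def split: split_indicator)
    also have "\<dots> = (indicator {0<..<T} t * deriv \<phi> t) * conv (frac_kernel 1) z t"
      unfolding conv_def by (rule integral_mult_right_zero)
    finally show "indicator {0<..<T} t * (conv (frac_kernel 1) z t * deriv \<phi> t) = (\<integral>s. ?F (s, t) \<partial>lborel)"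
      by (simp only: mult_ac)
  qed
  also have "\<dots> = (\<integral>s. \<integral>t. ?F (s, t) \<partial>lborel \<partial>lborel)"
    using lborel_pair.Fubini_integral[of "\<lambda>s t. ?F (s, t)"] F by simp
  also have "\<dots> = (\<integral>s. - (indicator {0<..<T} s * (z s * \<phi> s)) \<partial>lborel)"
  proof (rule Bochner_Integration.integral_cong[OF refl])
    fix s
    show "(\<integral>t. ?F (s, t) \<partial>lborel) = - (indicator {0<..<T} s * (z s * \<phi> s))"
    proof (cases "0 < s \<and> s < T")
      case True
      have ae: "AE t in lborel. indicator {0<..<T} t * (if s < t then 1 else 0) * deriv \<phi> t = deriv \<phi> t * indicator {s..T} t"
        using AE_lborel_singleton[of s] AE_lborel_singleton[of T]
        by eventually_elim (use True in \<open>auto split: split_indicator\<close>)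
      have "(\<integral>t. indicator {0<..<T} t * (if s < t then 1 else 0) * deriv \<phi> t \<partial>lborel) = (\<integral>t. deriv \<phi> t * indicator {s..T} t \<partial>lborel)"
        by (rule integral_cong_AE[OF _ _ ae]) measurable
      also have "\<dots> = \<phi> T - \<phi> s"
        by (rule integral_FTC_Icc_real) (use True der cont in auto)
      finally show ?thesis using True \<phi>T by (simp add: trunc_def)
    next
      case False
      have F0: "?F (s, t) = 0" for t
        using False causal_zero[OF z, of s] by (auto simp: trunc_def split: split_indicator)
      have "s \<notin> {0<..<T}" using False by auto
      then have "indicator {0<..<T} s = (0 :: real)" by (simp only: indicator_simps not_False_eq_True)
      then show ?thesis by (simp only: F0 mult_zero_left minus_zero integral_zero)
    qed
  qed
  finally show ?thesis by simp
qed

text \<open>Each derivative is moved over by writing \<open>J\<^sup>b\<^sup>+\<^sup>1 = J\<^sup>1 J\<^sup>b\<close>.\<close>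

lemma integral_frac_integral_test:
  assumes w: "causal w" and "\<phi> \<in> test_functions T" "real k < \<alpha>"
  shows "(\<integral>t. indicator {0<..<T} t * (conv (frac_kernel \<alpha>) w t * (deriv ^^ k) \<phi> t) \<partial>lborel)
    = (- 1) ^ k * (\<integral>t. indicator {0<..<T} t * (conv (frac_kernel (\<alpha> - real k)) w t * \<phi> t) \<partial>lborel)"
  using assms(2,3)
proof (induction k arbitrary: \<phi>)
  case (Suc k)
  note \<phi>' = test_functions_deriv[OF Suc.prems(1)]
  have [measurable]: "w \<in> borel_measurable borel" using w by (simp add: causal_def)
  have [measurable]: "deriv \<phi> \<in> borel_measurable borel"
    using test_functions_measurable[OF Suc.prems(1), of 1] by simp
  let ?b = "\<alpha> - real (Suc k)"
  have b: "0 < ?b" using Suc.prems by simp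
  have "(\<integral>t. indicator {0<..<T} t * (conv (frac_kernel \<alpha>) w t * (deriv ^^ Suc k) \<phi> t) \<partial>lborel)
      = (- 1) ^ k * (\<integral>t. indicator {0<..<T} t * (conv (frac_kernel (\<alpha> - real k)) w t * deriv \<phi> t) \<partial>lborel)"
    unfolding funpow_deriv_Suc[symmetric] using Suc.prems by (intro Suc.IH[OF \<phi>']) simp
  also have "(\<integral>t. indicator {0<..<T} t * (conv (frac_kernel (\<alpha> - real k)) w t * deriv \<phi> t) \<partial>lborel)
      = (\<integral>t. indicator {0<..<T} t * (conv (frac_kernel 1) (conv (frac_kernel ?b) w) t * deriv \<phi> t) \<partial>lborel)"
  proof (rule integral_cong_AE)
    have "1 + ?b = \<alpha> - real k" by simp
    then have "AE t in lborel. conv (frac_kernel 1) (conv (frac_kernel ?b) w) t = conv (frac_kernel (\<alpha> - real k)) w t"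
      using conv_conv_frac_kernel[OF zero_less_one b w] by simp
    then show "AE t in lborel. indicator {0<..<T} t * (conv (frac_kernel (\<alpha> - real k)) w t * deriv \<phi> t)
        = indicator {0<..<T} t * (conv (frac_kernel 1) (conv (frac_kernel ?b) w) t * deriv \<phi> t)"
      by eventually_elim simp
  qed measurable
  also have "\<dots> = - (\<integral>t. indicator {0<..<T} t * (conv (frac_kernel ?b) w t * \<phi> t) \<partial>lborel)"
    by (intro integral_by_parts_test causal_conv causal_frac_kernel b w Suc.prems)
  finally show ?case by simp
qed simp

lemma weak_deriv_frac_integral:
  assumes w: "causal w" and k: "real k < \<alpha>"
    and v: "AE t in lborel. 0 < t \<and> t < T \<longrightarrow> v t = conv (frac_kernel \<alpha>) w t"
  shows "weak_deriv T k v (conv (frac_kernel (\<alpha> - real k)) w)"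
  unfolding weak_deriv_def
proof
  fix \<phi> assume \<phi>: "\<phi> \<in> test_functions T"
  have [measurable]: "w \<in> borel_measurable borel" using w by (simp add: causal_def)
  have [measurable]: "(deriv ^^ k) \<phi> \<in> borel_measurable borel" "\<phi> \<in> borel_measurable borel"
    using test_functions_measurable[OF \<phi>, of k] test_functions_measurable[OF \<phi>, of 0] by simp_all
  have "AE t in lborel. t \<in> {0<..<T} \<longrightarrow> v t * (deriv ^^ k) \<phi> t = conv (frac_kernel \<alpha>) w t * (deriv ^^ k) \<phi> t"
    using v by eventually_elim simp
  from lebesgue_on_AE_borel(3)[OF _ _ this]
  have 1: "(LINT t|leb_interval T. v t * (deriv ^^ k) \<phi> t)
      = (\<integral>t. indicator {0<..<T} t * (conv (frac_kernel \<alpha>) w t * (deriv ^^ k) \<phi> t) \<partial>lborel)" by simp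
  have 2: "(LINT t|leb_interval T. conv (frac_kernel (\<alpha> - real k)) w t * \<phi> t)
      = (\<integral>t. indicator {0<..<T} t * (conv (frac_kernel (\<alpha> - real k)) w t * \<phi> t) \<partial>lborel)"
    by (rule lebesgue_on_AE_borel(3)) simp_all
  show "(LINT t|leb_interval T. v t * (deriv ^^ k) \<phi> t)
      = (- 1) ^ k * (LINT t|leb_interval T. conv (frac_kernel (\<alpha> - real k)) w t * \<phi> t)"
    unfolding 1 2 by (rule integral_frac_integral_test[OF w \<phi> k])
qed

text \<open>For \<open>b > 1\<close> the function is the primitive of \<open>J\<^sup>b\<^sup>-\<^sup>1 w\<close>; for \<open>1/2 < b < 1\<close> it is Hoelder continuous.\<close>

lemma zero_at_0_frac_integral:
  assumes w: "L2_supp T w" and b: "1/2 < b" "b \<noteq> 1"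
  shows "zero_at_0 T (conv (frac_kernel b) w)"
proof (cases "b < 1")
  case True
  note c = L2_supp_causal[OF w]
  show ?thesis
    unfolding zero_at_0_def
    using continuous_on_frac_integral[OF b(1) True w] conv_zero[OF causal_frac_kernel c, of b 0] b by auto
next
  case False
  note c = L2_supp_causal[OF w]
  have b1: "0 < b - 1" using False b by simp
  note cc = causal_conv[OF causal_frac_kernel[OF b1] c]
  have "AE t in lborel. conv (frac_kernel 1) (conv (frac_kernel (b - 1)) w) t = conv (frac_kernel b) w t"
    using conv_conv_frac_kernel[OF zero_less_one b1 c] by simp
  then have "AE t in leb_interval T. conv (frac_kernel b) w t = conv (frac_kernel 1) (conv (frac_kernel (b - 1)) w) t"
    unfolding AE_leb_interval_iff by eventually_elim simp
  then show ?thesis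
    unfolding zero_at_0_def
    using continuous_on_conv_frac_kernel_1[OF cc] conv_zero[OF causal_frac_kernel cc, of 1 0] by auto
qed

lemma frac_integral_in_L2:
  assumes w: "L2_supp T w" and b: "0 < b"
    and v: "AE t in lborel. 0 < t \<and> t < T \<longrightarrow> v t = conv (frac_kernel b) w t"
  shows "v \<in> L2 T"
  by (rule L2I[OF L2_supp_conv[OF causal_frac_kernel[OF b] w]]) (use v in eventually_elim, simp)

lemma frac_integral_in_H_unit:
  assumes T: "0 < T" and w: "L2_supp T w" and \<sigma>: "0 < \<sigma>" "\<sigma> < 1"
  shows "conv (frac_kernel \<sigma>) w \<in> H_unit \<sigma> T"
proof -
  let ?v = "conv (frac_kernel \<sigma>) w"
  have s: "?v \<in> slobodeckij \<sigma> T"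
    using frac_integral_slobodeckij_finite[OF \<sigma> w T] frac_integral_in_L2[OF w \<sigma>(1), of ?v]
    by (simp add: slobodeckij_def)
  consider "\<sigma> < 1/2" | "\<sigma> = 1/2" | "1/2 < \<sigma>" by linarith
  then show ?thesis
  proof cases
    case 1
    then show ?thesis using s by (simp add: H_unit_def)
  next
    case 2
    have s1: "2 * \<sigma> = 1" using 2 by simp
    have "(\<integral>\<^sup>+t. ennreal ((?v t)\<^sup>2 / t) \<partial>leb_interval T) = (\<integral>\<^sup>+t. ennreal ((?v t)\<^sup>2 / t powr (2 * \<sigma>)) \<partial>leb_interval T)"
      unfolding s1 by (intro nn_integral_cong) (auto simp: space_restrict_space)
    also have "\<dots> < \<infinity>" by (rule frac_integral_Hardy_finite[OF \<sigma> w T])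
    finally show ?thesis
      unfolding H_unit_def 2 using s[unfolded 2] by simp
  next
    case 3
    then show ?thesis
      using s \<sigma> zero_at_0_frac_integral[OF w 3] by (simp add: H_unit_def)
  qed
qed

text \<open>With \<open>\<alpha> = m + \<sigma>\<close> and \<open>0 < \<sigma> < 1\<close>, the weak derivative of order \<open>k \<le> m\<close> is \<open>J\<^sup>\<alpha>\<^sup>-\<^sup>k w\<close>. For \<open>k < m\<close> its order
  exceeds \<open>1\<close>, which gives the vanishing at \<open>0\<close>; the last one, \<open>J\<^sup>\<sigma> w\<close>, is in the space of order \<open>\<sigma>\<close>.\<close>

lemma frac_integral_in_H_frac:
  assumes T: "0 < T" and \<alpha>: "0 < \<alpha>" "\<alpha> \<notin> \<nat>" and w: "L2_supp T w"
    and v: "AE t in lborel. 0 < t \<and> t < T \<longrightarrow> v t = conv (frac_kernel \<alpha>) w t"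
  shows "v \<in> H_frac \<alpha> T"
proof -
  note c = L2_supp_causal[OF w]
  define m where "m = nat (\<lceil>\<alpha>\<rceil> - 1)"
  have m: "real m < \<alpha>" "\<alpha> < real m + 1"
  proof -
    have "1 \<le> \<lceil>\<alpha>\<rceil>" using \<alpha> by linarith
    then have rm: "real m = of_int \<lceil>\<alpha>\<rceil> - 1" by (simp add: m_def)
    then show "real m < \<alpha>" by linarith
    have "\<alpha> \<noteq> real (Suc m)" using \<alpha>(2) of_nat_in_Nats by metis
    then have "\<alpha> \<noteq> real m + 1" by simp
    then show "\<alpha> < real m + 1" using rm le_of_int_ceiling[of \<alpha>] by linarith
  qed
  have L2: "conv (frac_kernel (\<alpha> - real k)) w \<in> L2 T" if "k \<le> m" for k
    using m that by (intro frac_integral_in_L2[OF w]) auto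
  have wd: "weak_deriv T k v (conv (frac_kernel (\<alpha> - real k)) w)" if "k \<le> m" for k
    using m that by (intro weak_deriv_frac_integral[OF c _ v]) simp
  have "v \<in> sobolev m T"
    using frac_integral_in_L2[OF w \<alpha>(1) v] L2 wd by (auto simp: sobolev_def)
  moreover have "zero_at_0 T (conv (frac_kernel (\<alpha> - real k)) w)" if "k < m" for k
  proof -
    have "real k + 1 \<le> real m" using that by linarith
    then show ?thesis using m by (intro zero_at_0_frac_integral[OF w]) linarith+
  qed
  ultimately have "v \<in> H_nat m T"
    unfolding H_nat_def using L2 wd by (blast intro: less_imp_le)
  moreover have "conv (frac_kernel (\<alpha> - real m)) w \<in> H_unit (\<alpha> - real m) T"
    using m by (intro frac_integral_in_H_unit T w) auto
  ultimately show ?thesis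
    using wd[of m] unfolding H_frac_def m_def[symmetric] Let_def by blast
qed

section \<open>Existence, uniqueness and representation of the solution\<close>

text \<open>The difference of two solutions is \<open>J\<^sup>\<alpha> D\<close>, where \<open>D\<close>, the difference of the two right-hand sides, equals
  \<open>- \<lambda> J\<^sup>\<alpha> D\<close>.\<close>

lemma solution_unique:
  assumes \<alpha>: "0 < \<alpha>" and v: "is_solution \<alpha> T lam a f v" and u: "is_solution \<alpha> T lam a f u"
  shows "AE t in leb_interval T. v t = u t"
proof -
  have rep: "\<exists>w'. L2_supp T w'
      \<and> (AE t in lborel. 0 < t \<and> t < T \<longrightarrow> - lam * x t + f t = w' t)
      \<and> (AE t in lborel. 0 < t \<and> t < T \<longrightarrow> x t - a = conv (frac_kernel \<alpha>) w' t)"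
    if "is_solution \<alpha> T lam a f x" for x
  proof -
    have L: "(\<lambda>t. - lam * x t + f t) \<in> L2 T"
      and eq: "AE t in lborel. 0 < t \<and> t < T \<longrightarrow> frac_integral \<alpha> (\<lambda>t. - lam * x t + f t) t = x t - a"
      using that by (auto simp: is_solution_def has_frac_deriv_def AE_leb_interval_iff)
    obtain w' where w': "L2_supp T w'" "AE t in lborel. 0 < t \<and> t < T \<longrightarrow> - lam * x t + f t = w' t"
      using L2E[OF L] by blast
    have "frac_integral \<alpha> (\<lambda>t. - lam * x t + f t) t = conv (frac_kernel \<alpha>) w' t" if "t \<le> T" for t
      by (rule frac_integral_eq_conv[OF \<alpha> L2_supp_causal[OF w'(1)] w'(2) that])
    then have "AE t in lborel. 0 < t \<and> t < T \<longrightarrow> x t - a = conv (frac_kernel \<alpha>) w' t"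
      using eq by (auto elim!: eventually_mono)
    with w' show ?thesis by blast
  qed
  obtain p where p: "L2_supp T p" "AE t in lborel. 0 < t \<and> t < T \<longrightarrow> - lam * v t + f t = p t"
      "AE t in lborel. 0 < t \<and> t < T \<longrightarrow> v t - a = conv (frac_kernel \<alpha>) p t"
    using rep[OF v] by blast
  obtain q where q: "L2_supp T q" "AE t in lborel. 0 < t \<and> t < T \<longrightarrow> - lam * u t + f t = q t"
      "AE t in lborel. 0 < t \<and> t < T \<longrightarrow> u t - a = conv (frac_kernel \<alpha>) q t"
    using rep[OF u] by blast
  let ?K = "frac_kernel \<alpha>" and ?D = "\<lambda>t. p t + (- 1) * q t"
  note cp = L2_supp_causal[OF p(1)] and cq = L2_supp_causal[OF q(1)]
  have D: "causal ?D" by (rule causal_lincomb[OF cp cq])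
  have KD: "AE t in lborel. 0 < t \<and> t < T \<longrightarrow> v t - u t = conv ?K ?D t"
    using causal_conv_lincomb[OF causal_frac_kernel[OF \<alpha>] cp cq, of "- 1"] p(3) q(3)
    by eventually_elim auto
  have "AE t in lborel. 0 < t \<and> t < T \<longrightarrow> ?D t = - lam * conv ?K ?D t"
    using KD p(2) q(2)
  proof eventually_elim
    case (elim t)
    show ?case
    proof
      assume t: "0 < t \<and> t < T"
      have "?D t = - lam * (v t - u t)" using elim t by (simp add: algebra_simps)
      then show "?D t = - lam * conv ?K ?D t" using elim t by simp
    qed
  qed
  from resolvent_unique[OF \<alpha> D this] KD
  have "AE t in lborel. 0 < t \<and> t < T \<longrightarrow> v t = u t"
    by eventually_elim auto
  then show ?thesis by (simp add: AE_leb_interval_iff)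
qed

text \<open>By the identity for \<open>E\<^bsub>\<alpha>,1\<^esub>\<close> the term with \<open>a\<close> is \<open>a\<close> plus the response to the source \<open>- \<lambda> a\<close>.\<close>

lemma Mittag_Leffler_representation:
  assumes T: "0 < T" and \<alpha>: "0 < \<alpha>" and f': "L2_supp T f'"
    and eq: "AE t in lborel. 0 < t \<and> t < T \<longrightarrow> f t = f' t"
  shows "AE t in lborel. 0 < t \<and> t < T \<longrightarrow>
    a * Mittag_Leffler \<alpha> 1 (- lam * t powr \<alpha>)
      + (LINT s|lebesgue_on {0<..<t}. (t - s) powr (\<alpha> - 1) * Mittag_Leffler \<alpha> \<alpha> (- lam * (t - s) powr \<alpha>) * f s)
    = a + conv (resolvent_kernel \<alpha> lam) (\<lambda>s. f' s + (- lam * a) * indicator {0<..<T} s) t"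
proof -
  let ?R = "resolvent_kernel \<alpha> lam" and ?one = "\<lambda>s. indicator {0<..<T} s :: real"
  note R = causal_resolvent_kernel[OF \<alpha>, of lam] and cf = L2_supp_causal[OF f']
  have c1: "causal ?one"
    by (rule causalI_integrable) (use T in auto)
  show ?thesis
    using causal_conv_lincomb[OF R cf c1, of "- lam * a"]
  proof eventually_elim
    case (elim t)
    show ?case
    proof
      assume t: "0 < t \<and> t < T"
      have "conv (frac_kernel 1) ?R t = conv ?R (frac_kernel 1) t" by (rule conv_commute)
      also have "\<dots> = conv ?R ?one t"
      proof (rule conv_cong_upto[OF R _ c1])
        show "AE s in lborel. s < T \<longrightarrow> frac_kernel 1 s = ?one s"
          by (intro AE_I2) (auto simp: frac_kernel_def split: split_indicator)
      qed (use t causal_frac_kernel in auto)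
      finally have E: "Mittag_Leffler \<alpha> 1 (- lam * t powr \<alpha>) = 1 - lam * conv ?R ?one t"
        using Mittag_Leffler_eq_conv[OF \<alpha>, of t lam] t by simp
      have I: "(LINT s|lebesgue_on {0<..<t}. (t - s) powr (\<alpha> - 1) * Mittag_Leffler \<alpha> \<alpha> (- lam * (t - s) powr \<alpha>) * f s)
          = conv ?R f' t"
        by (rule Volterra_integral_eq_conv[OF R cf eq]) (use t in \<open>auto simp: resolvent_kernel_def\<close>)
      show "a * Mittag_Leffler \<alpha> 1 (- lam * t powr \<alpha>)
          + (LINT s|lebesgue_on {0<..<t}. (t - s) powr (\<alpha> - 1) * Mittag_Leffler \<alpha> \<alpha> (- lam * (t - s) powr \<alpha>) * f s)
        = a + conv ?R (\<lambda>s. f' s + (- lam * a) * ?one s) t"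
        unfolding E I elim by (simp add: algebra_simps)
    qed
  qed
qed

text \<open>If \<open>u - a = r * g\<close> with \<open>g = f - \<lambda> a\<close>, then the right-hand side \<open>f - \<lambda> u\<close> equals \<open>g - \<lambda> r * g\<close>, whose
  fractional integral is again \<open>r * g\<close>. It is square-integrable by Young's inequality, so \<open>u - a\<close> is the
  fractional integral of a function in \<open>L\<^sup>2\<close>.\<close>

lemma Mittag_Leffler_is_solution:
  assumes T: "0 < T" and \<alpha>: "0 < \<alpha>" "\<alpha> \<notin> \<nat>" and f': "L2_supp T f'"
    and eq: "AE t in lborel. 0 < t \<and> t < T \<longrightarrow> f t = f' t"
    and u: "AE t in lborel. 0 < t \<and> t < T \<longrightarrow>
      u t = a + conv (resolvent_kernel \<alpha> lam) (\<lambda>s. f' s + (- lam * a) * indicator {0<..<T} s) t"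
  shows "is_solution \<alpha> T lam a f u"
proof -
  let ?K = "frac_kernel \<alpha>" and ?R = "resolvent_kernel \<alpha> lam" and ?one = "\<lambda>s. indicator {0<..<T} s :: real"
  let ?g = "\<lambda>s. f' s + (- lam * a) * ?one s"
  note R = causal_resolvent_kernel[OF \<alpha>(1), of lam] and K = causal_frac_kernel[OF \<alpha>(1)]
  have "L2_supp T (\<lambda>s. indicator {0<..<T} s * 1)"
    by (rule L2_suppI) (use T in auto)
  then have g: "L2_supp T ?g"
    using L2_supp_lincomb[OF f', of ?one "- lam * a"] by simp
  note cg = L2_supp_causal[OF g]
  let ?w = "\<lambda>s. ?g s + (- lam) * (indicator {0<..<T} s * conv ?R ?g s)"
  have w: "L2_supp T ?w"
    by (rule L2_supp_lincomb[OF g L2_supp_conv[OF R g]])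
  have Kw: "AE t in lborel. 0 < t \<and> t < T \<longrightarrow> u t - a = conv ?K ?w t"
    using u resolvent_solves[OF \<alpha>(1) cg, of lam]
  proof eventually_elim
    case (elim t)
    show ?case
    proof
      assume t: "0 < t \<and> t < T"
      have "conv ?K ?w t = conv ?K (\<lambda>s. ?g s + (- lam) * conv ?R ?g s) t"
      proof (rule conv_cong_upto[OF K L2_supp_causal[OF w] causal_lincomb[OF cg causal_conv[OF R cg]]])
        show "AE s in lborel. s < T \<longrightarrow> ?w s = ?g s + (- lam) * conv ?R ?g s"
        proof (intro AE_I2 impI)
          fix s assume "s < T"
          then show "?w s = ?g s + (- lam) * conv ?R ?g s"
            using conv_zero[OF R cg, of s] by (cases "0 < s") auto
        qed
      qed (use t in simp)
      with elim t show "u t - a = conv ?K ?w t" by simp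
    qed
  qed
  have eqw: "AE t in lborel. 0 < t \<and> t < T \<longrightarrow> - lam * u t + f t = ?w t"
    using u eq by eventually_elim (auto simp: algebra_simps)
  have "(\<lambda>t. u t - a) \<in> H_frac \<alpha> T"
    by (rule frac_integral_in_H_frac[OF T \<alpha> w Kw])
  moreover have "(\<lambda>t. - lam * u t + f t) \<in> L2 T"
    by (rule L2I[OF w eqw])
  moreover have "AE t in leb_interval T. frac_integral \<alpha> (\<lambda>t. - lam * u t + f t) t = u t - a"
  proof -
    have "frac_integral \<alpha> (\<lambda>t. - lam * u t + f t) t = conv ?K ?w t" if "t \<le> T" for t
      by (rule frac_integral_eq_conv[OF \<alpha>(1) L2_supp_causal[OF w] eqw that])
    then show ?thesis
      unfolding AE_leb_interval_iff using Kw by (auto elim!: eventually_mono)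
  qed
  ultimately show ?thesis by (simp add: is_solution_def has_frac_deriv_def)
qed

theorem theorem5p1:
  fixes T \<alpha> lam a :: real and f :: "real \<Rightarrow> real"
  assumes "T > 0" and "\<alpha> > 0" and "\<alpha> \<notin> \<nat>" and "f \<in> L2 T"
  shows "\<exists>u. is_solution \<alpha> T lam a f u
           \<and> (\<forall>v. is_solution \<alpha> T lam a f v \<longrightarrow> (AE t in leb_interval T. v t = u t))
           \<and> (AE t in leb_interval T.
                u t = a * Mittag_Leffler \<alpha> 1 (- lam * t powr \<alpha>)
                    + (LINT s|lebesgue_on {0<..<t}.
                         (t - s) powr (\<alpha> - 1)
                         * Mittag_Leffler \<alpha> \<alpha> (- lam * (t - s) powr \<alpha>) * f s))"
proof -
  define u where "u t = a * Mittag_Leffler \<alpha> 1 (- lam * t powr \<alpha>)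
      + (LINT s|lebesgue_on {0<..<t}. (t - s) powr (\<alpha> - 1) * Mittag_Leffler \<alpha> \<alpha> (- lam * (t - s) powr \<alpha>) * f s)"
    for t
  obtain f' where f': "L2_supp T f'" "AE t in lborel. 0 < t \<and> t < T \<longrightarrow> f t = f' t"
    using L2E[OF assms(4)] by blast
  have "is_solution \<alpha> T lam a f u"
    using Mittag_Leffler_representation[OF assms(1,2) f', of a lam]
    by (intro Mittag_Leffler_is_solution[OF assms(1-3) f']) (simp add: u_def)
  moreover have "AE t in leb_interval T. v t = u t" if "is_solution \<alpha> T lam a f v" for v
    using solution_unique[OF assms(2) that] calculation by blast
  ultimately show ?thesis
    by (intro exI[of _ u] conjI) (auto simp: u_def)
qed

end
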